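(* Let $\mathfrak g$ be a finite-dimensional complex Lie algebra whose Jordan–Kronecker invariants have Kronecker sizes $2k_1-1,\dots,2k_q-1$, among which there is no $3\times3$ Kronecker block (no $k_j=2$) and at most one $1\times1$ Kronecker block (at most one $k_j=1$). Let $J_{um}$ be the number of unique Jordan tuples with multiple maxima among the Jordan–Kronecker invariants of $\mathfrak g$. Then $J_{um}\le k_1+\dots+k_q$.
   Context: For $x\in\mathfrak g^*$, let $\mathcal A_x$ be the skew form $(\xi,\eta)\mapsto\langle x,[\xi,\eta]\rangle$. By the Jordan–Kronecker theorem, a pair of skew forms on a finite-dimensional complex vector space admits a basis in which both are block-diagonal with Jordan $2n\times2n$ blocks with eigenvalues $\mu\in\mathbb C\cup\{\infty\}$ and Kronecker $(2k-1)\times(2k-1)$ blocks ($k\ge1$); block data grouped by eigenvalue are unique. The JK invariants of $\mathfrak g$ are, for $(x,a)$ in a nonempty Zariski open subset of $\mathfrak g^*\times\mathfrak g^*$ (where they are constant), the Kronecker sizes of $(\mathcal A_x,\mathcal A_a)$ and the Jordan tuples $J_{\lambda_i}(2n_{i1},\dots,2n_{is_i})$, $n_{i1}\ge\dots\ge n_{is_i}$, giving for each distinct eigenvalue $\lambda_i$ the sizes of the Jordan blocks with that eigenvalue; they form a multiset. A Jordan tuple has multiple maxima if $s_i\ge2$ and $n_{i1}=n_{i2}$. A Jordan tuple is unique if its tuple of sizes $(2n_{i1},\dots,2n_{is_i})$ differs from the tuple of sizes of every other Jordan tuple of $\mathfrak g$. *)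

theory Defs
  imports "Jordan_Normal_Form.Jordan_Normal_Form" "HOL-Library.Multiset"
begin

text \<open>A complex Lie algebra of dimension n with basis e_0..e_(n-1) is given by
  structure constants c i j k, [e_i, e_j] = sum_k c i j k e_k, subject to
  skew-symmetry and the Jacobi identity.\<close>

definition lie_structure_constants :: "nat \<Rightarrow> (nat \<Rightarrow> nat \<Rightarrow> nat \<Rightarrow> complex) \<Rightarrow> bool" where
  "lie_structure_constants n c \<longleftrightarrow>
     (\<forall>i<n. \<forall>j<n. \<forall>k<n. c i j k = - c j i k) \<and>
     (\<forall>i<n. \<forall>j<n. \<forall>l<n. \<forall>p<n.
        (\<Sum>m<n. c j l m * c i m p) + (\<Sum>m<n. c l i m * c j m p) + (\<Sum>m<n. c i j m * c l m p) = 0)"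

text \<open>For x in g^* (coordinates w.r.t. the dual basis), the skew form
  A_x(xi, eta) = <x, [xi, eta]>, as a Gram matrix in the basis e_i.\<close>

definition lie_form :: "nat \<Rightarrow> (nat \<Rightarrow> nat \<Rightarrow> nat \<Rightarrow> complex) \<Rightarrow> complex vec \<Rightarrow> complex mat" where
  "lie_form n c x = mat n n (\<lambda>(i,j). \<Sum>k<n. x $ k * c i j k)"

text \<open>Blocks: JK_Jordan (Some mu) m is a Jordan block of size 2m with eigenvalue mu,
  JK_Jordan None m a Jordan block of size 2m with eigenvalue infinity,
  JK_Kronecker k a Kronecker block of size 2k-1.\<close>

datatype jk_block = JK_Jordan "complex option" nat | JK_Kronecker nat

definition std_skew :: "nat \<Rightarrow> complex mat" where
  "std_skew m = four_block_mat (0\<^sub>m m m) (1\<^sub>m m) (- 1\<^sub>m m) (0\<^sub>m m m)"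

definition skew_of :: "complex mat \<Rightarrow> complex mat" where
  "skew_of M = four_block_mat (0\<^sub>m (dim_row M) (dim_row M)) M (- transpose_mat M) (0\<^sub>m (dim_col M) (dim_col M))"

definition kron_M1 :: "nat \<Rightarrow> complex mat" where
  "kron_M1 k = mat k (k - 1) (\<lambda>(i,j). if i = j then 1 else 0)"

definition kron_M2 :: "nat \<Rightarrow> complex mat" where
  "kron_M2 k = mat k (k - 1) (\<lambda>(i,j). if i = Suc j then 1 else 0)"

fun block_A :: "jk_block \<Rightarrow> complex mat" where
  "block_A (JK_Jordan (Some mu) m) = skew_of (jordan_block m mu)"
| "block_A (JK_Jordan None m) = std_skew m"
| "block_A (JK_Kronecker k) = skew_of (kron_M1 k)"

fun block_B :: "jk_block \<Rightarrow> complex mat" where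
  "block_B (JK_Jordan (Some mu) m) = std_skew m"
| "block_B (JK_Jordan None m) = skew_of (jordan_block m 0)"
| "block_B (JK_Kronecker k) = skew_of (kron_M2 k)"

fun jk_block_ok :: "jk_block \<Rightarrow> bool" where
  "jk_block_ok (JK_Jordan _ m) \<longleftrightarrow> m \<ge> 1"
| "jk_block_ok (JK_Kronecker k) \<longleftrightarrow> k \<ge> 1"

definition jk_decomposition :: "nat \<Rightarrow> complex mat \<Rightarrow> complex mat \<Rightarrow> jk_block list \<Rightarrow> bool" where
  "jk_decomposition n A B bs \<longleftrightarrow>
     (\<forall>b\<in>set bs. jk_block_ok b) \<and>
     (\<exists>P \<in> carrier_mat n n. invertible_mat P \<and>
        transpose_mat P * A * P = diag_block_mat (map block_A bs) \<and>
        transpose_mat P * B * P = diag_block_mat (map block_B bs))"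

definition kronecker_ks :: "jk_block list \<Rightarrow> nat multiset" where
  "kronecker_ks bs = mset [k. JK_Kronecker k \<leftarrow> bs]"

definition jordan_eigenvalues :: "jk_block list \<Rightarrow> complex option set" where
  "jordan_eigenvalues bs = {mu. \<exists>m. JK_Jordan mu m \<in> set bs}"

text \<open>Jordan tuples: for each distinct eigenvalue, the tuple (as a multiset, i.e. up
  to the descending ordering) of half-sizes n_ij of the Jordan blocks with that
  eigenvalue; the eigenvalues themselves are forgotten. These form a multiset.\<close>

definition jordan_tuples :: "jk_block list \<Rightarrow> nat multiset multiset" where
  "jordan_tuples bs =
     image_mset (\<lambda>mu. mset [m. JK_Jordan nu m \<leftarrow> bs, nu = mu]) (mset_set (jordan_eigenvalues bs))"

definition jk_type :: "jk_block list \<Rightarrow> nat multiset \<times> nat multiset multiset" where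
  "jk_type bs = (kronecker_ks bs, jordan_tuples bs)"

inductive_set poly_fun :: "nat \<Rightarrow> (complex vec \<times> complex vec \<Rightarrow> complex) set" for n where
  const: "(\<lambda>_. c) \<in> poly_fun n"
| coord1: "i < n \<Longrightarrow> (\<lambda>(x,a). x $ i) \<in> poly_fun n"
| coord2: "i < n \<Longrightarrow> (\<lambda>(x,a). a $ i) \<in> poly_fun n"
| add: "p \<in> poly_fun n \<Longrightarrow> q \<in> poly_fun n \<Longrightarrow> (\<lambda>v. p v + q v) \<in> poly_fun n"
| mult: "p \<in> poly_fun n \<Longrightarrow> q \<in> poly_fun n \<Longrightarrow> (\<lambda>v. p v * q v) \<in> poly_fun n"

definition zariski_open :: "nat \<Rightarrow> (complex vec \<times> complex vec) set \<Rightarrow> bool" where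
  "zariski_open n U \<longleftrightarrow>
     (\<exists>S \<subseteq> poly_fun n. U = {(x,a) \<in> carrier_vec n \<times> carrier_vec n. \<exists>p\<in>S. p (x,a) \<noteq> 0})"

definition lie_jk_invariants :: "nat \<Rightarrow> (nat \<Rightarrow> nat \<Rightarrow> nat \<Rightarrow> complex) \<Rightarrow>
    nat multiset \<times> nat multiset multiset \<Rightarrow> bool" where
  "lie_jk_invariants n c T \<longleftrightarrow>
     (\<exists>U. zariski_open n U \<and> U \<noteq> {} \<and>
        (\<forall>(x,a)\<in>U. \<exists>bs. jk_decomposition n (lie_form n c x) (lie_form n c a) bs \<and> jk_type bs = T))"

definition multiple_maxima :: "nat multiset \<Rightarrow> bool" where
  "multiple_maxima t \<longleftrightarrow> size t \<ge> 2 \<and> count t (Max (set_mset t)) \<ge> 2"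

definition J_um :: "nat multiset multiset \<Rightarrow> nat" where
  "J_um JT = card {t \<in> set_mset JT. count JT t = 1 \<and> multiple_maxima t}"

end

theory Submission
  imports Defs
begin

text \<open>
  Fix a generic \<open>a\<close>. The eigenvalue of a unique Jordan tuple is a single-valued algebraic function of
  \<open>x\<close>, hence rational; it is integral and grows at most linearly on lines, so it is a linear form
  \<open>x \<mapsto> \<langle>x, \<xi>\<rangle>\<close> with \<open>\<langle>a, \<xi>\<rangle> = 1\<close>. The generic point \<open>y\<close> of the hyperplane
  \<open>\<langle>y, \<xi>\<rangle> = 0\<close> is singular with a Jordan structure of constant type. To first order, this constancy
  forces the bracket of two kernel elements of the pencil \<open>A\<^sub>y + t A\<^sub>a\<close> modulo \<open>t ^ m\<close>, with \<open>m\<close> the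
  largest block, to be \<open>c t ^ (m - 1) \<xi>\<close> modulo \<open>t ^ m\<close>.
  Together with the Jacobi identity this gives \<open>\<xi> \<in> Ker A\<^sub>y\<close>, so \<open>\<xi>\<close> spans a one-dimensional ideal, and,
  if there are two blocks of size \<open>m\<close>, that \<open>\<xi>\<close> is orthogonal to the Jordan part of its eigenvalue (a
  two-form \<open>\<omega>\<close> of rank at least four admits no one-form \<open>\<theta> \<noteq> 0\<close> with
  \<open>\<omega> \<and> \<theta> = 0\<close>). Hence \<open>\<xi>\<close> lies in the sum of the kernels of the regular forms, which has dimension
  \<open>k\<^sub>1 + \<dots> + k\<^sub>q\<close>. Two such vectors \<open>\<xi>\<close>, \<open>\<xi>'\<close> of equal weight would give the kernel vector
  \<open>\<langle>x, \<xi>'\<rangle> \<xi> - \<langle>x, \<xi>\<rangle> \<xi>'\<close>, linear in \<open>x\<close>, which the assumptions on the small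
  Kronecker blocks exclude; so the weights are distinct and the vectors are linearly independent.
\<close>


section \<open>Polynomial functions\<close>

text \<open>The obstacle is that eigenvalues are branches rather than functions of \<open>x\<close>,
  and that a Jordan type is not visibly algebraic. Ranks handle both. The pencil at
  \<open>(x, l)\<close>, taken modulo \<open>t ^ j\<close> and written as a complex matrix, has
  corank \<open>j * q + 2 * (\<Sum>m. min m j)\<close>, where \<open>q\<close> counts the Kronecker
  blocks and \<open>m\<close> runs over the half-sizes of the Jordan blocks with eigenvalue
  \<open>l\<close>. These numbers for all \<open>j\<close> determine the tuple, and a rank is a
  condition on minors, which are polynomial in \<open>(x, l)\<close>. So all conjugates of a branch
  carry the same tuple, and a unique tuple leaves room for one conjugate only.

  The same matrices give the first-order statement: where a linear family of matrices has maximal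
  rank, its derivative pairs left and right kernel vectors to zero.

  The kernel of a Kronecker block of size \<open>2k - 1\<close> is generated by a vector polynomial
  of degree \<open>k - 1\<close> in the pencil parameter. A kernel family of degree one therefore
  meets only \<open>k = 1\<close> and \<open>k = 2\<close>, which is where the hypothesis on small
  blocks enters.\<close>

inductive_set polynomial_funs :: "((nat \<Rightarrow> complex) \<Rightarrow> complex) set" where
  const: "(\<lambda>_. c) \<in> polynomial_funs"
| coord: "(\<lambda>x. x i) \<in> polynomial_funs"
| add: "p \<in> polynomial_funs \<Longrightarrow> q \<in> polynomial_funs \<Longrightarrow> (\<lambda>x. p x + q x) \<in> polynomial_funs"
| mult: "p \<in> polynomial_funs \<Longrightarrow> q \<in> polynomial_funs \<Longrightarrow> (\<lambda>x. p x * q x) \<in> polynomial_funs"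

text \<open>Determinants have to be recognised as polynomial in a point, in a parameter on a line,
  and in a point together with an eigenvalue; one abstract algebra of functions serves all
  three.\<close>

locale fun_algebra =
  fixes C :: "('a \<Rightarrow> complex) set"
  assumes const: "(\<lambda>_. c) \<in> C"
    and add: "p \<in> C \<Longrightarrow> q \<in> C \<Longrightarrow> (\<lambda>x. p x + q x) \<in> C"
    and mult: "p \<in> C \<Longrightarrow> q \<in> C \<Longrightarrow> (\<lambda>x. p x * q x) \<in> C"
begin

lemma uminus: "p \<in> C \<Longrightarrow> (\<lambda>x. - p x) \<in> C"
  using mult[OF const[of "-1"], of p] by simp

lemma diff: "p \<in> C \<Longrightarrow> q \<in> C \<Longrightarrow> (\<lambda>x. p x - q x) \<in> C"
  using add[OF _ uminus, of p q] by simp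

lemma sum: "(\<And>i. i \<in> I \<Longrightarrow> f i \<in> C) \<Longrightarrow> (\<lambda>x. \<Sum>i\<in>I. f i x) \<in> C"
  by (induction I rule: infinite_finite_induct) (auto intro: const add)

lemma prod: "(\<And>i. i \<in> I \<Longrightarrow> f i \<in> C) \<Longrightarrow> (\<lambda>x. \<Prod>i\<in>I. f i x) \<in> C"
  by (induction I rule: infinite_finite_induct) (auto intro: const mult)

lemma power: "p \<in> C \<Longrightarrow> (\<lambda>x. p x ^ k) \<in> C"
  by (induction k) (auto intro: const mult)

lemma det:
  assumes M: "\<And>x. M x \<in> carrier_mat k k"
    and C: "\<And>i j. i < k \<Longrightarrow> j < k \<Longrightarrow> (\<lambda>x. M x $$ (i, j)) \<in> C"
  shows "(\<lambda>x. det (M x)) \<in> C"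
proof -
  have "(\<lambda>x. det (M x)) =
    (\<lambda>x. \<Sum>p\<in>{p. p permutes {0..<k}}. signof p * (\<Prod>i = 0..<k. M x $$ (i, p i)))"
    by (simp only: det_def'[OF M])
  moreover have "\<dots> \<in> C"
  proof (intro sum mult const prod C)
    fix p i assume "p \<in> {p. p permutes {0..<k}}" "i \<in> {0..<k}"
    then show "p i < k" using permutes_in_image[of p "{0..<k}" i] by auto
  qed auto
  ultimately show ?thesis by simp
qed

text \<open>Products \<open>X * M * Y\<close> with constant \<open>X\<close> and \<open>Y\<close>
  play the role of minors throughout, so that no rows or columns have to be selected.\<close>

lemma det_mult3:
  assumes M: "\<And>x. M x \<in> carrier_mat N N'"
    and X: "X \<in> carrier_mat k N" and Y: "Y \<in> carrier_mat N' k"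
    and C: "\<And>i j. i < N \<Longrightarrow> j < N' \<Longrightarrow> (\<lambda>x. M x $$ (i, j)) \<in> C"
  shows "(\<lambda>x. det (X * M x * Y)) \<in> C"
proof (rule det)
  show XM: "X * M x * Y \<in> carrier_mat k k" for x using M[of x] X Y by simp
  fix i j assume ij: "i < k" "j < k"
  have eq: "(X * M x * Y) $$ (i, j) = (\<Sum>m<N. X $$ (i, m) * (\<Sum>l<N'. M x $$ (m, l) * Y $$ (l, j)))" for x
    using M[of x] X Y ij by (simp add: scalar_prod_def lessThan_atLeast0 assoc_mult_mat[OF X M Y])
  show "(\<lambda>x. (X * M x * Y) $$ (i, j)) \<in> C"
    unfolding eq by (intro sum mult const C) auto
qed

end

interpretation PF: fun_algebra polynomial_funs
  by unfold_locales (auto intro: polynomial_funs.intros)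

definition univ_funs :: "(complex \<Rightarrow> complex) set" where
  "univ_funs = range poly"

interpretation UF: fun_algebra univ_funs
proof
  fix c :: complex show "(\<lambda>_. c) \<in> univ_funs"
    unfolding univ_funs_def by (rule range_eqI[of _ _ "[:c:]"]) auto
next
  fix p q assume "p \<in> univ_funs" "q \<in> univ_funs"
  then obtain P Q where "p = poly P" "q = poly Q" unfolding univ_funs_def by auto
  then have "(\<lambda>x. p x + q x) = poly (P + Q)" "(\<lambda>x. p x * q x) = poly (P * Q)" by auto
  then show "(\<lambda>x. p x + q x) \<in> univ_funs" "(\<lambda>x. p x * q x) \<in> univ_funs"
    unfolding univ_funs_def by blast+
qed

lemma univ_funs_id: "(\<lambda>r. r) \<in> univ_funs"
  unfolding univ_funs_def by (rule range_eqI[of _ _ "[:0,1:]"]) auto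

lemma univ_funs_poly: "poly P \<in> univ_funs"
  unfolding univ_funs_def by auto

lemma polynomial_funs_comp:
  assumes "p \<in> polynomial_funs" "fun_algebra C" "\<And>i. (\<lambda>r. z r i) \<in> C"
  shows "(\<lambda>r. p (z r)) \<in> C"
proof -
  interpret fun_algebra C by fact
  show ?thesis using assms(1)
    by induction (auto intro: const add mult assms(3))
qed

text \<open>Stands in for limit arguments: an identity proved where a division is possible extends
  to the finitely many excluded parameters.\<close>

lemma univ_funs_eq_0:
  assumes f: "f \<in> univ_funs" and S: "finite S" and 0: "\<And>r. r \<notin> S \<Longrightarrow> f r = 0"
  shows "f r = 0"
proof -
  obtain P where P: "f = poly P" using f unfolding univ_funs_def by auto
  have "infinite (UNIV - S)" using S infinite_UNIV_char_0[where 'a=complex] by (simp add: Diff_infinite_finite)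
  moreover have "UNIV - S \<subseteq> {x. poly P x = 0}" using 0 P by auto
  ultimately have "infinite {x. poly P x = 0}" using infinite_super by blast
  then have "P = 0" using poly_roots_finite by blast
  then show ?thesis using P by simp
qed

lemma univ_funs_nz_cofinite:
  assumes f: "f \<in> univ_funs" and "f r0 \<noteq> 0"
  shows "finite {r. f r = 0}"
proof -
  obtain P where P: "f = poly P" using f unfolding univ_funs_def by auto
  with assms have "P \<noteq> 0" by auto
  then show ?thesis using poly_roots_finite P by auto
qed

lemma line_univ:
  assumes "p \<in> polynomial_funs"
  shows "(\<lambda>r. p (\<lambda>i. x i + r * b i)) \<in> univ_funs"
  by (rule polynomial_funs_comp[OF assms UF.fun_algebra_axioms])
    (intro UF.add UF.const UF.mult univ_funs_id)

text \<open>Restriction to the line through the two points reduces this to one variable, where each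
  factor has finitely many zeros.\<close>

lemma polynomial_funs_no_zero_divisors:
  assumes p: "p \<in> polynomial_funs" and q: "q \<in> polynomial_funs" and "p x \<noteq> 0" "q y \<noteq> 0"
  shows "\<exists>z. p z * q z \<noteq> 0"
proof -
  let ?z = "\<lambda>r i. x i + r * (y i - x i)"
  have "finite {r. p (?z r) = 0}" "finite {r. q (?z r) = 0}"
    using univ_funs_nz_cofinite[OF line_univ[OF p, of x "\<lambda>i. y i - x i"], of 0]
      univ_funs_nz_cofinite[OF line_univ[OF q, of x "\<lambda>i. y i - x i"], of 1] assms by auto
  then have "finite ({r. p (?z r) = 0} \<union> {r. q (?z r) = 0})" by simp
  then obtain r where "r \<notin> {r. p (?z r) = 0} \<union> {r. q (?z r) = 0}"
    using ex_new_if_finite infinite_UNIV_char_0 by blast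
  then show ?thesis by (intro exI[of _ "?z r"]) auto
qed

text \<open>Points with countably many coordinates free the ring from a dimension parameter, so it
  can be a type of class \<open>idom\<close>, and pseudo-division applies to polynomials over
  it.\<close>

typedef mfun = polynomial_funs
  morphisms app Abs_mfun
  by (rule exI, rule polynomial_funs.const)

lemma mfun_eqI: "(\<And>x. app p x = app q x) \<Longrightarrow> p = q"
  by (metis app_inject ext)

instantiation mfun :: idom
begin

definition "0 = Abs_mfun (\<lambda>_. 0)"
definition "1 = Abs_mfun (\<lambda>_. 1)"
definition "p + q = Abs_mfun (\<lambda>x. app p x + app q x)"
definition "p * q = Abs_mfun (\<lambda>x. app p x * app q x)"
definition "- p = Abs_mfun (\<lambda>x. - app p x)"
definition "p - q = Abs_mfun (\<lambda>x. app p x - app q x)"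

lemma app_simps [simp]:
  "app 0 x = 0" "app 1 x = 1" "app (p + q) x = app p x + app q x" "app (p * q) x = app p x * app q x"
  "app (- p) x = - app p x" "app (p - q) x = app p x - app q x"
  unfolding zero_mfun_def one_mfun_def plus_mfun_def times_mfun_def uminus_mfun_def minus_mfun_def
  by (auto simp: Abs_mfun_inverse PF.const PF.add PF.mult PF.uminus PF.diff app)

instance
proof
  fix p q :: mfun assume "p \<noteq> 0" "q \<noteq> 0"
  then obtain x y where "app p x \<noteq> 0" "app q y \<noteq> 0" by (metis mfun_eqI app_simps(1))
  then obtain z where "app p z * app q z \<noteq> 0"
    using polynomial_funs_no_zero_divisors[OF app app] by blast
  then have "app (p * q) z \<noteq> app 0 z" by simp
  then show "p * q \<noteq> 0" by metis
next
  show "(0::mfun) \<noteq> 1" by (metis app_simps(1,2) zero_neq_one)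
qed (rule mfun_eqI, simp add: algebra_simps)+

end

lemma mfun_nz_iff: "p \<noteq> 0 \<longleftrightarrow> (\<exists>x. app p x \<noteq> 0)"
  by (metis mfun_eqI app_simps(1))

lemma ex_mfun:
  assumes "f \<in> polynomial_funs" shows "\<exists>p. \<forall>x. app p x = f x"
  using Abs_mfun_inverse[OF assms] by (intro exI[of _ "Abs_mfun f"]) simp

section \<open>Zariski density and irreducibility of affine space\<close>

definition zdense :: "(nat \<Rightarrow> complex) set \<Rightarrow> bool" where
  "zdense W \<longleftrightarrow> (\<forall>p. (\<forall>x\<in>W. app p x = 0) \<longrightarrow> p = 0)"

lemma zdense_mono: "zdense V \<Longrightarrow> V \<subseteq> W \<Longrightarrow> zdense W"
  unfolding zdense_def by blast

text \<open>Irreducibility: witnesses against both parts would multiply to zero in a ring without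
  zero divisors.\<close>

lemma zdense_Un:
  assumes "zdense W" "W \<subseteq> V1 \<union> V2" shows "zdense V1 \<or> zdense V2"
proof (rule ccontr)
  assume "\<not> ?thesis"
  then obtain p q where p: "\<forall>x\<in>V1. app p x = 0" "p \<noteq> 0" and q: "\<forall>x\<in>V2. app q x = 0" "q \<noteq> 0"
    unfolding zdense_def by blast
  have "\<forall>x\<in>W. app (p * q) x = 0" using p q assms(2) by auto
  then have "p * q = 0" using assms(1) unfolding zdense_def by blast
  then show False using p q by simp
qed

lemma zdense_open:
  assumes "zdense W" "p \<noteq> 0" shows "zdense {x\<in>W. app p x \<noteq> 0}"
proof -
  have "zdense {x\<in>W. app p x \<noteq> 0} \<or> zdense {x. app p x = 0}"
    by (rule zdense_Un[OF assms(1)]) auto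
  then show ?thesis using assms(2) unfolding zdense_def by blast
qed

lemma zdense_UNIV: "zdense UNIV"
  unfolding zdense_def using mfun_nz_iff by auto

lemma zdense_ne: "zdense W \<Longrightarrow> \<exists>x. x \<in> W"
  unfolding zdense_def by (metis zero_neq_one)

section \<open>Polynomials in an eigenvalue variable over the ring of polynomial functions\<close>

definition ev :: "mfun poly \<Rightarrow> (nat \<Rightarrow> complex) \<Rightarrow> complex \<Rightarrow> complex" where
  "ev h x l = poly (map_poly (\<lambda>p. app p x) h) l"

lemma app_hom: "comm_ring_hom (\<lambda>p. app p x)"
  by unfold_locales auto

lemma ev_simps [simp]:
  "ev 0 x l = 0" "ev (g + h) x l = ev g x l + ev h x l" "ev (g * h) x l = ev g x l * ev h x l"
  "ev (pCons p h) x l = app p x + l * ev h x l" "ev (Polynomial.smult p h) x l = app p x * ev h x l"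
proof -
  interpret comm_ring_hom "\<lambda>p. app p x" by (rule app_hom)
  interpret M: map_poly_comm_ring_hom "\<lambda>p. app p x" ..
  show "ev 0 x l = 0" "ev (g + h) x l = ev g x l + ev h x l" "ev (g * h) x l = ev g x l * ev h x l"
    by (auto simp: ev_def hom_distribs)
  show "ev (pCons p h) x l = app p x + l * ev h x l"
    by (simp add: ev_def hom_distribs)
  show "ev (Polynomial.smult p h) x l = app p x * ev h x l"
    by (simp add: ev_def hom_distribs)
qed

definition bi_funs :: "((nat \<Rightarrow> complex) \<times> complex \<Rightarrow> complex) set" where
  "bi_funs = {f. \<exists>h. \<forall>x l. f (x, l) = ev h x l}"

lemma bi_funsI: "(\<And>x l. f (x, l) = ev h x l) \<Longrightarrow> f \<in> bi_funs"
  unfolding bi_funs_def by blast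

lemma bi_funs_fst:
  assumes "f \<in> polynomial_funs" shows "(\<lambda>(x, l). f x) \<in> bi_funs"
proof -
  obtain p where "\<forall>x. app p x = f x" using ex_mfun[OF assms] by blast
  then show ?thesis by (intro bi_funsI[of _ "[:p:]"]) simp
qed

lemma bi_funs_snd: "(\<lambda>(x, l). l) \<in> bi_funs"
  by (rule bi_funsI[of _ "[:0, 1:]"]) simp

interpretation BF: fun_algebra bi_funs
proof
  fix c show "(\<lambda>_. c) \<in> bi_funs"
    using bi_funs_fst[OF PF.const[of c]] by (simp add: case_prod_unfold)
next
  fix f g assume "f \<in> bi_funs" "g \<in> bi_funs"
  then obtain F G where FG: "\<And>x l. f (x, l) = ev F x l" "\<And>x l. g (x, l) = ev G x l"
    unfolding bi_funs_def by blast
  show "(\<lambda>x. f x + g x) \<in> bi_funs" by (rule bi_funsI[of _ "F + G"]) (simp add: FG)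
  show "(\<lambda>x. f x * g x) \<in> bi_funs" by (rule bi_funsI[of _ "F * G"]) (simp add: FG)
qed

section \<open>Eigenvalue functions with a minimal equation\<close>

text \<open>Characteristic zero makes the derivative of a nonconstant polynomial nonzero, hence the
  minimal equation separable.\<close>

instance mfun :: ring_char_0
proof
  have "app (of_nat n) x = of_nat n" for n x by (induction n) auto
  then show "inj (of_nat :: nat \<Rightarrow> mfun)"
    by (metis injI of_nat_eq_iff)
qed

lemma app_power [simp]: "app (p ^ k) x = app p x ^ k"
  by (induction k) auto

lemma ev_pderiv: "ev (pderiv h) x l = poly (pderiv (map_poly (\<lambda>p. app p x) h)) l"
proof (induction h)
  case 0 then show ?case by simp
next
  case (pCons a h)
  interpret comm_ring_hom "\<lambda>p. app p x" by (rule app_hom)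
  interpret M: map_poly_comm_ring_hom "\<lambda>p. app p x" ..
  show ?case using pCons.IH by (simp add: pderiv_pCons hom_distribs) (simp add: ev_def)
qed

text \<open>Here \<open>g\<close> is a substitute for the minimal polynomial of \<open>\<mu>\<close> over the rational functions:
  pseudo-division by \<open>g\<close> replaces arithmetic in the extension field.\<close>

locale minimal_root =
  fixes g :: "mfun poly" and W :: "(nat \<Rightarrow> complex) set" and \<mu> :: "(nat \<Rightarrow> complex) \<Rightarrow> complex"
  assumes dense: "zdense W" and deg: "degree g > 0"
    and root: "x \<in> W \<Longrightarrow> ev g x (\<mu> x) = 0"
    and minimal: "zdense V \<Longrightarrow> V \<subseteq> W \<Longrightarrow> (\<And>x. x \<in> V \<Longrightarrow> ev h x (\<mu> x) = 0) \<Longrightarrow> degree h < degree g \<Longrightarrow> h = 0"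
begin

lemma pdiv:
  fixes f d :: "mfun poly" assumes "d \<noteq> 0"
  obtains k q r where "Polynomial.smult (lead_coeff d ^ k) f = d * q + r" "r = 0 \<or> degree r < degree d"
  using pseudo_divmod[OF assms, of f "fst (pseudo_divmod f d)" "snd (pseudo_divmod f d)"] by auto

text \<open>Substitute for conjugacy of the roots of a minimal polynomial: the remainder of
  \<open>h\<close> modulo \<open>g\<close> vanishes at \<open>\<mu>\<close> on a dense set, hence is
  zero, so \<open>h\<close> inherits the roots of \<open>g\<close> wherever the leading coefficient
  can be cancelled.\<close>

lemma vanishing:
  assumes V: "zdense V" "V \<subseteq> W" and h: "\<And>x. x \<in> V \<Longrightarrow> ev h x (\<mu> x) = 0"
    and x: "app (lead_coeff g) x \<noteq> 0" and l: "ev g x l = 0"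
  shows "ev h x l = 0"
proof -
  have g0: "g \<noteq> 0" using deg by auto
  obtain k q r where qr: "Polynomial.smult (lead_coeff g ^ k) h = g * q + r" "r = 0 \<or> degree r < degree g"
    by (rule pdiv[OF g0])
  have e: "app (lead_coeff g) x ^ k * ev h x l = ev g x l * ev q x l + ev r x l" for x l
    using arg_cong[OF qr(1), of "\<lambda>p. ev p x l"] by simp
  have "r = 0"
  proof (rule ccontr)
    assume "r \<noteq> 0"
    have "ev r x (\<mu> x) = 0" if "x \<in> V" for x
      using e[of x "\<mu> x"] h[OF that] root[of x] that V(2) by auto
    then have "r = 0" using minimal[OF V, of r] qr(2) by blast
    then show False using \<open>r \<noteq> 0\<close> by simp
  qed
  then show ?thesis using e[of x l] l x by simp
qed

text \<open>A Bezout relation without a field of fractions: \<open>u * g + v * h\<close> can be made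
  a nonzero element \<open>c\<close> free of the polynomial variable, and \<open>c\<close> vanishes
  at every common zero of \<open>g\<close> and \<open>h\<close>.\<close>

lemma nonvanishing:
  assumes h: "\<not> zdense {x\<in>W. ev h x (\<mu> x) = 0}"
  shows "\<exists>c. c \<noteq> 0 \<and> (\<forall>x l. app c x \<noteq> 0 \<longrightarrow> ev g x l = 0 \<longrightarrow> ev h x l \<noteq> 0)"
proof -
  have g0: "g \<noteq> 0" using deg by auto
  define I where "I = {f. f \<noteq> 0 \<and> (\<exists>u v. f = u * g + v * h)}"
  have "g = 1 * g + 0 * h" by simp
  then have "g \<in> I" unfolding I_def using g0 by blast
  \<comment> \<open>An element of least degree acts as a greatest common divisor, up to powers of
    its leading coefficient.\<close>
  then obtain d where dI: "d \<in> I" and dmin: "\<And>f. f \<in> I \<Longrightarrow> degree d \<le> degree f"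
    using ex_has_least_nat[of "\<lambda>f. f \<in> I" g degree] by auto
  have d0: "d \<noteq> 0" using dI unfolding I_def by auto
  obtain u v where uv: "d = u * g + v * h" using dI unfolding I_def by blast
  have div: "\<exists>k e. Polynomial.smult (lead_coeff d ^ k) f = d * e" if f: "f = u' * g + v' * h" for f u' v'
  proof -
    obtain k q r where qr: "Polynomial.smult (lead_coeff d ^ k) f = d * q + r" "r = 0 \<or> degree r < degree d"
      by (rule pdiv[OF d0])
    have "r = Polynomial.smult (lead_coeff d ^ k) f - d * q" using qr(1) by simp
    also have "\<dots> = (Polynomial.smult (lead_coeff d ^ k) u' - q * u) * g + (Polynomial.smult (lead_coeff d ^ k) v' - q * v) * h"
      unfolding f uv by (simp add: algebra_simps smult_add_right)
    finally have "r \<noteq> 0 \<Longrightarrow> r \<in> I" unfolding I_def by blast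
    then have "r = 0" using dmin[of r] qr(2) by (cases "r = 0") auto
    then show ?thesis using qr(1) by auto
  qed
  obtain k e where ke: "Polynomial.smult (lead_coeff d ^ k) g = d * e"
    using div[of g 1 0] by auto
  obtain k' e' where ke': "Polynomial.smult (lead_coeff d ^ k') h = d * e'"
    using div[of h 0 1] by auto
  have E: "app (lead_coeff d) x ^ k * ev g x l = ev d x l * ev e x l" for x l
    using arg_cong[OF ke, of "\<lambda>p. ev p x l"] by simp
  have E': "app (lead_coeff d) x ^ k' * ev h x l = ev d x l * ev e' x l" for x l
    using arg_cong[OF ke', of "\<lambda>p. ev p x l"] by simp
  have lk: "lead_coeff d ^ k \<noteq> 0" using d0 by simp
  have deg_e: "degree g = degree d + degree e" and e0: "e \<noteq> 0"
  proof -
    have "d * e \<noteq> 0" using ke g0 lk by (metis smult_eq_0_iff)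
    then show "e \<noteq> 0" by auto
    then show "degree g = degree d + degree e"
      using ke degree_smult_eq[of "lead_coeff d ^ k" g] lk d0 degree_mult_eq[of d e] by auto
  qed
  have "degree d = 0"
  proof (rule ccontr)
    assume "degree d \<noteq> 0"
    let ?V1 = "{x\<in>W. ev d x (\<mu> x) = 0}" and ?V2 = "{x\<in>W. ev e x (\<mu> x) = 0}"
    \<comment> \<open>Up to a factor \<open>g\<close> is \<open>d * e\<close>, so
      \<open>\<mu>\<close> is densely a root of \<open>d\<close>, and then of \<open>h\<close>
      against the assumption, or of \<open>e\<close> against minimality.\<close>
    have "W \<subseteq> ?V1 \<union> ?V2" 
    proof
      fix x assume x: "x \<in> W"
      then have "ev d x (\<mu> x) * ev e x (\<mu> x) = 0" using E[of x "\<mu> x"] root[OF x] by simp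
      then show "x \<in> ?V1 \<union> ?V2" using x by auto
    qed
    from zdense_Un[OF dense this] consider "zdense ?V1" | "zdense ?V2" by (elim disjE)
    then show False
    proof cases
      case 1
      have z: "zdense {x\<in>?V1. app (lead_coeff d) x \<noteq> 0}" using zdense_open[OF 1] d0 by simp
      have s: "{x\<in>?V1. app (lead_coeff d) x \<noteq> 0} \<subseteq> {x\<in>W. ev h x (\<mu> x) = 0}"
      proof
        fix x assume x: "x \<in> {x\<in>?V1. app (lead_coeff d) x \<noteq> 0}"
        then have "app (lead_coeff d) x ^ k' * ev h x (\<mu> x) = 0" using E'[of x "\<mu> x"] by simp
        then show "x \<in> {x\<in>W. ev h x (\<mu> x) = 0}" using x by simp
      qed
      show False using h zdense_mono[OF z s] by (rule notE)
    next
      case 2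
      have "degree e < degree g" using deg_e \<open>degree d \<noteq> 0\<close> by linarith
      with 2 have "e = 0" by (intro minimal[OF 2, of e]) auto
      then show False using e0 by simp
    qed
  qed
  then obtain c where c: "d = [:c:]" by (metis degree_eq_zeroE)
  then have "c \<noteq> 0" using d0 by auto
  moreover have "ev h x l \<noteq> 0" if "app c x \<noteq> 0" "ev g x l = 0" for x l
    using arg_cong[OF uv, of "\<lambda>p. ev p x l"] that c by auto
  ultimately show ?thesis by blast
qed

text \<open>By separability a generic specialisation of \<open>g\<close> has simple roots only; if
  all of them equal \<open>m x\<close>, there is just one.\<close>

lemma unique_root_degree:
  assumes e: "e \<noteq> 0" and uniq: "\<And>x l. app e x \<noteq> 0 \<Longrightarrow> ev g x l = 0 \<Longrightarrow> l = m x"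
  shows "degree g = 1"
proof -
  have g0: "g \<noteq> 0" using deg by auto
  have pd: "pderiv g \<noteq> 0" using deg pderiv_eq_0_iff[of g] by auto
  have dpd: "degree (pderiv g) < degree g" using deg degree_pderiv[of g] by auto
  have "\<not> zdense {x\<in>W. ev (pderiv g) x (\<mu> x) = 0}"
  proof
    assume z: "zdense {x\<in>W. ev (pderiv g) x (\<mu> x) = 0}"
    have "pderiv g = 0" by (rule minimal[OF z _ _ dpd]) auto
    then show False using pd by simp
  qed
  then obtain c where c: "c \<noteq> 0" "\<And>x l. app c x \<noteq> 0 \<Longrightarrow> ev g x l = 0 \<Longrightarrow> ev (pderiv g) x l \<noteq> 0"
    using nonvanishing by blast
  have "e * c * lead_coeff g \<noteq> 0" using e c g0 by simp
  then obtain x where "app (e * c * lead_coeff g) x \<noteq> 0" using mfun_nz_iff by blast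
  then have x: "app e x \<noteq> 0" "app c x \<noteq> 0" "app (lead_coeff g) x \<noteq> 0" by auto
  let ?G = "map_poly (\<lambda>p. app p x) g"
  have dG: "degree ?G = degree g" using x(3)
    by (intro degree_map_poly) auto
  have "\<not> constant (poly ?G)" using dG deg constant_degree[of ?G] by simp
  then obtain l where l: "poly ?G l = 0" using fundamental_theorem_of_algebra by blast
  then obtain G2 where G2: "?G = [:-l, 1:] * G2" using poly_eq_0_iff_dvd by (metis dvdE)
  have G0: "?G \<noteq> 0" using dG deg by auto
  then have "G2 \<noteq> 0" using G2 by auto
  then have d2: "degree ?G = 1 + degree G2" unfolding G2 by (subst degree_mult_eq) auto
  show ?thesis
  proof (rule ccontr)
    assume "degree g \<noteq> 1"
    then have "degree G2 > 0" using d2 dG by auto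
    then have "\<not> constant (poly G2)" using constant_degree[of G2] by simp
    then obtain l' where l': "poly G2 l' = 0" using fundamental_theorem_of_algebra by blast
    then have "poly ?G l' = 0" using G2 by simp
    then have "l' = l" using uniq[OF x(1)] l unfolding ev_def by metis
    then have "poly (pderiv ?G) l = 0" unfolding G2 pderiv_mult poly_add poly_mult using l' by simp
    then show False using c(2)[OF x(2), of l] l unfolding ev_pderiv by (simp add: ev_def)
  qed
qed

end

text \<open>A branch chosen pointwise may satisfy a smaller equation on a dense part of
  \<open>W\<close>, so the degree is minimised over equations and dense subsets together.\<close>

lemma minimal_root_exists:
  assumes W: "zdense W" and D: "D \<noteq> 0" and vanish: "\<And>x. x \<in> W \<Longrightarrow> ev D x (\<mu> x) = 0"
  shows "\<exists>g W'. W' \<subseteq> W \<and> minimal_root g W' \<mu>"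
proof -
  let ?P = "\<lambda>g. g \<noteq> 0 \<and> (\<exists>W'. zdense W' \<and> W' \<subseteq> W \<and> (\<forall>x\<in>W'. ev g x (\<mu> x) = 0))"
  have "?P D" using assms by blast
  then obtain g where g: "?P g" and gmin: "\<And>h. ?P h \<Longrightarrow> degree g \<le> degree h"
    using ex_has_least_nat[of ?P D degree] by auto
  obtain W' where W': "zdense W'" "W' \<subseteq> W" "\<forall>x\<in>W'. ev g x (\<mu> x) = 0" using g by blast
  have "minimal_root g W' \<mu>"
  proof
    show "0 < degree g"
    proof (rule ccontr)
      assume "\<not> ?thesis"
      then obtain c where c: "g = [:c:]" by (metis degree_eq_zeroE gr0I)
      then have "\<forall>x\<in>W'. app c x = 0" using W'(3) by auto
      then have "c = 0" using W'(1) unfolding zdense_def by blast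
      then show False using c g by simp
    qed
  next
    fix V h assume V: "zdense V" "V \<subseteq> W'" "\<And>x. x \<in> V \<Longrightarrow> ev h x (\<mu> x) = 0" and d: "degree h < degree g"
    show "h = 0"
    proof (rule ccontr)
      assume "h \<noteq> 0"
      then have "?P h" using V W'(2) by blast
      then show False using gmin[of h] d by simp
    qed
  qed (use W' in auto)
  then show ?thesis using W' by blast
qed

section \<open>Rank of a matrix\<close>

text \<open>For fixed \<open>X\<close> and \<open>Y\<close> this is the nonvanishing of one
  polynomial in the entries, hence an open condition that can be carried along algebraic
  families.\<close>

definition rk_ge :: "complex mat \<Rightarrow> nat \<Rightarrow> bool" where
  "rk_ge T k \<longleftrightarrow> (\<exists>X Y. X \<in> carrier_mat k (dim_row T) \<and> Y \<in> carrier_mat (dim_col T) k \<and> det (X * T * Y) \<noteq> 0)"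

definition partial_perm :: "nat \<Rightarrow> nat set \<Rightarrow> complex mat \<Rightarrow> bool" where
  "partial_perm N I S \<longleftrightarrow> S \<in> carrier_mat N N \<and> I \<subseteq> {..<N} \<and>
     (\<exists>\<sigma> c. inj_on \<sigma> I \<and> \<sigma> ` I \<subseteq> {..<N} \<and> (\<forall>p\<in>I. c p \<noteq> 0) \<and>
        (\<forall>p<N. \<forall>q<N. S $$ (p, q) = (if p \<in> I \<and> q = \<sigma> p then c p else 0)))"

text \<open>Corank through a monomial normal form instead of a dimension: additivity over direct
  sums and invariance under equivalence become matrix identities.\<close>

definition cork :: "complex mat \<Rightarrow> nat \<Rightarrow> bool" where
  "cork T d \<longleftrightarrow> (\<exists>N P Q I. T \<in> carrier_mat N N \<and> P \<in> carrier_mat N N \<and> Q \<in> carrier_mat N N \<and>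
     det P \<noteq> 0 \<and> det Q \<noteq> 0 \<and> partial_perm N I (P * T * Q) \<and> card I + d = N)"

lemma det_nz_inverse:
  assumes "P \<in> carrier_mat N N" "det P \<noteq> (0::complex)"
  obtains P' where "P' \<in> carrier_mat N N" "P * P' = 1\<^sub>m N" "P' * P = 1\<^sub>m N" "det P' \<noteq> 0"
proof -
  define P' where "P' = (1 / det P) \<cdot>\<^sub>m adj_mat P"
  have P': "P' \<in> carrier_mat N N" "P * P' = 1\<^sub>m N" "P' * P = 1\<^sub>m N"
    using adj_mat[OF assms(1)] assms unfolding P'_def
    by (auto simp: mult_smult_distrib[of _ N N _ N] mult_smult_assoc_mat[of _ N N _ N] intro!: eq_matI)
  have "det P * det P' = 1" using det_mult[OF assms(1) P'(1)] P'(2) by simp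
  then have "det P' \<noteq> 0" by auto
  with that P' show ?thesis by blast
qed

text \<open>Fewer equations than unknowns; padding with zero rows gives a singular square matrix.
  Serves the rank computations and the final dimension count.\<close>

lemma exists_kernel_vec:
  fixes E :: "'a \<Rightarrow> nat \<Rightarrow> complex"
  assumes "finite I" "card I < k"
  shows "\<exists>v\<in>carrier_vec k. v \<noteq> 0\<^sub>v k \<and> (\<forall>p\<in>I. (\<Sum>j<k. E p j * v $ j) = 0)"
proof -
  obtain e where e: "bij_betw e {0..<card I} I" using ex_bij_betw_nat_finite[OF assms(1)] by blast
  define M where "M = mat k k (\<lambda>(i, j). if i < card I then E (e i) j else 0)"
  have M: "M \<in> carrier_mat k k" unfolding M_def by simp
  have "transpose_mat M *\<^sub>v unit_vec k (card I) = 0\<^sub>v k"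
    using assms(2) by (intro eq_vecI) (auto simp: M_def)
  then have "det (transpose_mat M) = 0" using assms(2) M
    by (subst det_0_iff_vec_prod_zero[of _ k]) (auto intro!: exI[of _ "unit_vec k (card I)"])
  then have "det M = 0" using det_transpose[OF M] by simp
  then obtain v where v: "v \<in> carrier_vec k" "v \<noteq> 0\<^sub>v k" "M *\<^sub>v v = 0\<^sub>v k"
    using det_0_iff_vec_prod_zero[OF M] by blast
  have "(\<Sum>j<k. E p j * v $ j) = 0" if p: "p \<in> I" for p
  proof -
    have "p \<in> e ` {0..<card I}" using e p unfolding bij_betw_def by simp
    then obtain i where i: "i < card I" "e i = p" by auto
    have "(M *\<^sub>v v) $ i = (\<Sum>j<k. E p j * v $ j)"
      using i assms(2) v(1) by (simp add: M_def scalar_prod_def lessThan_atLeast0)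
    then show ?thesis using v(3) i assms(2) by simp
  qed
  then show ?thesis using v by blast
qed

text \<open>Only the coordinates in \<open>I\<close> of \<open>Y *\<^sub>v v\<close> matter to
  \<open>S\<close>, and fewer than \<open>k\<close> linear conditions on \<open>v\<close> have a
  nonzero solution.\<close>

lemma det_0_if_few_rows:
  assumes S: "S \<in> carrier_mat N N'" and X: "X \<in> carrier_mat k N" and Y: "Y \<in> carrier_mat N' k"
    and I: "finite I" "card I < k" and z: "\<And>p q. p < N \<Longrightarrow> q < N' \<Longrightarrow> q \<notin> I \<Longrightarrow> S $$ (p, q) = 0"
  shows "det (X * S * Y) = (0::complex)"
proof -
  obtain v where v: "v \<in> carrier_vec k" "v \<noteq> 0\<^sub>v k"
    and vI: "\<And>p. p \<in> I \<Longrightarrow> (\<Sum>j<k. Y $$ (p, j) * v $ j) = 0"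
    using exists_kernel_vec[OF I, of "\<lambda>p j. Y $$ (p, j)"] by blast
  have Yv: "(Y *\<^sub>v v) $ q = (\<Sum>j<k. Y $$ (q, j) * v $ j)" if "q < N'" for q
    using that Y v(1) by (simp add: scalar_prod_def lessThan_atLeast0)
  have "S *\<^sub>v (Y *\<^sub>v v) = 0\<^sub>v N"
  proof (rule eq_vecI)
    fix p assume p: "p < dim_vec (0\<^sub>v N)"
    have "(S *\<^sub>v (Y *\<^sub>v v)) $ p = (\<Sum>q<N'. S $$ (p, q) * (Y *\<^sub>v v) $ q)"
      using p S Y by (simp add: scalar_prod_def lessThan_atLeast0)
    also have "\<dots> = 0"
    proof (intro sum.neutral ballI)
      fix q assume "q \<in> {..<N'}"
      then show "S $$ (p, q) * (Y *\<^sub>v v) $ q = 0"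
        using z[of p q] p vI[of q] Yv[of q] by (cases "q \<in> I") auto
    qed
    finally show "(S *\<^sub>v (Y *\<^sub>v v)) $ p = 0\<^sub>v N $ p" using p by simp
  qed (use S in auto)
  moreover have "X *\<^sub>v 0\<^sub>v N = 0\<^sub>v k" using X by (intro eq_vecI) auto
  ultimately have "(X * S * Y) *\<^sub>v v = 0\<^sub>v k"
    using X S Y v(1) assoc_mult_mat_vec[of "X * S" k N' Y k v] assoc_mult_mat_vec[of X k N S N' "Y *\<^sub>v v"]
    by simp
  then show ?thesis using det_0_iff_vec_prod_zero[of "X * S * Y" k] X S Y v by auto
qed

lemma rk_ge_le_dim:
  assumes "T \<in> carrier_mat N N'" "rk_ge T k" shows "k \<le> N'"
proof (rule ccontr)
  assume "\<not> k \<le> N'"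
  then have "det (X * T * Y) = 0" if "X \<in> carrier_mat k N" "Y \<in> carrier_mat N' k" for X Y
    using det_0_if_few_rows[OF assms(1) that, of "{..<N'}"] by auto
  then show False using assms unfolding rk_ge_def by auto
qed

lemma partial_perm_rk:
  assumes S: "partial_perm N I S"
  shows "rk_ge S k \<longleftrightarrow> k \<le> card I"
proof -
  obtain \<sigma> c where sc: "inj_on \<sigma> I" "\<sigma> ` I \<subseteq> {..<N}" "\<And>p. p \<in> I \<Longrightarrow> c p \<noteq> 0"
    and ent: "\<And>p q. p < N \<Longrightarrow> q < N \<Longrightarrow> S $$ (p, q) = (if p \<in> I \<and> q = \<sigma> p then c p else 0)"
    and SN: "S \<in> carrier_mat N N" and IN: "I \<subseteq> {..<N}"
    using S unfolding partial_perm_def by metis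
  have fI: "finite I" using IN finite_subset by blast
  show ?thesis
  proof
    assume "rk_ge S k"
    then obtain X Y where XY: "X \<in> carrier_mat k N" "Y \<in> carrier_mat N k" "det (X * S * Y) \<noteq> 0"
      unfolding rk_ge_def using SN by auto
    have "\<not> card (\<sigma> ` I) < k"
    proof
      assume less: "card (\<sigma> ` I) < k"
      have "S $$ (p, q) = 0" if "p < N" "q < N" "q \<notin> \<sigma> ` I" for p q
        using ent[OF that(1,2)] that(3) by auto
      then show False using det_0_if_few_rows[OF SN XY(1,2) _ less] XY(3) fI by auto
    qed
    then show "k \<le> card I" using card_image[OF sc(1)] by simp
  next
    assume k: "k \<le> card I"
    obtain e where e: "bij_betw e {0..<card I} I" using ex_bij_betw_nat_finite[OF fI] by blast
    have eI: "e i \<in> I" if "i < k" for i using e k that unfolding bij_betw_def by auto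
    have einj: "e i = e j \<longleftrightarrow> i = j" if "i < k" "j < k" for i j
      using e k that unfolding bij_betw_def inj_on_def by auto
    define X where "X = mat k N (\<lambda>(i, p). if p = e i then 1 else (0::complex))"
    define Y where "Y = mat N k (\<lambda>(q, j). if q = \<sigma> (e j) then 1 else (0::complex))"
    have XY: "X \<in> carrier_mat k N" "Y \<in> carrier_mat N k" unfolding X_def Y_def by auto
    have "X * S * Y = mat k k (\<lambda>(i, j). if i = j then c (e i) else 0)"
    proof (rule eq_matI)
      fix i j assume "i < dim_row (mat k k (\<lambda>(i, j). if i = j then c (e i) else 0))"
        "j < dim_col (mat k k (\<lambda>(i, j). if i = j then c (e i) else 0))"
      then have ij: "i < k" "j < k" by auto
      have eN: "e i < N" "\<sigma> (e j) < N" using eI[OF ij(1)] eI[OF ij(2)] IN sc(2) by auto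
      have "(X * S * Y) $$ (i, j) = (\<Sum>l<N. (\<Sum>m<N. X $$ (i, m) * S $$ (m, l)) * Y $$ (l, j))"
        using XY SN ij by (simp add: scalar_prod_def lessThan_atLeast0 del: assoc_mult_mat)
      also have "\<dots> = (\<Sum>l<N. (\<Sum>m<N. if m = e i then S $$ (m, l) else 0) * (if l = \<sigma> (e j) then 1 else 0))"
        using ij by (intro sum.cong arg_cong2[where f="(*)"] refl) (auto simp: X_def Y_def)
      also have "\<dots> = (\<Sum>l<N. if l = \<sigma> (e j) then S $$ (e i, l) else 0)"
        using eN by (intro sum.cong refl) (simp add: sum.delta)
      also have "\<dots> = S $$ (e i, \<sigma> (e j))" using eN by (simp add: sum.delta)
      also have "\<dots> = (if i = j then c (e i) else 0)"
        using ent[OF eN] eI ij einj[OF ij] inj_on_eq_iff[OF sc(1) eI[OF ij(2)] eI[OF ij(1)]] by auto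
      finally show "(X * S * Y) $$ (i, j) = mat k k (\<lambda>(i, j). if i = j then c (e i) else 0) $$ (i, j)"
        using ij by simp
    qed (use XY SN in auto)
    moreover have "det (mat k k (\<lambda>(i, j). if i = j then c (e i) else 0)) \<noteq> 0"
      using sc(3) eI by (subst det_upper_triangular[of _ k]) (auto simp: diag_mat_def prod_list_zero_iff)
    ultimately show "rk_ge S k" unfolding rk_ge_def using XY SN by (intro exI[of _ X] exI[of _ Y]) auto
  qed
qed

lemma assoc_mult_mat5:
  assumes "X \<in> carrier_mat k a" "P \<in> carrier_mat a b" "T \<in> carrier_mat b c" "Q \<in> carrier_mat c d"
    "Y \<in> carrier_mat d l"
  shows "X * (P * T * Q) * Y = (X * P) * T * (Q * Y)"
  using assms assoc_mult_mat[of X k a "P * T" c Q d] assoc_mult_mat[of X k a P b T c]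
    assoc_mult_mat[of "X * P * T" k c Q d Y l] by simp

lemma rk_ge_mult:
  assumes T: "T \<in> carrier_mat N N" and P: "P \<in> carrier_mat N N" and Q: "Q \<in> carrier_mat N N"
    and "rk_ge (P * T * Q) k"
  shows "rk_ge T k"
proof -
  obtain X Y where XY: "X \<in> carrier_mat k N" "Y \<in> carrier_mat N k" "det (X * (P * T * Q) * Y) \<noteq> 0"
    using assms unfolding rk_ge_def by auto
  have "X * (P * T * Q) * Y = (X * P) * T * (Q * Y)"
    by (rule assoc_mult_mat5[OF XY(1) P T Q XY(2)])
  then show ?thesis unfolding rk_ge_def using XY T P Q
    by (intro exI[of _ "X * P"] exI[of _ "Q * Y"]) auto
qed

lemma mult_inverse_cancel:
  assumes T: "T \<in> carrier_mat N N" and P: "P \<in> carrier_mat N N" and Q: "Q \<in> carrier_mat N N"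
    and P': "P' \<in> carrier_mat N N" "P' * P = 1\<^sub>m N" and Q': "Q' \<in> carrier_mat N N" "Q * Q' = 1\<^sub>m N"
  shows "P' * (P * T * Q) * Q' = (T :: complex mat)"
proof -
  have "P' * (P * T * Q) * Q' = (P' * P) * T * (Q * Q')"
    by (rule assoc_mult_mat5[OF P'(1) P T Q Q'(1)])
  then show ?thesis using P' Q' T by simp
qed

text \<open>Bridge from the normal form, computable for blocks, to the rank condition, which is
  polynomial.\<close>

lemma cork_rk:
  assumes "cork T d" "T \<in> carrier_mat N N"
  shows "rk_ge T k \<longleftrightarrow> k + d \<le> N"
proof -
  obtain P Q I where PQ: "P \<in> carrier_mat N N" "Q \<in> carrier_mat N N" "det P \<noteq> 0" "det Q \<noteq> 0"
    and I: "partial_perm N I (P * T * Q)" "card I + d = N"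
    using assms unfolding cork_def by auto
  obtain P' Q' where P': "P' \<in> carrier_mat N N" "P' * P = 1\<^sub>m N"
    and Q': "Q' \<in> carrier_mat N N" "Q * Q' = 1\<^sub>m N"
    using det_nz_inverse[OF PQ(1,3)] det_nz_inverse[OF PQ(2,4)] by metis
  have "rk_ge T k \<longleftrightarrow> rk_ge (P * T * Q) k"
    using rk_ge_mult[OF assms(2) PQ(1,2), of k] rk_ge_mult[of "P * T * Q" N P' Q' k]
      mult_inverse_cancel[OF assms(2) PQ(1,2) P' Q'] assms(2) PQ P'(1) Q'(1) by auto
  then show ?thesis using partial_perm_rk[OF I(1), of k] I(2) by auto
qed

lemma partial_perm_cork:
  assumes "partial_perm N I S" "card I + d = N" shows "cork S d"
  unfolding cork_def
proof (intro exI conjI)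
  show S: "S \<in> carrier_mat N N" using assms(1) unfolding partial_perm_def by simp
  show "partial_perm N I (1\<^sub>m N * S * 1\<^sub>m N)" using assms(1) S by simp
qed (use assms(2) in auto)

lemma cork_mult:
  assumes T: "T \<in> carrier_mat N N" and P: "P \<in> carrier_mat N N" "det P \<noteq> 0"
    and Q: "Q \<in> carrier_mat N N" "det Q \<noteq> 0" and "cork (P * T * Q) d"
  shows "cork T d"
proof -
  obtain P' Q' I where P': "P' \<in> carrier_mat N N" "Q' \<in> carrier_mat N N" "det P' \<noteq> 0" "det Q' \<noteq> 0"
    and I: "partial_perm N I (P' * (P * T * Q) * Q')" "card I + d = N"
    using assms unfolding cork_def by auto
  have "P' * (P * T * Q) * Q' = (P' * P) * T * (Q * Q')"
    by (rule assoc_mult_mat5[OF P'(1) P(1) T Q(1) P'(2)])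
  then show ?thesis unfolding cork_def using T P Q P' I
    by (intro exI[of _ N] exI[of _ "P' * P"] exI[of _ "Q * Q'"] exI[of _ I]) (auto simp: det_mult)
qed

lemma cork_mult':
  assumes T: "T \<in> carrier_mat N N" and P: "P \<in> carrier_mat N N" "det P \<noteq> 0"
    and Q: "Q \<in> carrier_mat N N" "det Q \<noteq> 0" and c: "cork T d"
  shows "cork (P * T * Q) d"
proof -
  obtain P' where P': "P' \<in> carrier_mat N N" "P' * P = 1\<^sub>m N" "det P' \<noteq> 0"
    using det_nz_inverse[OF P] by metis
  obtain Q' where Q': "Q' \<in> carrier_mat N N" "Q * Q' = 1\<^sub>m N" "det Q' \<noteq> 0"
    using det_nz_inverse[OF Q] by metis
  show ?thesis using cork_mult[of "P * T * Q" N P' Q' d] c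
      mult_inverse_cancel[OF T P(1) Q(1) P'(1,2) Q'(1,2)] T P Q P' Q' by auto
qed

lemma cork_0:
  assumes T: "T \<in> carrier_mat N N" "det T \<noteq> 0" shows "cork T 0"
proof -
  obtain P where P: "P \<in> carrier_mat N N" "P * T = 1\<^sub>m N" "det P \<noteq> 0"
    using det_nz_inverse[OF T] by metis
  have "partial_perm N {..<N} (1\<^sub>m N)" unfolding partial_perm_def
    by (intro conjI exI[of _ id] exI[of _ "\<lambda>_. 1"]) auto
  then show ?thesis unfolding cork_def using T P
    by (intro exI[of _ N] exI[of _ P] exI[of _ "1\<^sub>m N"] exI[of _ "{..<N}"]) auto
qed

lemma partial_perm_diag:
  assumes 1: "partial_perm N1 I1 S1" and 2: "partial_perm N2 I2 S2"
  shows "partial_perm (N1 + N2) (I1 \<union> (+) N1 ` I2)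
    (four_block_mat S1 (0\<^sub>m N1 N2) (0\<^sub>m N2 N1) S2)"
proof -
  obtain \<sigma>1 c1 where s1: "inj_on \<sigma>1 I1" "\<sigma>1 ` I1 \<subseteq> {..<N1}" "\<forall>p\<in>I1. c1 p \<noteq> 0"
     "\<And>p q. p < N1 \<Longrightarrow> q < N1 \<Longrightarrow> S1 $$ (p, q) = (if p \<in> I1 \<and> q = \<sigma>1 p then c1 p else 0)"
     and S1: "S1 \<in> carrier_mat N1 N1" and I1: "I1 \<subseteq> {..<N1}"
    using 1 unfolding partial_perm_def by metis
  obtain \<sigma>2 c2 where s2: "inj_on \<sigma>2 I2" "\<sigma>2 ` I2 \<subseteq> {..<N2}" "\<forall>p\<in>I2. c2 p \<noteq> 0"
     "\<And>p q. p < N2 \<Longrightarrow> q < N2 \<Longrightarrow> S2 $$ (p, q) = (if p \<in> I2 \<and> q = \<sigma>2 p then c2 p else 0)"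
     and S2: "S2 \<in> carrier_mat N2 N2" and I2: "I2 \<subseteq> {..<N2}"
    using 2 unfolding partial_perm_def by metis
  define \<sigma> where "\<sigma> p = (if p < N1 then \<sigma>1 p else N1 + \<sigma>2 (p - N1))" for p
  define c where "c p = (if p < N1 then c1 p else c2 (p - N1))" for p
  have lt: "\<And>p. p \<in> I1 \<Longrightarrow> p < N1" "\<And>p. p \<in> I1 \<Longrightarrow> \<sigma>1 p < N1" "\<And>p. p \<in> I2 \<Longrightarrow> p < N2" "\<And>p. p \<in> I2 \<Longrightarrow> \<sigma>2 p < N2"
    using I1 I2 s1(2) s2(2) by auto
  have mem: "p \<in> I1 \<union> (+) N1 ` I2 \<longleftrightarrow> (if p < N1 then p \<in> I1 else p - N1 \<in> I2)" for p
    using lt by (auto simp: image_iff) (metis le_add_diff_inverse not_less)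
  have side: "\<sigma> p < N1 \<longleftrightarrow> p < N1" if "p \<in> I1 \<union> (+) N1 ` I2" for p
    using that lt(2)[of p] unfolding mem \<sigma>_def by (cases "p < N1") auto
  have inj: "inj_on \<sigma> (I1 \<union> (+) N1 ` I2)"
  proof (rule inj_onI)
    fix p q assume pq: "p \<in> I1 \<union> (+) N1 ` I2" "q \<in> I1 \<union> (+) N1 ` I2" and e: "\<sigma> p = \<sigma> q"
    have lq: "p < N1 \<longleftrightarrow> q < N1" using side[OF pq(1)] side[OF pq(2)] e by simp
    show "p = q"
    proof (cases "p < N1")
      case True
      then have "\<sigma>1 p = \<sigma>1 q" using e lq unfolding \<sigma>_def by simp
      then show ?thesis using pq True lq unfolding mem by (auto dest: inj_onD[OF s1(1)])
    next
      case False
      then have "\<sigma>2 (p - N1) = \<sigma>2 (q - N1)" using e lq unfolding \<sigma>_def by simp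
      then have "p - N1 = q - N1" using pq False lq unfolding mem by (auto dest: inj_onD[OF s2(1)])
      then show ?thesis using False lq by simp
    qed
  qed
  have ent: "four_block_mat S1 (0\<^sub>m N1 N2) (0\<^sub>m N2 N1) S2 $$ (p, q) =
      (if p \<in> I1 \<union> (+) N1 ` I2 \<and> q = \<sigma> p then c p else 0)" if "p < N1 + N2" "q < N1 + N2" for p q
    unfolding mem using that S1 S2 s1(4)[of p q] s2(4)[of "p - N1" "q - N1"] lt
    by (auto simp: \<sigma>_def c_def)
  show ?thesis unfolding partial_perm_def
  proof (intro conjI exI[of _ \<sigma>] exI[of _ c] allI impI inj)
    show "\<sigma> ` (I1 \<union> (+) N1 ` I2) \<subseteq> {..<N1 + N2}" using lt by (fastforce simp: \<sigma>_def)
    show "\<forall>p\<in>I1 \<union> (+) N1 ` I2. c p \<noteq> 0" using lt s1(3) s2(3) by (auto simp: c_def)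
    show "I1 \<union> (+) N1 ` I2 \<subseteq> {..<N1 + N2}" using lt by (fastforce)
  qed (use S1 S2 ent in auto)
qed

lemma card_shift_Un:
  assumes "I1 \<subseteq> {..<N1}" "I2 \<subseteq> {..<N2::nat}"
  shows "card (I1 \<union> (+) N1 ` I2) = card I1 + card I2"
proof -
  have "finite I1" "finite I2" using assms finite_subset by blast+
  moreover have "I1 \<inter> (+) N1 ` I2 = {}" using assms(1) by auto
  ultimately show ?thesis by (simp add: card_Un_disjoint card_image)
qed

lemma cork_diag:
  assumes T1: "T1 \<in> carrier_mat N1 N1" "cork T1 d1" and T2: "T2 \<in> carrier_mat N2 N2" "cork T2 d2"
  shows "cork (four_block_mat T1 (0\<^sub>m N1 N2) (0\<^sub>m N2 N1) T2) (d1 + d2)"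
proof -
  obtain P1 Q1 I1 where 1: "P1 \<in> carrier_mat N1 N1" "Q1 \<in> carrier_mat N1 N1" "det P1 \<noteq> 0" "det Q1 \<noteq> 0"
     "partial_perm N1 I1 (P1 * T1 * Q1)" "card I1 + d1 = N1"
    using T1 unfolding cork_def by auto
  obtain P2 Q2 I2 where 2: "P2 \<in> carrier_mat N2 N2" "Q2 \<in> carrier_mat N2 N2" "det P2 \<noteq> 0" "det Q2 \<noteq> 0"
     "partial_perm N2 I2 (P2 * T2 * Q2)" "card I2 + d2 = N2"
    using T2 unfolding cork_def by auto
  let ?D = "\<lambda>A B. four_block_mat A (0\<^sub>m N1 N2) (0\<^sub>m N2 N1) B"
  have pp: "partial_perm (N1 + N2) (I1 \<union> (+) N1 ` I2) (?D (P1 * T1 * Q1) (P2 * T2 * Q2))"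
    by (rule partial_perm_diag[OF 1(5) 2(5)])
  have I: "I1 \<subseteq> {..<N1}" "I2 \<subseteq> {..<N2}" using 1(5) 2(5) unfolding partial_perm_def by auto
  have eq: "?D (P1 * T1 * Q1) (P2 * T2 * Q2) = ?D P1 P2 * ?D T1 T2 * ?D Q1 Q2"
    using 1(1,2) 2(1,2) T1(1) T2(1) by (simp add: mult_four_block_mat[of _ N1 N1 _ N2 _ N2 _ _ N1 _ N2])
  have d: "det (?D P1 P2) \<noteq> 0" "det (?D Q1 Q2) \<noteq> 0"
    using 1 2 by (simp_all add: det_four_block_mat_lower_left_zero[of _ N1 _ N2])
  show ?thesis
    by (rule cork_mult[OF _ _ d(1) _ d(2), where N = "N1 + N2"])
      (use 1 2 T1 T2 partial_perm_cork[OF pp, of "d1 + d2"] card_shift_Un[OF I] eq in auto)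
qed

text \<open>Swapping the two block columns turns the matrix into a direct sum; the skew blocks of
  the decomposition have this shape.\<close>

lemma cork_antidiag:
  assumes T1: "T1 \<in> carrier_mat N N" "cork T1 d1" and T2: "T2 \<in> carrier_mat N N" "cork T2 d2"
  shows "cork (four_block_mat (0\<^sub>m N N) T1 T2 (0\<^sub>m N N)) (d1 + d2)"
proof -
  let ?D = "four_block_mat T1 (0\<^sub>m N N) (0\<^sub>m N N) T2"
  let ?Z = "four_block_mat (0\<^sub>m N N) (1\<^sub>m N) (1\<^sub>m N) (0\<^sub>m N N) :: complex mat"
  have Z: "?Z \<in> carrier_mat (N + N) (N + N)" by simp
  have "?Z * ?Z = 1\<^sub>m (N + N)"
    by (simp add: mult_four_block_mat[of _ N N _ N _ N _ _ N _ N])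
  then have "det ?Z * det ?Z = 1" using det_mult[OF Z Z] by simp
  then have dZ: "det ?Z \<noteq> 0" by auto
  have D: "?D \<in> carrier_mat (N + N) (N + N)" using T1 T2 by simp
  have "?D * ?Z = four_block_mat (0\<^sub>m N N) T1 T2 (0\<^sub>m N N)"
    using T1 T2 by (simp add: mult_four_block_mat[of _ N N _ N _ N _ _ N _ N])
  moreover have "cork (1\<^sub>m (N + N) * ?D * ?Z) (d1 + d2)"
    by (rule cork_mult'[OF D _ _ Z dZ cork_diag[OF T1 T2]]) simp_all
  ultimately show ?thesis by (simp only: left_mult_one_mat[OF D])
qed

lemma cork_transpose:
  assumes T: "T \<in> carrier_mat N N" "cork T d" shows "cork (transpose_mat T) d"
proof -
  obtain P Q I where 1: "P \<in> carrier_mat N N" "Q \<in> carrier_mat N N" "det P \<noteq> 0" "det Q \<noteq> 0"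
     and pp: "partial_perm N I (P * T * Q)" "card I + d = N"
    using T unfolding cork_def by auto
  obtain \<sigma> c where s: "inj_on \<sigma> I" "\<sigma> ` I \<subseteq> {..<N}" "\<forall>p\<in>I. c p \<noteq> 0"
     "\<And>p q. p < N \<Longrightarrow> q < N \<Longrightarrow> (P * T * Q) $$ (p, q) = (if p \<in> I \<and> q = \<sigma> p then c p else 0)"
     and I: "I \<subseteq> {..<N}"
    using pp(1) unfolding partial_perm_def by metis
  have ptq: "transpose_mat (P * T * Q) = transpose_mat Q * transpose_mat T * transpose_mat P"
    using 1(1,2) T(1) by (simp add: transpose_mult[of _ N N _ N] assoc_mult_mat[of _ N N _ N _ N])
  have "partial_perm N (\<sigma> ` I) (transpose_mat (P * T * Q))"
    unfolding partial_perm_def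
  proof (intro conjI exI[of _ "the_inv_into I \<sigma>"] exI[of _ "\<lambda>q. c (the_inv_into I \<sigma> q)"] allI impI)
    show "inj_on (the_inv_into I \<sigma>) (\<sigma> ` I)" by (rule inj_on_the_inv_into[OF s(1)])
    show "the_inv_into I \<sigma> ` \<sigma> ` I \<subseteq> {..<N}" using the_inv_into_onto[OF s(1)] I by simp
    show "\<forall>p\<in>\<sigma> ` I. c (the_inv_into I \<sigma> p) \<noteq> 0" using the_inv_into_f_f[OF s(1)] s(3) by auto
    fix p q assume pq: "p < N" "q < N"
    have "(P * T * Q) $$ (q, p) = (if q \<in> I \<and> p = \<sigma> q then c q else 0)" by (rule s(4)[OF pq(2,1)])
    also have "\<dots> = (if p \<in> \<sigma> ` I \<and> q = the_inv_into I \<sigma> p then c (the_inv_into I \<sigma> p) else 0)"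
      using the_inv_into_f_f[OF s(1)] by auto
    finally show "transpose_mat (P * T * Q) $$ (p, q) = \<dots>" using pq 1 T(1) by simp
  qed (use 1 T s in auto)
  then have "cork (transpose_mat Q * transpose_mat T * transpose_mat P) d"
    using partial_perm_cork[of N "\<sigma> ` I" _ d] pp(2) card_image[OF s(1)] ptq by simp
  then show ?thesis
    by (rule cork_mult[rotated 5, of _ _ _ _ N]) (use 1 T in \<open>auto simp: det_transpose\<close>)
qed

section \<open>Derivative of a linear matrix family at a point of maximal rank\<close>

lemma mult3_index:
  fixes A T B :: "complex mat"
  assumes "A \<in> carrier_mat k N" "T \<in> carrier_mat N N'" "B \<in> carrier_mat N' k'" "i < k" "j < k'"
  shows "(A * T * B) $$ (i, j) = row A i \<bullet> (T *\<^sub>v col B j)"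
  using assms col_mult2[of T N N' B k' j] by (simp add: assoc_mult_mat[of A k N T N' B k'])

lemma bordered_mult:
  fixes T :: "complex mat"
  assumes X: "X \<in> carrier_mat R N" and Y: "Y \<in> carrier_mat N' R" and T: "T \<in> carrier_mat N N'"
    and U: "U \<in> carrier_mat N' 1" and V: "V \<in> carrier_mat 1 N"
  shows "mat (R + 1) N (\<lambda>(i, j). if i < R then X $$ (i, j) else V $$ (0, j)) * T *
      mat N' (R + 1) (\<lambda>(i, j). if j < R then Y $$ (i, j) else U $$ (i, 0))
    = four_block_mat (X * T * Y) (X * T * U) (V * T * Y) (V * T * U)" (is "?X * T * ?Y = ?M")
proof (rule eq_matI)
  have c: "X * T * Y \<in> carrier_mat R R" "X * T * U \<in> carrier_mat R 1"
    "V * T * Y \<in> carrier_mat 1 R" "V * T * U \<in> carrier_mat 1 1"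
    using assms by auto
  have c': "?X \<in> carrier_mat (R + 1) N" "?Y \<in> carrier_mat N' (R + 1)" by auto
  fix i j assume "i < dim_row ?M" "j < dim_col ?M"
  then have ij: "i < R + 1" "j < R + 1" using X V Y U T by auto
  have r: "row ?X i = (if i < R then row X i else row V 0)"
    using ij X V by (intro eq_vecI) auto
  have cl: "col ?Y j = (if j < R then col Y j else col U 0)"
    using ij Y U by (intro eq_vecI) auto
  have "(?X * T * ?Y) $$ (i, j) = row ?X i \<bullet> (T *\<^sub>v col ?Y j)"
    by (rule mult3_index[OF c'(1) T c'(2) ij])
  also have "\<dots> = ?M $$ (i, j)"
    unfolding r cl using ij X V Y U T
      mult3_index[OF X T Y, of i j] mult3_index[OF X T U, of i 0] mult3_index[OF V T Y, of 0 j] mult3_index[OF V T U, of 0 0]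
    by (auto simp: less_Suc_eq simp del: assoc_mult_mat)
  finally show "(?X * T * ?Y) $$ (i, j) = ?M $$ (i, j)" .
qed (use assms in auto)

lemma four_block_scale_col:
  fixes A :: "complex mat"
  assumes c: "A \<in> carrier_mat R R" "B \<in> carrier_mat R 1" "C \<in> carrier_mat 1 R" "D \<in> carrier_mat 1 1"
  shows "four_block_mat A (e \<cdot>\<^sub>m B) C (e \<cdot>\<^sub>m D) =
    four_block_mat A B C D * four_block_mat (1\<^sub>m R) (0\<^sub>m R 1) (0\<^sub>m 1 R) (e \<cdot>\<^sub>m 1\<^sub>m 1)"
proof -
  have "A * 0\<^sub>m R 1 = 0\<^sub>m R 1" "B * 0\<^sub>m 1 R = 0\<^sub>m R R" "C * 0\<^sub>m R 1 = 0\<^sub>m 1 1" "D * 0\<^sub>m 1 R = 0\<^sub>m 1 R"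
    "B * (e \<cdot>\<^sub>m 1\<^sub>m 1) = e \<cdot>\<^sub>m B" "D * (e \<cdot>\<^sub>m 1\<^sub>m 1) = e \<cdot>\<^sub>m D" "A * 1\<^sub>m R = A" "C * 1\<^sub>m R = C"
    using c by (auto simp: mult_smult_distrib[of _ _ 1 _ 1])
  then show ?thesis
    using c by (subst mult_four_block_mat[OF c, of _ R _ 1]) auto
qed

lemma four_block_border_index:
  fixes A :: "complex mat"
  assumes c: "A \<in> carrier_mat R R" "B \<in> carrier_mat R 1" "C \<in> carrier_mat 1 R" "D \<in> carrier_mat 1 1"
    and ij: "i < R + 1" "j < R + 1"
  shows "four_block_mat A B C D $$ (i, j) =
    (if i < R then if j < R then A $$ (i, j) else B $$ (i, 0) else if j < R then C $$ (0, j) else D $$ (0, 0))"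
proof -
  have "i < dim_row A + dim_row D" "j < dim_col A + dim_col D" using assms by auto
  moreover have "i < R \<or> i = R" "j < R \<or> j = R" using ij by auto
  ultimately show ?thesis using c by auto
qed

text \<open>Bordering the nonzero minor by \<open>u\<close> and \<open>v\<close> yields a minor of \<open>T0 + e T1\<close> that is
  \<open>e\<close> times a polynomial whose constant term is the minor times \<open>v \<bullet> T1 u\<close>.\<close>

lemma max_rank_kernel:
  fixes T0 T1 :: "complex mat"
  assumes T: "T0 \<in> carrier_mat N N" "T1 \<in> carrier_mat N N"
    and X: "X \<in> carrier_mat R N" and Y: "Y \<in> carrier_mat N R" and nz: "det (X * T0 * Y) \<noteq> 0"
    and max: "\<And>e. \<not> rk_ge (T0 + e \<cdot>\<^sub>m T1) (Suc R)"
    and u: "u \<in> carrier_vec N" "T0 *\<^sub>v u = 0\<^sub>v N"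
    and v: "v \<in> carrier_vec N" "transpose_mat T0 *\<^sub>v v = 0\<^sub>v N"
  shows "v \<bullet> (T1 *\<^sub>v u) = 0"
proof -
  define U where "U = mat N 1 (\<lambda>(i, j). u $ i)"
  define V where "V = mat 1 N (\<lambda>(i, j). v $ j)"
  have UV: "U \<in> carrier_mat N 1" "V \<in> carrier_mat 1 N" unfolding U_def V_def by auto
  let ?T = "\<lambda>e. T0 + e \<cdot>\<^sub>m T1"
  \<comment> \<open>Since \<open>u\<close> and \<open>v\<close> annihilate \<open>T0\<close>, border
    row and border column both carry a factor \<open>e\<close>. Only that of the column is removed,
    so the matrix becomes block triangular at \<open>e = 0\<close>.\<close>
  define M where "M e = four_block_mat (X * ?T e * Y) (X * T1 * U) (e \<cdot>\<^sub>m (V * T1 * Y)) (V * T1 * U)" for e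
  define X' where "X' = mat (R + 1) N (\<lambda>(i, j). if i < R then X $$ (i, j) else V $$ (0, j))"
  define Y' where "Y' = mat N (R + 1) (\<lambda>(i, j). if j < R then Y $$ (i, j) else U $$ (i, 0))"
  have XY': "X' \<in> carrier_mat (R + 1) N" "Y' \<in> carrier_mat N (R + 1)"
    unfolding X'_def Y'_def by auto
  have T0U: "T0 * U = 0\<^sub>m N 1"
  proof (rule eq_matI)
    fix i j assume ij: "i < dim_row (0\<^sub>m N 1)" "j < dim_col (0\<^sub>m N 1)"
    have "(T0 * U) $$ (i, j) = (T0 *\<^sub>v u) $ i" using ij T UV u(1)
      by (simp add: U_def scalar_prod_def)
    also have "\<dots> = 0\<^sub>v N $ i" by (simp only: u(2))
    finally show "(T0 * U) $$ (i, j) = 0\<^sub>m N 1 $$ (i, j)" using ij by simp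
  qed (use T UV in auto)
  have VT0: "V * T0 = 0\<^sub>m 1 N"
  proof (rule eq_matI)
    fix i j assume ij: "i < dim_row (0\<^sub>m 1 N)" "j < dim_col (0\<^sub>m 1 N)"
    have "(V * T0) $$ (i, j) = (transpose_mat T0 *\<^sub>v v) $ j" using ij T UV v(1)
      by (simp add: V_def scalar_prod_def mult.commute)
    also have "\<dots> = 0\<^sub>v N $ j" by (simp only: v(2))
    finally show "(V * T0) $$ (i, j) = 0\<^sub>m 1 N $$ (i, j)" using ij by simp
  qed (use T UV in auto)
  have TU: "?T e * U = e \<cdot>\<^sub>m (T1 * U)" for e
    using T UV T0U by (simp add: add_mult_distrib_mat[of _ N N _ _ 1] mult_smult_assoc_mat[of _ N N _ 1])
  have VT: "V * ?T e = e \<cdot>\<^sub>m (V * T1)" for e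
    using T UV VT0 by (simp add: mult_add_distrib_mat[of _ 1 N _ N] mult_smult_distrib[of _ 1 N _ N])
  have prod: "X' * ?T e * Y' = M e * four_block_mat (1\<^sub>m R) (0\<^sub>m R 1) (0\<^sub>m 1 R) (e \<cdot>\<^sub>m 1\<^sub>m 1)" for e
  proof -
    have Te: "?T e \<in> carrier_mat N N" using T by auto
    have "X' * ?T e * Y' = four_block_mat (X * ?T e * Y) (X * ?T e * U) (V * ?T e * Y) (V * ?T e * U)"
      unfolding X'_def Y'_def by (rule bordered_mult[OF X Y Te UV])
    also have "X * ?T e * U = e \<cdot>\<^sub>m (X * T1 * U)"
      using assoc_mult_mat[OF X Te UV(1)] TU X T UV by (simp add: mult_smult_distrib[of _ R N _ 1])
    also have "V * ?T e * Y = e \<cdot>\<^sub>m (V * T1 * Y)"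
      unfolding VT using UV T Y by (simp add: mult_smult_assoc_mat[of _ 1 N _ R])
    also have "V * ?T e * U = e \<cdot>\<^sub>m (V * T1 * U)"
      unfolding VT using UV T Y by (simp add: mult_smult_assoc_mat[of _ 1 N _ 1])
    also have "four_block_mat (X * ?T e * Y) (e \<cdot>\<^sub>m (X * T1 * U)) (e \<cdot>\<^sub>m (V * T1 * Y)) (e \<cdot>\<^sub>m (V * T1 * U))
       = M e * four_block_mat (1\<^sub>m R) (0\<^sub>m R 1) (0\<^sub>m 1 R) (e \<cdot>\<^sub>m 1\<^sub>m 1)"
    proof -
      have c: "X * ?T e * Y \<in> carrier_mat R R" "X * T1 * U \<in> carrier_mat R 1"
        "e \<cdot>\<^sub>m (V * T1 * Y) \<in> carrier_mat 1 R" "V * T1 * U \<in> carrier_mat 1 1"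
        using X Y T UV Te by auto
      show ?thesis unfolding M_def by (rule four_block_scale_col[OF c])
    qed
    finally show ?thesis .
  qed
  have Mc: "M e \<in> carrier_mat (R + 1) (R + 1)" for e
    unfolding M_def using X Y T UV by (intro four_block_carrier_mat) auto
  have "det (M e) = 0" if "e \<noteq> 0" for e
  proof -
    have "det (X' * ?T e * Y') = 0"
      using max[of e] XY' T unfolding rk_ge_def by auto
    then have "det (M e) * det (four_block_mat (1\<^sub>m R) (0\<^sub>m R 1) (0\<^sub>m 1 R) (e \<cdot>\<^sub>m 1\<^sub>m 1)) = 0"
      unfolding prod by (subst (asm) det_mult[OF Mc]) auto
    moreover have "det (four_block_mat (1\<^sub>m R) (0\<^sub>m R 1) (0\<^sub>m 1 R) (e \<cdot>\<^sub>m 1\<^sub>m 1)) = e"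
      by (subst det_four_block_mat_lower_left_zero[of _ R _ 1]) (auto simp: det_smult)
    ultimately show ?thesis using that by auto
  qed
  moreover have "(\<lambda>e. det (M e)) \<in> univ_funs"
  proof (rule UF.det[OF Mc])
    fix i j assume ij: "i < R + 1" "j < R + 1"
    have c: "X * T0 * Y \<in> carrier_mat R R" "X * T1 * Y \<in> carrier_mat R R" "X * T1 * U \<in> carrier_mat R 1"
        "V * T1 * Y \<in> carrier_mat 1 R" "V * T1 * U \<in> carrier_mat 1 1"
      using X Y T UV by auto
    have "X * ?T e * Y = X * T0 * Y + e \<cdot>\<^sub>m (X * T1 * Y)" for e
      using X T Y by (simp add: mult_add_distrib_mat[of _ R N _ N] mult_smult_distrib[of _ R N _ N]
        add_mult_distrib_mat[of _ R N _ _ R] mult_smult_assoc_mat[of _ R N _ R] del: assoc_mult_mat)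
    then have "M e $$ (i, j) = (if i < R then if j < R then (X * T0 * Y) $$ (i, j) + e * (X * T1 * Y) $$ (i, j)
       else (X * T1 * U) $$ (i, 0) else if j < R then e * (V * T1 * Y) $$ (0, j) else (V * T1 * U) $$ (0, 0))" for e
      unfolding M_def using c X Y UV
      by (subst four_block_border_index[of _ R, OF _ _ _ _ ij]) (auto simp del: assoc_mult_mat)
    then have *: "(\<lambda>e. M e $$ (i, j)) = (\<lambda>e. if i < R then if j < R then (X * T0 * Y) $$ (i, j) + e * (X * T1 * Y) $$ (i, j)
       else (X * T1 * U) $$ (i, 0) else if j < R then e * (V * T1 * Y) $$ (0, j) else (V * T1 * U) $$ (0, 0))"
      by blast
    have lin: "(\<lambda>e. a + e * b) \<in> univ_funs" "(\<lambda>e. e * b) \<in> univ_funs" for a b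
      by (intro UF.add UF.mult UF.const univ_funs_id)+
    show "(\<lambda>e. M e $$ (i, j)) \<in> univ_funs"
      unfolding * by (cases "i < R"; cases "j < R") (simp_all add: lin UF.const del: assoc_mult_mat)
  qed
  \<comment> \<open>The factor \<open>e\<close> could be cancelled for \<open>e \<noteq> 0\<close>
    only; polynomiality carries the vanishing to \<open>e = 0\<close>.\<close>
  ultimately have "det (M 0) = 0" using univ_funs_eq_0[of "\<lambda>e. det (M e)" "{0}" 0] by auto
  moreover have "det (M 0) = det (X * T0 * Y) * det (V * T1 * U)"
  proof -
    have z: "0 \<cdot>\<^sub>m (V * T1 * Y) = 0\<^sub>m 1 R" "T0 + 0 \<cdot>\<^sub>m T1 = T0" using UV T Y by auto
    show ?thesis unfolding M_def z
      by (rule det_four_block_mat_lower_left_zero) (use X Y UV T in auto)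
  qed
  moreover have "det (V * T1 * U) = v \<bullet> (T1 *\<^sub>v u)"
  proof -
    have "det (V * T1 * U) = (V * T1 * U) $$ (0, 0)"
      using UV T by (intro det_single) auto
    also have "\<dots> = v \<bullet> (T1 *\<^sub>v u)"
    proof -
      have "row V 0 = v" "col U 0 = u" using u(1) v(1) by (auto intro!: eq_vecI simp: U_def V_def)
      then show ?thesis using mult3_index[OF UV(2) T(2) UV(1), of 0 0] by simp
    qed
    finally show ?thesis .
  qed
  ultimately show ?thesis using nz by simp
qed

section \<open>Truncated Toeplitz matrices\<close>

text \<open>The truncated block Toeplitz matrix of multiplication by a polynomial matrix modulo the
  \<open>j\<close>-th power of the variable; index \<open>i * j + s\<close> stands for the coefficient of degree \<open>s\<close>
  in component \<open>i\<close>.\<close>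

definition toep :: "nat \<Rightarrow> complex poly mat \<Rightarrow> complex mat" where
  "toep j F = mat (dim_row F * j) (dim_col F * j) (\<lambda>(p, q).
     if q mod j \<le> p mod j then coeff (F $$ (p div j, q div j)) (p mod j - q mod j) else 0)"

lemma toep_carrier [simp]: "F \<in> carrier_mat n m \<Longrightarrow> toep j F \<in> carrier_mat (n * j) (m * j)"
  unfolding toep_def by auto

lemma dim_toep [simp]: "dim_row (toep j F) = dim_row F * j" "dim_col (toep j F) = dim_col F * j"
  unfolding toep_def by auto

lemma div_less_iff: "0 < j \<Longrightarrow> p div j < n \<longleftrightarrow> p < n * (j::nat)"
  by (simp add: div_less_iff_less_mult)

lemma toep_index:
  assumes "F \<in> carrier_mat n m" "p < n * j" "q < m * j"
  shows "toep j F $$ (p, q) =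
    (if q mod j \<le> p mod j then coeff (F $$ (p div j, q div j)) (p mod j - q mod j) else 0)"
  using assms unfolding toep_def by auto

lemma sum_div_mod:
  assumes "0 < (j::nat)"
  shows "(\<Sum>x<m * j. f (x div j) (x mod j)) = (\<Sum>a<m. \<Sum>w<j. f a w)"
proof -
  have "(\<Sum>a<m. \<Sum>w<j. f a w) = (\<Sum>(a, w)\<in>{..<m} \<times> {..<j}. f a w)"
    by (simp add: sum.cartesian_product)
  also have "\<dots> = (\<Sum>x<m * j. f (x div j) (x mod j))"
  proof (rule sum.reindex_bij_witness[of _ "\<lambda>x. (x div j, x mod j)" "\<lambda>(a, w). a * j + w"])
    fix x assume x: "x \<in> {..<m} \<times> {..<j}"
    then obtain a w where aw: "x = (a, w)" "a < m" "w < j" by auto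
    have "a * j + w < Suc a * j" using aw by simp
    also have "Suc a * j \<le> m * j" using aw by (intro mult_right_mono) auto
    finally show "(case x of (a, w) \<Rightarrow> a * j + w) \<in> {..<m * j}" using aw by simp
  qed (use assms in \<open>auto simp: div_less_iff\<close>)
  finally show ?thesis by simp
qed

lemma conv_shift:
  fixes f g :: "nat \<Rightarrow> complex"
  assumes "s < j"
  shows "(\<Sum>w<j. (if w \<le> s then f (s - w) else 0) * (if r \<le> w then g (w - r) else 0)) =
    (if r \<le> s then \<Sum>d\<le>s - r. f d * g (s - r - d) else 0)"
proof -
  have "(\<Sum>w<j. (if w \<le> s then f (s - w) else 0) * (if r \<le> w then g (w - r) else 0)) =
      (\<Sum>w\<in>{r..s}. f (s - w) * g (w - r))"
    using assms by (intro sum.mono_neutral_cong_right) auto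
  also have "\<dots> = (if r \<le> s then \<Sum>d\<le>s - r. f d * g (s - r - d) else 0)"
  proof (cases "r \<le> s")
    case True
    have "(\<Sum>w\<in>{r..s}. f (s - w) * g (w - r)) = (\<Sum>d\<le>s - r. f d * g (s - r - d))"
      by (rule sum.reindex_bij_witness[of _ "\<lambda>d. s - d" "\<lambda>w. s - w"]) (use True in auto)
    then show ?thesis using True by simp
  qed auto
  finally show ?thesis .
qed

text \<open>Reduction modulo \<open>t ^ j\<close> is a ring homomorphism, so equivalences over the
  polynomial ring descend to equivalences of complex matrices.\<close>

lemma toep_mult:
  assumes F: "F \<in> carrier_mat n m" and G: "G \<in> carrier_mat m l" and j: "0 < j"
  shows "toep j (F * G) = toep j F * toep j G"
proof (rule eq_matI)
  have FG: "F * G \<in> carrier_mat n l" using F G by simp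
  fix p q assume "p < dim_row (toep j F * toep j G)" "q < dim_col (toep j F * toep j G)"
  then have p: "p < n * j" and q: "q < l * j" using F G by (auto simp: toep_def)
  have pq': "p div j < n" "q div j < l" "p mod j < j" using p q j by (auto simp: div_less_iff)
  let ?f = "\<lambda>a w. (if w \<le> p mod j then coeff (F $$ (p div j, a)) (p mod j - w) else 0) *
       (if q mod j \<le> w then coeff (G $$ (a, q div j)) (w - q mod j) else 0)"
  have "(toep j F * toep j G) $$ (p, q) = (\<Sum>x<m * j. toep j F $$ (p, x) * toep j G $$ (x, q))"
    using F G p q
    by (simp add: scalar_prod_def lessThan_atLeast0)
  also have "\<dots> = (\<Sum>x<m * j. ?f (x div j) (x mod j))"
    by (intro sum.cong refl) (simp add: toep_index[OF F p] toep_index[OF G _ q])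
  also have "\<dots> = (\<Sum>a<m. \<Sum>w<j. ?f a w)" by (rule sum_div_mod[OF j])
  also have "\<dots> = (\<Sum>a<m. if q mod j \<le> p mod j then
      \<Sum>d\<le>p mod j - q mod j. coeff (F $$ (p div j, a)) d * coeff (G $$ (a, q div j)) (p mod j - q mod j - d) else 0)"
    by (intro sum.cong refl conv_shift pq')
  also have "\<dots> = (if q mod j \<le> p mod j then coeff ((F * G) $$ (p div j, q div j)) (p mod j - q mod j) else 0)"
    using F G pq' by (auto simp: scalar_prod_def coeff_sum coeff_mult lessThan_atLeast0)
  finally show "toep j (F * G) $$ (p, q) = (toep j F * toep j G) $$ (p, q)"
    by (simp add: toep_index[OF FG p q])
qed (use F G in \<open>auto simp: toep_def\<close>)

lemma toep_four_block:
  assumes A: "A \<in> carrier_mat n1 m1" and B: "B \<in> carrier_mat n1 m2"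
    and C: "C \<in> carrier_mat n2 m1" and D: "D \<in> carrier_mat n2 m2" and j: "0 < j"
  shows "toep j (four_block_mat A B C D) = four_block_mat (toep j A) (toep j B) (toep j C) (toep j D)"
proof (rule eq_matI)
  let ?R = "four_block_mat (toep j A) (toep j B) (toep j C) (toep j D)"
  have T: "toep j A \<in> carrier_mat (n1 * j) (m1 * j)" "toep j B \<in> carrier_mat (n1 * j) (m2 * j)"
    "toep j C \<in> carrier_mat (n2 * j) (m1 * j)" "toep j D \<in> carrier_mat (n2 * j) (m2 * j)"
    using A B C D by auto
  fix p q assume "p < dim_row ?R" "q < dim_col ?R"
  then have pq: "p < n1 * j + n2 * j" "q < m1 * j + m2 * j" using A B C D by auto
  have F: "four_block_mat A B C D \<in> carrier_mat (n1 + n2) (m1 + m2)" using A D by auto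
  have pq': "p div j < n1 + n2" "q div j < m1 + m2"
    using pq j by (auto simp: div_less_iff add_mult_distrib)
  have sub: "(x - a * j) div j = x div j - a" "(x - a * j) mod j = x mod j" if "\<not> x < a * j" for x a
  proof -
    obtain y where "x = y + a * j" using \<open>\<not> x < a * j\<close> by (metis add.commute le_Suc_ex not_less)
    then show "(x - a * j) div j = x div j - a" "(x - a * j) mod j = x mod j" using j by auto
  qed
  have lt: "x div j < a \<longleftrightarrow> x < a * j" for x a by (rule div_less_iff[OF j])
  show "toep j (four_block_mat A B C D) $$ (p, q) = ?R $$ (p, q)"
    using pq pq' A B C D T
    by (auto simp: toep_index[OF F] toep_index[OF A] toep_index[OF B] toep_index[OF C] toep_index[OF D]
        add_mult_distrib lt sub)
qed (use A B C D in \<open>auto simp: toep_def add_mult_distrib\<close>)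

lemma toep_zero: "toep j (0\<^sub>m n m) = 0\<^sub>m (n * j) (m * j)"
proof (rule eq_matI)
  fix p q assume "p < dim_row (0\<^sub>m (n * j) (m * j))" "q < dim_col (0\<^sub>m (n * j) (m * j))"
  then have pq: "p < n * j" "q < m * j" by auto
  then have "0 < j" by (cases j) auto
  then have "p div j < n" "q div j < m" using pq by (auto simp: div_less_iff)
  then show "toep j (0\<^sub>m n m) $$ (p, q) = 0\<^sub>m (n * j) (m * j) $$ (p, q)"
    using pq by (auto simp: toep_index[of _ n m])
qed (auto simp: toep_def)

text \<open>A determinant with nonzero constant term is a unit modulo \<open>t ^ j\<close>:
  multiplication by the adjugate leaves a triangular matrix with that constant on the
  diagonal.\<close>

lemma det_toep_nz:
  assumes M: "M \<in> carrier_mat n n" and c: "coeff (det M) 0 \<noteq> 0" and j: "0 < j"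
  shows "det (toep j M) \<noteq> 0"
proof
  assume 0: "det (toep j M) = 0"
  have adj: "adj_mat M \<in> carrier_mat n n" "M * adj_mat M = det M \<cdot>\<^sub>m 1\<^sub>m n"
    using adj_mat[OF M] by auto
  let ?D = "toep j (det M \<cdot>\<^sub>m 1\<^sub>m n)"
  have D: "det M \<cdot>\<^sub>m 1\<^sub>m n \<in> carrier_mat n n" by simp
  have "?D = toep j M * toep j (adj_mat M)"
    using toep_mult[OF M adj(1) j] adj(2) by simp
  then have "det ?D = 0" using 0 M adj(1) det_mult[of "toep j M" "n * j" "toep j (adj_mat M)"] by simp
  moreover have "det ?D = prod_list (diag_mat ?D)"
  proof (rule det_lower_triangular)
    show "?D \<in> carrier_mat (n * j) (n * j)" by simp
    fix p q assume pq: "p < q" "q < n * j"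
    then have d: "p div j < n" "q div j < n" using j by (auto simp: div_less_iff)
    have "q mod j \<le> p mod j \<Longrightarrow> p div j \<noteq> q div j"
      using pq(1) by (metis add_le_cancel_left div_mult_mod_eq not_le)
    then show "?D $$ (p, q) = 0" using pq d by (auto simp: toep_index[OF D])
  qed
  moreover have "prod_list (diag_mat ?D) \<noteq> 0"
  proof -
    have "?D $$ (p, p) = coeff (det M) 0" if "p < n * j" for p
      using that j by (auto simp: toep_index[OF D] div_less_iff)
    then show ?thesis using c by (auto simp: prod_list_zero_iff diag_mat_def toep_def)
  qed
  ultimately show False by simp
qed

text \<open>Transposition reverses the order of degrees; the involution \<open>\<rho>\<close>, which
  reverses degrees inside each component, restores the Toeplitz shape.\<close>

lemma cork_toep_transpose:
  assumes M: "M \<in> carrier_mat n n" and c: "cork (toep j M) d" and j: "0 < j"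
  shows "cork (toep j (transpose_mat M)) d"
proof -
  define \<rho> where "\<rho> p = (p div j) * j + (j - 1 - p mod j)" for p :: nat
  have rdm: "\<rho> p div j = p div j" "\<rho> p mod j = j - 1 - p mod j" for p
    unfolding \<rho>_def using j by (auto simp: div_add1_eq)
  have rr: "\<rho> (\<rho> p) = p" for p
  proof -
    have "p mod j < j" using j by simp
    then have "\<rho> (\<rho> p) = p div j * j + p mod j" unfolding \<rho>_def[of "\<rho> p"] rdm by simp
    then show ?thesis by simp
  qed
  have rN: "\<rho> p < n * j" if "p < n * j" for p
    using that j by (simp add: div_less_iff[OF j, symmetric] rdm)
  let ?N = "n * j"
  define R where "R = mat ?N ?N (\<lambda>(p, q). if q = \<rho> p then 1 else (0::complex))"
  have R: "R \<in> carrier_mat ?N ?N" unfolding R_def by simp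
  have RA: "(R * A) $$ (p, q) = A $$ (\<rho> p, q)" if "A \<in> carrier_mat ?N ?N" "p < ?N" "q < ?N" for A p q
  proof -
    have "(R * A) $$ (p, q) = (\<Sum>x<?N. (if x = \<rho> p then 1 else 0) * A $$ (x, q))"
      using that by (simp add: R_def scalar_prod_def lessThan_atLeast0)
    also have "\<dots> = (\<Sum>x<?N. if x = \<rho> p then A $$ (x, q) else 0)" by (intro sum.cong) auto
    finally show ?thesis using rN[OF that(2)] by simp
  qed
  have AR: "(A * R) $$ (p, q) = A $$ (p, \<rho> q)" if "A \<in> carrier_mat ?N ?N" "p < ?N" "q < ?N" for A p q
  proof -
    have e: "q = \<rho> x \<longleftrightarrow> x = \<rho> q" for x using rr by metis
    have "(A * R) $$ (p, q) = (\<Sum>x<?N. A $$ (p, x) * (if x = \<rho> q then 1 else 0))"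
      using that e by (simp add: R_def scalar_prod_def lessThan_atLeast0)
    also have "\<dots> = (\<Sum>x<?N. if x = \<rho> q then A $$ (p, x) else 0)" by (intro sum.cong) auto
    finally show ?thesis using rN[OF that(3)] by simp
  qed
  have "R * R = 1\<^sub>m ?N"
  proof (rule eq_matI)
    fix p q assume "p < dim_row (1\<^sub>m ?N)" "q < dim_col (1\<^sub>m ?N)"
    then show "(R * R) $$ (p, q) = 1\<^sub>m ?N $$ (p, q)"
      using RA[OF R, of p q] rN rr by (auto simp: R_def)
  qed (use R in auto)
  then have "det R * det R = 1" using det_mult[OF R R] by simp
  then have dR: "det R \<noteq> 0" by auto
  have T: "toep j M \<in> carrier_mat ?N ?N" using M by simp
  have MT: "transpose_mat M \<in> carrier_mat n n" using M by simp
  have "toep j (transpose_mat M) = R * transpose_mat (toep j M) * R"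
  proof (rule eq_matI)
    fix p q assume "p < dim_row (R * transpose_mat (toep j M) * R)" "q < dim_col (R * transpose_mat (toep j M) * R)"
    then have pq: "p < ?N" "q < ?N" using R by auto
    have pq': "p div j < n" "q div j < n" using pq j by (auto simp: div_less_iff)
    have m: "p mod j < j" "q mod j < j" using j by auto
    have "(R * transpose_mat (toep j M) * R) $$ (p, q) = toep j M $$ (\<rho> q, \<rho> p)"
    proof -
      have TT: "transpose_mat (toep j M) \<in> carrier_mat ?N ?N" using T by simp
      have RT: "R * transpose_mat (toep j M) \<in> carrier_mat ?N ?N" using R TT by (rule mult_carrier_mat)
      have "(R * transpose_mat (toep j M) * R) $$ (p, q) = (R * transpose_mat (toep j M)) $$ (p, \<rho> q)"
        by (rule AR[OF RT pq])
      also have "\<dots> = transpose_mat (toep j M) $$ (\<rho> p, \<rho> q)" by (rule RA[OF TT pq(1) rN[OF pq(2)]])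
      also have "\<dots> = toep j M $$ (\<rho> q, \<rho> p)" using M rN[OF pq(1)] rN[OF pq(2)] by simp
      finally show ?thesis .
    qed
    also have "\<dots> = toep j (transpose_mat M) $$ (p, q)"
    proof -
      have "j - 1 - p mod j \<le> j - 1 - q mod j \<longleftrightarrow> q mod j \<le> p mod j"
        "q mod j \<le> p mod j \<Longrightarrow> j - 1 - q mod j - (j - 1 - p mod j) = p mod j - q mod j"
        using m by linarith+
      moreover have "transpose_mat M $$ (p div j, q div j) = M $$ (q div j, p div j)"
        using M pq' by simp
      ultimately show ?thesis
        unfolding toep_index[OF M rN[OF pq(2)] rN[OF pq(1)]] toep_index[OF MT pq] rdm by simp
    qed
    finally show "toep j (transpose_mat M) $$ (p, q) = (R * transpose_mat (toep j M) * R) $$ (p, q)" by simp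
  qed (use R M in \<open>auto simp: toep_def\<close>)
  then show ?thesis
    using cork_mult'[OF _ R dR R dR cork_transpose[OF T c]] T by simp
qed

lemma cork_uminus:
  assumes "T \<in> carrier_mat N N" "cork T d" shows "cork (- T) d"
proof -
  have "det (- 1\<^sub>m N :: complex mat) \<noteq> 0"
    by (subst det_upper_triangular[of _ N]) (auto simp: diag_mat_def prod_list_zero_iff)
  then have "cork (- 1\<^sub>m N * T * 1\<^sub>m N) d"
    using assms by (intro cork_mult'[of _ N]) auto
  then show ?thesis using assms by simp
qed

lemma toep_uminus: "F \<in> carrier_mat n m \<Longrightarrow> 0 < j \<Longrightarrow> toep j (- F) = - toep j F"
  by (intro eq_matI) (auto simp: toep_def div_less_iff)

lemma cork_toep_skew:
  assumes M: "M \<in> carrier_mat n n" and c: "cork (toep j M) d" and j: "0 < j"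
  shows "cork (toep j (four_block_mat (0\<^sub>m n n) M (- transpose_mat M) (0\<^sub>m n n))) (d + d)"
proof -
  have "cork (toep j (- transpose_mat M)) d"
    using cork_uminus[OF _ cork_toep_transpose[OF M c j], of "n * j"] M toep_uminus[of "transpose_mat M" n n j] j
    by simp
  then show ?thesis
    using M j c by (simp add: toep_four_block[of _ n n _ n _ n] toep_zero cork_antidiag)
qed

section \<open>Corank of the blocks\<close>

text \<open>The pencil \<open>A + (t - l) B\<close>, expanded in \<open>t\<close> at the candidate
  eigenvalue \<open>l\<close>. For Lie algebra forms its constant term is the form at
  \<open>x - l * a\<close>.\<close>

definition lpencil :: "complex mat \<Rightarrow> complex mat \<Rightarrow> complex \<Rightarrow> complex poly mat" where
  "lpencil A B l = mat (dim_row A) (dim_col A) (\<lambda>(i, j). [:A $$ (i, j) - l * B $$ (i, j), B $$ (i, j):])"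

lemma lpencil_carrier [simp]: "A \<in> carrier_mat n m \<Longrightarrow> lpencil A B l \<in> carrier_mat n m"
  unfolding lpencil_def by auto

lemma dim_lpencil [simp]: "dim_row (lpencil A B l) = dim_row A" "dim_col (lpencil A B l) = dim_col A"
  unfolding lpencil_def by simp_all

lemma const_poly_hom: "comm_ring_hom (\<lambda>c::complex. [:c:])"
  by unfold_locales (auto simp: one_pCons)

lemma lpencil_mult:
  assumes A: "A \<in> carrier_mat n n" and B: "B \<in> carrier_mat n n"
    and P: "P \<in> carrier_mat n n" and Q: "Q \<in> carrier_mat n n"
  shows "lpencil (P * A * Q) (P * B * Q) l =
    map_mat (\<lambda>c. [:c:]) P * lpencil A B l * map_mat (\<lambda>c. [:c:]) Q"
proof -
  interpret comm_ring_hom "\<lambda>c::complex. [:c:]" by (rule const_poly_hom)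
  let ?h = "map_mat (\<lambda>c::complex. [:c:])"
  have e: "lpencil A B l = ?h A + [:- l, 1:] \<cdot>\<^sub>m ?h B" if "A \<in> carrier_mat n n" "B \<in> carrier_mat n n" for A B
    using that by (intro eq_matI) (auto simp: lpencil_def)
  have c: "?h A \<in> carrier_mat n n" "?h B \<in> carrier_mat n n" "?h P \<in> carrier_mat n n" "?h Q \<in> carrier_mat n n"
    using assms by auto
  have h3: "?h (P * C * Q) = ?h P * ?h C * ?h Q" if "C \<in> carrier_mat n n" for C
    using that P Q by (simp add: mat_hom_mult[of _ n n _ n] del: assoc_mult_mat)
  have "lpencil (P * A * Q) (P * B * Q) l = ?h P * ?h A * ?h Q + [:- l, 1:] \<cdot>\<^sub>m (?h P * ?h B * ?h Q)"
  proof -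
    have "P * A * Q \<in> carrier_mat n n" "P * B * Q \<in> carrier_mat n n"
      using assms by (auto intro!: mult_carrier_mat simp del: assoc_mult_mat)
    then show ?thesis by (simp only: e h3[OF A] h3[OF B])
  qed
  also have "\<dots> = ?h P * (?h A + [:- l, 1:] \<cdot>\<^sub>m ?h B) * ?h Q"
    using c by (simp add: mult_add_distrib_mat[of _ n n _ n] add_mult_distrib_mat[of _ n n _ _ n]
        mult_smult_distrib[of _ n n _ n] mult_smult_assoc_mat[of _ n n _ n] del: assoc_mult_mat)
  finally show ?thesis using e[OF A B] by simp
qed

lemma det_toep_const:
  assumes P: "P \<in> carrier_mat n n" "det P \<noteq> 0" and j: "0 < j"
  shows "det (toep j (map_mat (\<lambda>c. [:c:]) P)) \<noteq> 0"
proof -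
  interpret comm_ring_hom "\<lambda>c::complex. [:c:]" by (rule const_poly_hom)
  have "det (map_mat (\<lambda>c. [:c:]) P) = [:det P:]" by (rule hom_det)
  then show ?thesis using P j by (intro det_toep_nz[of _ n]) auto
qed

lemma lpencil_four_block:
  assumes "A1 \<in> carrier_mat n1 n1" "A2 \<in> carrier_mat n2 n2" "B1 \<in> carrier_mat n1 n1" "B2 \<in> carrier_mat n2 n2"
  shows "lpencil (four_block_mat A1 (0\<^sub>m n1 n2) (0\<^sub>m n2 n1) A2) (four_block_mat B1 (0\<^sub>m n1 n2) (0\<^sub>m n2 n1) B2) l
   = four_block_mat (lpencil A1 B1 l) (0\<^sub>m n1 n2) (0\<^sub>m n2 n1) (lpencil A2 B2 l)"
  using assms by (intro eq_matI) (auto simp: lpencil_def)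

fun bdim :: "jk_block \<Rightarrow> nat" where
  "bdim (JK_Jordan _ m) = m + m"
| "bdim (JK_Kronecker k) = k + (k - 1)"

lemma block_carrier: "block_A b \<in> carrier_mat (bdim b) (bdim b)" "block_B b \<in> carrier_mat (bdim b) (bdim b)"
  by (cases b rule: block_A.cases; simp add: skew_of_def std_skew_def kron_M1_def kron_M2_def jordan_block_def)+

text \<open>Covers finite and infinite eigenvalues at once: they differ in whether the linear
  polynomial stands on the diagonal or above it.\<close>

definition jordan_pencil :: "nat \<Rightarrow> complex poly \<Rightarrow> complex poly \<Rightarrow> complex poly mat" where
  "jordan_pencil m z e = mat m m (\<lambda>(i, j). if i = j then z else if Suc i = j then e else 0)"

lemma jordan_pencil_carrier [simp]: "jordan_pencil m z e \<in> carrier_mat m m"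
  unfolding jordan_pencil_def by simp

lemma lpencil_jordan_Some:
  "lpencil (block_A (JK_Jordan (Some \<mu>) m)) (block_B (JK_Jordan (Some \<mu>) m)) l =
   four_block_mat (0\<^sub>m m m) (jordan_pencil m [:\<mu> - l, 1:] 1) (- transpose_mat (jordan_pencil m [:\<mu> - l, 1:] 1)) (0\<^sub>m m m)"
  by (intro eq_matI)
    (auto simp: lpencil_def skew_of_def std_skew_def jordan_block_def jordan_pencil_def one_pCons)

lemma lpencil_jordan_None:
  "lpencil (block_A (JK_Jordan None m)) (block_B (JK_Jordan None m)) l =
   four_block_mat (0\<^sub>m m m) (jordan_pencil m 1 [:- l, 1:]) (- transpose_mat (jordan_pencil m 1 [:- l, 1:])) (0\<^sub>m m m)"
  by (intro eq_matI)
    (auto simp: lpencil_def skew_of_def std_skew_def jordan_block_def jordan_pencil_def one_pCons)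

lemma det_jordan_pencil: "det (jordan_pencil m z e) = z ^ m"
proof -
  have "det (jordan_pencil m z e) = prod_list (diag_mat (jordan_pencil m z e))"
    by (rule det_upper_triangular[of _ m]) (auto simp: jordan_pencil_def)
  also have "diag_mat (jordan_pencil m z e) = replicate m z"
    by (auto simp: diag_mat_def jordan_pencil_def intro: nth_equalityI)
  finally show ?thesis by simp
qed

lemma cork_toep_jordan_unit:
  assumes "coeff z 0 \<noteq> 0" "0 < j" shows "cork (toep j (jordan_pencil m z e)) 0"
  using assms by (intro cork_0[of _ "m * j"] det_toep_nz[of _ m])
    (auto simp: det_jordan_pencil coeff_0_power)

text \<open>Clearing the first column of \<open>t + J\<close> with the vector of powers of \<open>- t\<close> leaves a
  monomial matrix with a single entry \<open>t ^ m\<close> up to sign and unit entries otherwise.\<close>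

lemma cork_toep_jordan_nil:
  assumes m: "0 < m" and j: "0 < j"
  shows "cork (toep j (jordan_pencil m [:0, 1:] 1)) (min m j)"
proof -
  let ?t = "[:0, 1:] :: complex poly"
  define u where "u i = monom ((-1) ^ i :: complex) i" for i
  have tu: "?t * u i = - u (Suc i)" for i
    by (simp add: u_def monom_Suc minus_monom[symmetric])
  have u0: "u 0 = 1" by (simp add: u_def monom_0 one_pCons)
  define W where "W = mat m m (\<lambda>(i, k). if k = 0 then u i else if i = k then 1 else (0 :: complex poly))"
  \<comment> \<open>After multiplication by \<open>W\<close> the other columns still contain
    \<open>?t\<close> on the diagonal; the unitriangular \<open>L\<close> absorbs these
    entries.\<close>
  define L where "L = mat m m (\<lambda>(i, k). if i = k then 1 else if i = Suc k then ?t else 0)"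
  define S where "S = mat m m (\<lambda>(i, k). if k = 0 then if i = m - 1 then - u m else 0 else if k = Suc i then 1 else (0 :: complex poly))"
  have c: "W \<in> carrier_mat m m" "L \<in> carrier_mat m m" "S \<in> carrier_mat m m" unfolding W_def L_def S_def by auto
  have MW: "(jordan_pencil m ?t 1 * W) $$ (i, k) = ?t * W $$ (i, k) + (if Suc i < m then W $$ (Suc i, k) else 0)"
    if "i < m" "k < m" for i k
  proof -
    have "(jordan_pencil m ?t 1 * W) $$ (i, k) =
      (\<Sum>l<m. (if l = i then ?t * W $$ (i, k) else 0) + (if l = Suc i then W $$ (Suc i, k) else 0))"
      using that c by (auto simp: scalar_prod_def lessThan_atLeast0 jordan_pencil_def intro!: sum.cong)
    then show ?thesis using that by (simp add: sum.distrib)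
  qed
  have LS: "(L * S) $$ (i, k) = S $$ (i, k) + (if 0 < i then ?t * S $$ (i - 1, k) else 0)"
    if "i < m" "k < m" for i k
  proof -
    have "(L * S) $$ (i, k) =
      (\<Sum>l<m. (if l = i then S $$ (i, k) else 0) + (if Suc l = i then ?t * S $$ (l, k) else 0))"
      using that c by (auto simp: scalar_prod_def lessThan_atLeast0 L_def intro!: sum.cong)
    then show ?thesis using that by (cases i) (simp_all add: sum.distrib del: mult_pCons_left)
  qed
  have eq: "jordan_pencil m ?t 1 * W = L * S"
  proof (rule eq_matI)
    fix i k assume "i < dim_row (L * S)" "k < dim_col (L * S)"
    then have ik: "i < m" "k < m" using c by auto
    have "Suc i < m \<or> Suc i = m" using ik by auto
    then show "(jordan_pencil m ?t 1 * W) $$ (i, k) = (L * S) $$ (i, k)"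
      unfolding MW[OF ik] LS[OF ik] using ik m
      by (auto simp: W_def S_def tu simp del: mult_pCons_left)
  qed (use c in \<open>auto simp: jordan_pencil_def\<close>)
  have dL: "det L = 1"
    by (subst det_lower_triangular[of m]) (auto simp: L_def diag_mat_def intro!: prod_list_neutral)
  have dW: "det W = 1"
    by (subst det_lower_triangular[of m]) (auto simp: W_def diag_mat_def u0 intro!: prod_list_neutral)
  have TL: "toep j L \<in> carrier_mat (m * j) (m * j)" "det (toep j L) \<noteq> 0"
    using det_toep_nz[OF c(2) _ j] dL c by auto
  have TW: "toep j W \<in> carrier_mat (m * j) (m * j)" "det (toep j W) \<noteq> 0"
    using det_toep_nz[OF c(1) _ j] dW c by auto
  have Sx: "S $$ (i, k) = (if k = 0 then if i = m - 1 then - u m else 0 else if k = Suc i then 1 else 0)"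
    if "i < m" "k < m" for i k
    using that by (simp add: S_def)
  \<comment> \<open>The last block row of \<open>S\<close> is \<open>t ^ m\<close> up to sign, so
    its coefficients of degree below \<open>m\<close> are zero rows.\<close>
  let ?I = "{..<(m - 1) * j} \<union> {(m - 1) * j + m..<m * j}"
  let ?s = "\<lambda>p. if p < (m - 1) * j then p + j else p - (m - 1) * j - m"
  have mj: "m * j = (m - 1) * j + j" using m by (cases m) auto
  have pp: "partial_perm (m * j) ?I (toep j S)"
    unfolding partial_perm_def
  proof (intro conjI exI[of _ ?s] exI[of _ "\<lambda>p. if p < (m - 1) * j then 1 else - ((-1) ^ m)"] allI impI)
    show "toep j S \<in> carrier_mat (m * j) (m * j)" using c by simp
    show "?I \<subseteq> {..<m * j}" using mj by auto
    show "inj_on ?s ?I" by (rule inj_onI) (use mj in \<open>auto split: if_splits\<close>)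
    show "?s ` ?I \<subseteq> {..<m * j}" using mj by auto
    show "\<forall>p\<in>?I. (if p < (m - 1) * j then 1 else - ((-1) ^ m)) \<noteq> (0::complex)" by auto
    fix p q assume pq: "p < m * j" "q < m * j"
    have d: "p div j < m" "q div j < m" "p mod j < j" "q mod j < j" using pq j by (auto simp: div_less_iff)
    have pd: "p = p div j * j + p mod j" "q = q div j * j + q mod j" by auto
    show "toep j S $$ (p, q) = (if p \<in> ?I \<and> q = ?s p then if p < (m - 1) * j then 1 else - ((-1) ^ m) else 0)"
    proof (cases "p < (m - 1) * j")
      case True
      then have pm: "p div j < m - 1" using j by (simp add: div_less_iff)
      have iff: "q div j = Suc (p div j) \<and> q mod j = p mod j \<longleftrightarrow> q = p + j"
      proof
        assume "q div j = Suc (p div j) \<and> q mod j = p mod j"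
        then show "q = p + j" using pd by (metis add.assoc add.commute mult_Suc)
      qed (use j in auto)
      have "toep j S $$ (p, q) = (if q mod j \<le> p mod j \<and> q div j = Suc (p div j) \<and> p mod j - q mod j = 0 then 1 else 0)"
        using pm d pq m by (auto simp: toep_index[OF c(3)] Sx)
      also have "\<dots> = (if q = p + j then 1 else 0)" unfolding iff[symmetric] by auto
      finally show ?thesis using True by simp
    next
      case False
      then have pm: "p div j = m - 1" using j d by (simp add: div_less_iff[symmetric])
      have ps: "p mod j = p - (m - 1) * j" using pd(1) pm by simp
      have "toep j S $$ (p, q) = (if q mod j \<le> p mod j \<and> q div j = 0 \<and> p mod j - q mod j = m then - ((-1) ^ m) else 0)"
        using pm d pq m by (auto simp: toep_index[OF c(3)] Sx u_def)
      also have "\<dots> = (if p mod j \<ge> m \<and> q = p mod j - m then - ((-1) ^ m) else 0)"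
      proof -
        have "q mod j \<le> p mod j \<and> q div j = 0 \<and> p mod j - q mod j = m \<longleftrightarrow> p mod j \<ge> m \<and> q = p mod j - m"
        proof
          assume "q mod j \<le> p mod j \<and> q div j = 0 \<and> p mod j - q mod j = m"
          then show "p mod j \<ge> m \<and> q = p mod j - m" using j by (auto simp: div_eq_0_iff)
        next
          assume r: "p mod j \<ge> m \<and> q = p mod j - m"
          then have "q < j" using d(3) by linarith
          then show "q mod j \<le> p mod j \<and> q div j = 0 \<and> p mod j - q mod j = m" using r by auto
        qed
        then show ?thesis by simp
      qed
      finally have "toep j S $$ (p, q) = (if p mod j \<ge> m \<and> q = p mod j - m then - ((-1) ^ m) else 0)" .
      moreover have "(m - 1) * j + m \<le> p \<longleftrightarrow> m \<le> p - (m - 1) * j" using False by linarith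
      ultimately show ?thesis using False pq ps by auto
    qed
  qed
  \<comment> \<open>Truncated subtraction is intended in \<open>j - m\<close>: for
    \<open>m \<ge> j\<close> the whole last block row is lost, which produces the minimum.\<close>
  have "card ?I = (m - 1) * j + (j - m)" using mj by (subst card_Un_disjoint) auto
  then have "card ?I + min m j = m * j" using mj by auto
  then have "cork (toep j S) (min m j)" using partial_perm_cork[OF pp] by simp
  then have "cork (toep j L * toep j S * 1\<^sub>m (m * j)) (min m j)"
    using c TL by (intro cork_mult'[of _ "m * j"]) auto
  then have "cork (toep j (L * S)) (min m j)" using c j TL by (simp add: toep_mult[of _ m m _ m])
  then have "cork (1\<^sub>m (m * j) * toep j (jordan_pencil m ?t 1) * toep j W) (min m j)"
    unfolding eq[symmetric] using c j
    by (simp add: toep_mult[of _ m m _ m] left_mult_one_mat[of _ "m * j" "m * j"])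
  then show ?thesis
    using cork_mult[of "toep j (jordan_pencil m ?t 1)" "m * j" "1\<^sub>m (m * j)" "toep j W" "min m j"] TW by simp
qed

lemma lpencil_kronecker:
  "lpencil (block_A (JK_Kronecker k)) (block_B (JK_Kronecker k)) l =
   four_block_mat (0\<^sub>m k k) (mat k (k - 1) (\<lambda>(i, j). if i = j then 1 else if i = Suc j then [:- l, 1:] else 0))
     (mat (k - 1) k (\<lambda>(j, i). if i = j then - 1 else if i = Suc j then - [:- l, 1:] else 0)) (0\<^sub>m (k - 1) (k - 1))"
  by (intro eq_matI)
    (auto simp: lpencil_def skew_of_def kron_M1_def kron_M2_def one_pCons)

lemma partial_perm_swap:
  assumes S: "S \<in> carrier_mat N N" and N: "a \<le> b" "N = b + a"
    and ent: "\<And>p q. p < N \<Longrightarrow> q < N \<Longrightarrow>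
      S $$ (p, q) = (if p < a \<and> q = p + b then 1 else if b \<le> p \<and> p = q + b then - 1 else 0)"
  shows "cork S (b - a)"
proof (rule partial_perm_cork)
  let ?I = "{..<a} \<union> {b..<N}" and ?s = "\<lambda>p. if p < a then p + b else p - b"
  show "partial_perm N ?I S"
    unfolding partial_perm_def
  proof (intro conjI exI[of _ ?s] exI[of _ "\<lambda>p. if p < a then 1 else - 1"] allI impI S)
    show "?I \<subseteq> {..<N}" using N by auto
    show "inj_on ?s ?I" by (rule inj_onI) (use N in \<open>auto split: if_splits\<close>)
    show "?s ` ?I \<subseteq> {..<N}" using N by auto
    fix p q assume "p < N" "q < N"
    then show "S $$ (p, q) = (if p \<in> ?I \<and> q = ?s p then if p < a then 1 else - 1 else 0)"
      using N by (subst ent) auto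
  qed auto
  show "card ?I + (b - a) = N" using N by (subst card_Un_disjoint) auto
qed

text \<open>The parameter enters only through the unitriangular factor \<open>L\<close>. The block
  is thus equivalent to a constant matrix of corank one, and each of the \<open>j\<close> degrees
  loses one dimension, whatever \<open>l\<close> is.\<close>

lemma cork_toep_kronecker:
  assumes k: "0 < k" and j: "0 < j"
  shows "cork (toep j (lpencil (block_A (JK_Kronecker k)) (block_B (JK_Kronecker k)) l)) j"
proof -
  let ?z = "[:- l, 1:] :: complex poly"
  let ?n = "k + (k - 1)"
  define L where "L = mat k k (\<lambda>(i, c). if i = c then 1 else if i = Suc c then ?z else 0)"
  define E where "E = mat k (k - 1) (\<lambda>(i, c). if i = c then 1 else (0 :: complex poly))"
  define D where "D = four_block_mat L (0\<^sub>m k (k - 1)) (0\<^sub>m (k - 1) k) (1\<^sub>m (k - 1))"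
  define S where "S = four_block_mat (0\<^sub>m k k) E (- transpose_mat E) (0\<^sub>m (k - 1) (k - 1))"
  have c: "L \<in> carrier_mat k k" "E \<in> carrier_mat k (k - 1)" "D \<in> carrier_mat ?n ?n" "S \<in> carrier_mat ?n ?n"
    unfolding L_def E_def D_def S_def by auto
  let ?M = "mat k (k - 1) (\<lambda>(i, j). if i = j then 1 else if i = Suc j then ?z else 0)"
  have LE: "L * E = ?M"
  proof (rule eq_matI)
    fix i q assume "i < dim_row ?M" "q < dim_col ?M"
    then have iq: "i < k" "q < k - 1" by auto
    have "(L * E) $$ (i, q) = (\<Sum>x<k. L $$ (i, x) * (if x = q then 1 else 0))"
      using iq c by (auto simp: scalar_prod_def lessThan_atLeast0 E_def intro!: sum.cong)
    also have "\<dots> = (\<Sum>x<k. if x = q then L $$ (i, x) else 0)" by (intro sum.cong) auto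
    also have "\<dots> = L $$ (i, q)" using iq by simp
    finally show "(L * E) $$ (i, q) = ?M $$ (i, q)" using iq by (simp add: L_def)
  qed (use c in auto)
  have eq: "lpencil (block_A (JK_Kronecker k)) (block_B (JK_Kronecker k)) l = D * S * transpose_mat D"
  proof -
    have DT: "transpose_mat D = four_block_mat (transpose_mat L) (0\<^sub>m k (k - 1)) (0\<^sub>m (k - 1) k) (1\<^sub>m (k - 1))"
      unfolding D_def using c by (subst transpose_four_block_mat[of _ k k _ "k - 1" _ "k - 1"]) auto
    have "D * S = four_block_mat (0\<^sub>m k k) (L * E) (- transpose_mat E) (0\<^sub>m (k - 1) (k - 1))"
      unfolding D_def S_def using c
      by (subst mult_four_block_mat[of _ k k _ "k - 1" _ "k - 1" _ _ k _ "k - 1"]) auto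
    also have "\<dots> * transpose_mat D =
        four_block_mat (0\<^sub>m k k) (L * E) (- transpose_mat E * transpose_mat L) (0\<^sub>m (k - 1) (k - 1))"
      unfolding DT using c
      by (subst mult_four_block_mat[of _ k k _ "k - 1" _ "k - 1" _ _ k _ "k - 1"]) auto
    also have "- transpose_mat E * transpose_mat L = - transpose_mat (L * E)"
      using c by (simp add: transpose_mult[of _ k k _ "k - 1"])
    finally show ?thesis unfolding lpencil_kronecker LE by (intro eq_matI) auto
  qed
  have dD: "det D = 1"
  proof -
    have "det L = 1"
      by (subst det_lower_triangular[of k]) (auto simp: L_def diag_mat_def intro!: prod_list_neutral)
    then show ?thesis unfolding D_def using c
      by (subst det_four_block_mat_lower_left_zero[of _ k _ "k - 1"]) auto
  qed
  have TD: "det (toep j D) \<noteq> 0" using det_toep_nz[OF c(3) _ j] dD by simp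
  have TDT: "det (toep j (transpose_mat D)) \<noteq> 0"
    using det_toep_nz[of "transpose_mat D" ?n j] dD c j det_transpose[OF c(3)] by simp
  have kj: "k * j = (k - 1) * j + j" "?n * j = k * j + (k - 1) * j" using k by (cases k; simp add: algebra_simps)+
  have Sx: "S $$ (i, x) = (if i < k - 1 \<and> x = k + i then 1 else if k \<le> i \<and> i = k + x then - 1 else 0)"
    if "i < ?n" "x < ?n" for i x
    using that unfolding S_def E_def by auto
  have "cork (toep j S) (k * j - (k - 1) * j)"
  proof (rule partial_perm_swap)
    show "toep j S \<in> carrier_mat (?n * j) (?n * j)" using c by simp
    show "(k - 1) * j \<le> k * j" "?n * j = k * j + (k - 1) * j" using kj by simp_all
    fix p q assume pq: "p < ?n * j" "q < ?n * j"
    have d: "p div j < ?n" "q div j < ?n" using pq j by (auto simp: div_less_iff)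
    have shift: "y div j = k + x div j \<and> y mod j = x mod j \<longleftrightarrow> y = x + k * j" for x y
    proof
      assume a: "y div j = k + x div j \<and> y mod j = x mod j"
      have "y = y div j * j + y mod j" by simp
      also have "\<dots> = x div j * j + x mod j + k * j" using a by (simp add: algebra_simps)
      finally show "y = x + k * j" by simp
    qed (use j in auto)
    have "toep j S $$ (p, q) = (if q mod j = p mod j then coeff (S $$ (p div j, q div j)) 0 else 0)"
      using pq d by (auto simp: toep_index[OF c(4)] Sx)
    also have "\<dots> = (if p div j < k - 1 \<and> q = p + k * j then 1 else if k \<le> p div j \<and> p = q + k * j then - 1 else 0)"
      unfolding shift[symmetric] Sx[OF d] by auto
    also have "p div j < k - 1 \<longleftrightarrow> p < (k - 1) * j" by (rule div_less_iff[OF j])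
    also have "k \<le> p div j \<longleftrightarrow> k * j \<le> p" using div_less_iff[OF j, of p k] by (simp only: not_less[symmetric])
    finally show "toep j S $$ (p, q) = (if p < (k - 1) * j \<and> q = p + k * j then 1
      else if k * j \<le> p \<and> p = q + k * j then - 1 else 0)" .
  qed
  then have "cork (toep j S) j" using kj by simp
  then have "cork (toep j D * toep j S * toep j (transpose_mat D)) j"
    using c TD TDT by (intro cork_mult'[of _ "?n * j"]) auto
  then show ?thesis unfolding eq
    using c j by (simp add: toep_mult[of _ ?n ?n _ ?n] del: assoc_mult_mat)
qed

text \<open>Corank of a block modulo \<open>t ^ j\<close> at \<open>l\<close>. The factor 2 arises
  because a skew block contains its Jordan matrix and the transpose.\<close>

fun loss :: "complex \<Rightarrow> nat \<Rightarrow> jk_block \<Rightarrow> nat" where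
  "loss l j (JK_Jordan mu m) = (if mu = Some l then 2 * min m j else 0)"
| "loss l j (JK_Kronecker k) = j"

text \<open>Corank of the second form alone; it detects the eigenvalue infinity, which expansions at
  finite \<open>l\<close> do not see.\<close>

fun lossB :: "jk_block \<Rightarrow> nat" where
  "lossB (JK_Jordan mu m) = (if mu = None then 2 else 0)"
| "lossB (JK_Kronecker k) = 1"

lemma cork_block:
  assumes "jk_block_ok b" and j: "0 < j"
  shows "cork (toep j (lpencil (block_A b) (block_B b) l)) (loss l j b)"
proof (cases b)
  case (JK_Kronecker k)
  then show ?thesis using assms cork_toep_kronecker[of k j l] by simp
next
  case (JK_Jordan mu m)
  then have m: "0 < m" using assms by simp
  show ?thesis
  proof (cases mu)
    case None
    have "cork (toep j (jordan_pencil m 1 [:- l, 1:])) 0"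
      by (rule cork_toep_jordan_unit) (use j in auto)
    from cork_toep_skew[OF jordan_pencil_carrier this j] show ?thesis
      unfolding JK_Jordan None lpencil_jordan_None by simp
  next
    case (Some \<mu>)
    show ?thesis
    proof (cases "\<mu> = l")
      case True
      then have "cork (toep j (jordan_pencil m [:\<mu> - l, 1:] 1)) (min m j)"
        using cork_toep_jordan_nil[OF m j] by simp
      from cork_toep_skew[OF jordan_pencil_carrier this j] show ?thesis
        unfolding JK_Jordan Some lpencil_jordan_Some using True by (simp add: mult_2)
    next
      case False
      then have "cork (toep j (jordan_pencil m [:\<mu> - l, 1:] 1)) 0"
        by (intro cork_toep_jordan_unit) (use j in auto)
      from cork_toep_skew[OF jordan_pencil_carrier this j] show ?thesis
        unfolding JK_Jordan Some lpencil_jordan_Some using False by simp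
    qed
  qed
qed

lemma cork_block_B:
  assumes "jk_block_ok b"
  shows "cork (block_B b) (lossB b)"
proof (cases b)
  case (JK_Kronecker k)
  then have k: "0 < k" using assms by simp
  let ?n = "k + (k - 1)"
  let ?I = "{1..<k} \<union> {k..<?n}" and ?s = "\<lambda>p. if p < k then k + p - 1 else p - k + 1"
  have "partial_perm ?n ?I (block_B b)"
    unfolding partial_perm_def
  proof (intro conjI exI[of _ ?s] exI[of _ "\<lambda>p. if p < k then 1 else - 1"] allI impI)
    show "block_B b \<in> carrier_mat ?n ?n" using block_carrier(2)[of b] JK_Kronecker by simp
    show "?I \<subseteq> {..<?n}" using k by auto
    show "inj_on ?s ?I" by (rule inj_onI) (use k in \<open>auto split: if_splits\<close>)
    show "?s ` ?I \<subseteq> {..<?n}" using k by auto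
    fix p q assume "p < ?n" "q < ?n"
    then show "block_B b $$ (p, q) = (if p \<in> ?I \<and> q = ?s p then if p < k then 1 else - 1 else 0)"
      using JK_Kronecker k by (auto simp: skew_of_def kron_M2_def)
  qed auto
  moreover have "card ?I + 1 = ?n" using k by (subst card_Un_disjoint) auto
  ultimately have "cork (block_B b) 1" by (rule partial_perm_cork)
  then show ?thesis using JK_Kronecker by simp
next
  case (JK_Jordan mu m)
  then have m: "0 < m" using assms by simp
  have one: "cork (1\<^sub>m m) 0" by (rule cork_0[of _ m]) auto
  show ?thesis
  proof (cases mu)
    case None
    have J: "jordan_block m (0::complex) \<in> carrier_mat m m" by simp
    have "partial_perm m {..<m - 1} (jordan_block m (0::complex))"
      unfolding partial_perm_def using m
      by (intro conjI exI[of _ Suc] exI[of _ "\<lambda>p. 1"]) (auto simp: jordan_block_def)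
    then have c: "cork (jordan_block m (0::complex)) 1" by (rule partial_perm_cork) (use m in simp)
    have "cork (block_B b) (1 + 1)"
      unfolding JK_Jordan None block_B.simps skew_of_def
      using cork_antidiag[OF J c _ cork_uminus[OF _ cork_transpose[OF J c], of m]] J by simp
    then show ?thesis using JK_Jordan None by (simp add: numeral_2_eq_2)
  next
    case (Some \<mu>)
    have "cork (block_B b) (0 + 0)"
      unfolding JK_Jordan Some block_B.simps std_skew_def
      by (intro cork_antidiag cork_uminus[of _ m] one) auto
    then show ?thesis using JK_Jordan Some by simp
  qed
qed

lemma diag_block_carrier:
  assumes "\<And>b. G b \<in> carrier_mat (bdim b) (bdim b)"
  shows "diag_block_mat (map G bs) \<in> carrier_mat (sum_list (map bdim bs)) (sum_list (map bdim bs))"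
  using assms by (induction bs) (auto simp: Let_def intro!: four_block_carrier_mat)

lemma diag_blocks_Cons:
  "diag_block_mat (map block_A (b # bs)) = four_block_mat (block_A b) (0\<^sub>m (bdim b) (sum_list (map bdim bs)))
     (0\<^sub>m (sum_list (map bdim bs)) (bdim b)) (diag_block_mat (map block_A bs))"
  "diag_block_mat (map block_B (b # bs)) = four_block_mat (block_B b) (0\<^sub>m (bdim b) (sum_list (map bdim bs)))
     (0\<^sub>m (sum_list (map bdim bs)) (bdim b)) (diag_block_mat (map block_B bs))"
  using diag_block_carrier[OF block_carrier(1), of bs] diag_block_carrier[OF block_carrier(2), of bs] block_carrier[of b]
  by (auto simp: Let_def)

lemma cork_blocks:
  assumes "\<forall>b\<in>set bs. jk_block_ok b" and j: "0 < j"
  shows "cork (toep j (lpencil (diag_block_mat (map block_A bs)) (diag_block_mat (map block_B bs)) l))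
    (sum_list (map (loss l j) bs))"
  using assms(1)
proof (induction bs)
  case Nil
  show ?case by (simp, rule cork_0[of _ 0]) (auto simp: toep_def lpencil_def)
next
  case (Cons b bs)
  note c = diag_block_carrier[OF block_carrier(1), of bs] diag_block_carrier[OF block_carrier(2), of bs] block_carrier[of b]
  let ?N = "sum_list (map bdim bs)"
  have "toep j (lpencil (diag_block_mat (map block_A (b # bs))) (diag_block_mat (map block_B (b # bs))) l) =
    four_block_mat (toep j (lpencil (block_A b) (block_B b) l)) (0\<^sub>m (bdim b * j) (?N * j)) (0\<^sub>m (?N * j) (bdim b * j))
     (toep j (lpencil (diag_block_mat (map block_A bs)) (diag_block_mat (map block_B bs)) l))"
    unfolding diag_blocks_Cons lpencil_four_block[OF c(3,1,4,2)]
    using c j by (simp add: toep_four_block[of _ "bdim b" "bdim b" _ ?N _ ?N] toep_zero)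
  then show ?case
    using cork_diag[of "toep j (lpencil (block_A b) (block_B b) l)" "bdim b * j" "loss l j b" _ "?N * j"]
      cork_block[OF _ j, of b l] Cons c by simp
qed

lemma cork_blocks_B:
  assumes "\<forall>b\<in>set bs. jk_block_ok b"
  shows "cork (diag_block_mat (map block_B bs)) (sum_list (map lossB bs))"
  using assms
proof (induction bs)
  case Nil
  show ?case by (simp, rule cork_0[of _ 0]) auto
next
  case (Cons b bs)
  note c = diag_block_carrier[OF block_carrier(1), of bs] diag_block_carrier[OF block_carrier(2), of bs] block_carrier[of b]
  show ?case unfolding diag_blocks_Cons
    using cork_diag[OF c(4) _ c(2)] cork_block_B[of b] Cons by simp
qed

lemma invertible_det:
  assumes P: "P \<in> carrier_mat n n" "invertible_mat P" shows "det P \<noteq> (0::complex)"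
proof -
  obtain Q where Q: "P * Q = 1\<^sub>m n" "Q * P = 1\<^sub>m (dim_row Q)"
    using P unfolding invertible_mat_def inverts_mat_def by auto
  have "Q \<in> carrier_mat n n"
    using arg_cong[OF Q(1), of dim_col] arg_cong[OF Q(2), of dim_col] P by auto
  then have "det P * det Q = 1" using det_mult[of P n Q] P Q by simp
  then show ?thesis by auto
qed

text \<open>A constant congruence stays invertible modulo \<open>t ^ j\<close>, so coranks can be
  summed over the blocks.\<close>

lemma jk_decomposition_cork:
  assumes jk: "jk_decomposition n A B bs" and A: "A \<in> carrier_mat n n" and B: "B \<in> carrier_mat n n"
  shows "0 < j \<Longrightarrow> cork (toep j (lpencil A B l)) (sum_list (map (loss l j) bs))"
    and "cork B (sum_list (map lossB bs))"
proof -
  obtain P where P: "P \<in> carrier_mat n n" "invertible_mat P"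
      and PA: "transpose_mat P * A * P = diag_block_mat (map block_A bs)"
      and PB: "transpose_mat P * B * P = diag_block_mat (map block_B bs)"
      and ok: "\<forall>b\<in>set bs. jk_block_ok b"
    using jk unfolding jk_decomposition_def by auto
  have dP: "det P \<noteq> 0" by (rule invertible_det[OF P])
  have PT: "transpose_mat P \<in> carrier_mat n n" "det (transpose_mat P) \<noteq> 0"
    using P dP det_transpose[OF P(1)] by auto
  show "cork B (sum_list (map lossB bs))"
    by (rule cork_mult[OF B PT P(1) dP]) (use PB cork_blocks_B[OF ok] in simp)
  assume j: "0 < j"
  let ?h = "map_mat (\<lambda>c::complex. [:c:])"
  have c: "toep j (?h (transpose_mat P)) \<in> carrier_mat (n * j) (n * j)" "toep j (?h P) \<in> carrier_mat (n * j) (n * j)"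
    "toep j (lpencil A B l) \<in> carrier_mat (n * j) (n * j)"
    using P A by auto
  have L: "lpencil A B l \<in> carrier_mat n n" "?h P \<in> carrier_mat n n" "?h (transpose_mat P) \<in> carrier_mat n n"
    using A P by auto
  have "toep j (?h (transpose_mat P)) * toep j (lpencil A B l) * toep j (?h P) =
     toep j (lpencil (diag_block_mat (map block_A bs)) (diag_block_mat (map block_B bs)) l)"
    unfolding PA[symmetric] PB[symmetric] lpencil_mult[OF A B PT(1) P(1)]
    using toep_mult[OF L(3,1) j] toep_mult[OF mult_carrier_mat[OF L(3,1)] L(2) j] by simp
  then show "cork (toep j (lpencil A B l)) (sum_list (map (loss l j) bs))"
    using cork_mult[OF c(3,1) det_toep_const[OF PT j] c(2) det_toep_const[OF P(1) dP j]] cork_blocks[OF ok j]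
    by simp
qed

section \<open>Recovering a Jordan tuple from coranks\<close>

definition jtuple :: "jk_block list \<Rightarrow> complex option \<Rightarrow> nat multiset" where
  "jtuple bs mu = mset [m. JK_Jordan nu m \<leftarrow> bs, nu = mu]"

lemma jtuple_simps [simp]:
  "jtuple [] mu = {#}"
  "jtuple (JK_Jordan nu m # bs) mu = (if nu = mu then add_mset m (jtuple bs mu) else jtuple bs mu)"
  "jtuple (JK_Kronecker k # bs) mu = jtuple bs mu"
  unfolding jtuple_def by auto

lemma kronecker_ks_simps [simp]:
  "kronecker_ks [] = {#}"
  "kronecker_ks (JK_Jordan nu m # bs) = kronecker_ks bs"
  "kronecker_ks (JK_Kronecker k # bs) = add_mset k (kronecker_ks bs)"
  unfolding kronecker_ks_def by auto

lemma sum_list_loss: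
  "sum_list (map (loss l j) bs) = j * size (kronecker_ks bs) + 2 * (\<Sum>m\<in>#jtuple bs (Some l). min m j)"
proof (induction bs)
  case (Cons b bs)
  then show ?case by (cases b) auto
qed simp

lemma sum_list_lossB:
  "sum_list (map lossB bs) = size (kronecker_ks bs) + 2 * size (jtuple bs None)"
proof (induction bs)
  case (Cons b bs)
  then show ?case by (cases b) auto
qed simp

lemma count_jtuple: "count (jtuple bs mu) m = count (mset bs) (JK_Jordan mu m)"
proof (induction bs)
  case (Cons b bs)
  then show ?case by (cases b) auto
qed simp

lemma set_jtuple: "m \<in># jtuple bs mu \<longleftrightarrow> JK_Jordan mu m \<in> set bs"
proof (induction bs)
  case (Cons b bs)
  then show ?case by (cases b) auto
qed simp

lemma set_kronecker_ks: "k \<in># kronecker_ks bs \<longleftrightarrow> JK_Kronecker k \<in> set bs"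
proof (induction bs)
  case (Cons b bs)
  then show ?case by (cases b) auto
qed simp

lemma jordan_tuples_eq:
  "jordan_tuples bs = image_mset (jtuple bs) (mset_set (jordan_eigenvalues bs))"
  unfolding jordan_tuples_def jtuple_def by simp

lemma finite_jordan_eigenvalues: "finite (jordan_eigenvalues bs)"
proof -
  have "jordan_eigenvalues bs \<subseteq> (\<lambda>b. case b of JK_Jordan mu m \<Rightarrow> mu | JK_Kronecker k \<Rightarrow> None) ` set bs"
    unfolding jordan_eigenvalues_def by force
  then show ?thesis using finite_subset by blast
qed

lemma jordan_eigenvalues_iff: "mu \<in> jordan_eigenvalues bs \<longleftrightarrow> jtuple bs mu \<noteq> {#}"
  unfolding jordan_eigenvalues_def set_jtuple[symmetric] by (auto dest: multiset_nonemptyE)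

text \<open>First differences in \<open>j\<close> count the parts above \<open>j\<close> (the
  conjugate partition), second differences give multiplicities. Parts lie strictly below
  \<open>J\<close>, so that the difference at \<open>J - 1\<close> is still available.\<close>

lemma multiset_eq_if_min_sums:
  assumes s: "\<And>j. 0 < j \<Longrightarrow> j \<le> J \<Longrightarrow> (\<Sum>m\<in>#t. min m j) = (\<Sum>m\<in>#t'. min m j)"
    and t: "\<forall>m\<in>#t. 0 < m \<and> m < J" "\<forall>m\<in>#t'. 0 < m \<and> m < J"
  shows "t = (t' :: nat multiset)"
proof (rule multiset_eqI)
  have S: "(\<Sum>m\<in>#u. min m (Suc j)) = (\<Sum>m\<in>#u. min m j) + size {#m \<in># u. j < m#}" for u and j :: nat
    by (induction u) auto
  have C: "size {#m \<in># u. j < m#} = size {#m \<in># u. Suc j < m#} + count u (Suc j)" for u and j :: nat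
    by (induction u) auto
  have s': "(\<Sum>m\<in>#t. min m j) = (\<Sum>m\<in>#t'. min m j)" if "j \<le> J" for j
    using s[of j] that by (cases "j = 0") auto
  have g: "size {#m \<in># t. j < m#} = size {#m \<in># t'. j < m#}" if "j < J" for j
    using s'[of j] s'[of "Suc j"] that S[where u = t and j = j] S[where u = t' and j = j] by simp
  fix m
  show "count t m = count t' m"
  proof (cases "0 < m \<and> m < J")
    case True
    moreover from True have "m - 1 < J" by auto
    ultimately show ?thesis using C[where u = t and j = "m - 1"] C[where u = t' and j = "m - 1"] g[of "m - 1"] g[of m] by simp
  next
    case False
    then have "m \<notin># t" "m \<notin># t'" using t by auto
    then show ?thesis by (simp add: not_in_iff)
  qed
qed

section \<open>Linearity of a rational eigenvalue\<close>

lemma ex_notin_finite: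
  assumes "finite (S :: complex set)" obtains r where "r \<notin> S"
  using ex_new_if_finite[OF infinite_UNIV_char_0 assms] by blast

locale linear_pencil =
  fixes n :: nat and c :: "nat \<Rightarrow> nat \<Rightarrow> nat \<Rightarrow> complex" and a :: "nat \<Rightarrow> complex"
    and \<rho> :: nat and X Y :: "complex mat"
  assumes X: "X \<in> carrier_mat \<rho> n" and Y: "Y \<in> carrier_mat n \<rho>"
begin

definition form :: "(nat \<Rightarrow> complex) \<Rightarrow> nat \<Rightarrow> nat \<Rightarrow> complex" where
  "form x i j = (\<Sum>k<n. x k * c i j k)"

text \<open>Homogeneous in \<open>s\<close> and \<open>t\<close>, so that a fraction
  \<open>p / q\<close> can be inserted as eigenvalue without dividing. As a polynomial in
  \<open>t\<close> its leading coefficient is \<open>pdet 1 0 a\<close> up to sign.\<close>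

definition pdet :: "complex \<Rightarrow> complex \<Rightarrow> (nat \<Rightarrow> complex) \<Rightarrow> complex" where
  "pdet s t x = det (X * mat n n (\<lambda>(i, j). s * form x i j - t * form a i j) * Y)"

lemma form_scale: "form (\<lambda>k. s * x k) i j = s * form x i j"
  by (simp add: form_def sum_distrib_left mult.assoc)

lemma pdet_one: "pdet s t x = pdet 1 t (\<lambda>k. s * x k)"
  unfolding pdet_def form_scale by simp

lemma pdet_scale: "pdet (r * s) (r * t) x = r ^ \<rho> * pdet s t x"
proof -
  let ?M = "mat n n (\<lambda>(i, j). s * form x i j - t * form a i j)"
  have "mat n n (\<lambda>(i, j). r * s * form x i j - r * t * form a i j) = r \<cdot>\<^sub>m ?M"
    by (intro eq_matI) (auto simp: algebra_simps)
  moreover have "X * (r \<cdot>\<^sub>m ?M) * Y = r \<cdot>\<^sub>m (X * ?M * Y)"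
  proof -
    have "X * (r \<cdot>\<^sub>m ?M) = r \<cdot>\<^sub>m (X * ?M)" using X by (intro mult_smult_distrib) auto
    moreover have "r \<cdot>\<^sub>m (X * ?M) * Y = r \<cdot>\<^sub>m (X * ?M * Y)" using X Y by (intro mult_smult_assoc_mat) auto
    ultimately show ?thesis by simp
  qed
  moreover have "X * ?M * Y \<in> carrier_mat \<rho> \<rho>" using X Y by auto
  ultimately show ?thesis unfolding pdet_def using Y by (simp add: det_smult)
qed

lemma pdet_univ:
  assumes "s \<in> univ_funs" "t \<in> univ_funs" "\<And>k. (\<lambda>r. x r k) \<in> univ_funs"
  shows "(\<lambda>r. pdet (s r) (t r) (x r)) \<in> univ_funs"
  unfolding pdet_def
proof (rule UF.det_mult3[OF _ X Y])
  fix i j assume "i < n" "j < n"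
  then show "(\<lambda>r. mat n n (\<lambda>(i, j). s r * form (x r) i j - t r * form a i j) $$ (i, j)) \<in> univ_funs"
    using assms by (simp add: form_def) (intro UF.diff UF.mult UF.sum UF.const; simp)
qed auto

lemma pdet_a: "form x = (\<lambda>i j. r * form a i j) \<Longrightarrow> pdet s t x = (s * r - t) ^ \<rho> * pdet 1 0 a"
  using pdet_scale[of "s * r - t" 1 0 a] unfolding pdet_def by (simp add: algebra_simps)

end

locale linear_root = linear_pencil +
  fixes p q :: mfun
  assumes q0: "q \<noteq> 0" and a_reg: "pdet 1 0 a \<noteq> 0"
    and root: "\<And>x. pdet (app q x) (app p x) x = 0"
begin

text \<open>On a line \<open>p / q\<close> is a rational function that satisfies a monic equation with polynomial
  coefficients of degrees at most \<open>1, 2, \<dots>\<close>; so it has no poles and at most linear growth.\<close>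

lemma line_affine:
  assumes qx: "app q x \<noteq> 0"
  shows "\<exists>\<alpha> \<beta>. \<forall>r. app p (\<lambda>k. x k + r * b k) = (\<alpha> + r * \<beta>) * app q (\<lambda>k. x k + r * b k)"
proof -
  let ?x = "\<lambda>r k. x k + r * b k"
  have xk: "(\<lambda>r. ?x r k) \<in> univ_funs" for k by (intro UF.add UF.mult UF.const univ_funs_id)
  obtain P Q where P: "(\<lambda>r. app p (?x r)) = poly P" and Q: "(\<lambda>r. app q (?x r)) = poly Q"
    using line_univ[OF app, of p x b] line_univ[OF app, of q x b] unfolding univ_funs_def by auto
  have "poly Q 0 \<noteq> 0" using fun_cong[OF Q, of 0] qx by simp
  then have Q0: "Q \<noteq> 0" by auto
  then have finQ: "finite {r. poly Q r = 0}" by (rule poly_roots_finite)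
  \<comment> \<open>A denominator of least degree stands for the reduced fraction on the
    line.\<close>
  let ?good = "\<lambda>Q'. Q' \<noteq> 0 \<and> (\<exists>P'. P' * Q = P * Q')"
  obtain Q' where Q': "?good Q'" and Qmin: "\<And>R. ?good R \<Longrightarrow> degree Q' \<le> degree R"
    using ex_has_least_nat[of ?good Q degree] Q0 by blast
  obtain P' where P': "P' * Q = P * Q'" using Q' by blast
  have van: "pdet (poly Q' r) (poly P' r) (?x r) = 0" for r
  proof (rule univ_funs_eq_0[OF pdet_univ[OF univ_funs_poly univ_funs_poly xk] finQ])
    fix r assume "r \<notin> {r. poly Q r = 0}"
    then have nz: "poly Q r \<noteq> 0" by simp
    let ?s = "poly Q' r / poly Q r"
    have "poly P' r * poly Q r = poly P r * poly Q' r" using arg_cong[OF P', of "\<lambda>p. poly p r"] by simp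
    then have "poly P' r = ?s * poly P r" "poly Q' r = ?s * poly Q r" using nz by (auto simp: field_simps)
    then have "pdet (poly Q' r) (poly P' r) (?x r) = ?s ^ \<rho> * pdet (poly Q r) (poly P r) (?x r)"
      using pdet_scale by metis
    also have "pdet (poly Q r) (poly P r) (?x r) = 0"
      using root[of "?x r"] fun_cong[OF P, of r] fun_cong[OF Q, of r] by simp
    finally show "pdet (poly Q' r) (poly P' r) (?x r) = 0" by simp
  qed
  have "degree Q' = 0"
  proof (rule ccontr)
    assume "degree Q' \<noteq> 0"
    then have "\<not> constant (poly Q')" using constant_degree[of Q'] by simp
    then obtain r where r: "poly Q' r = 0" using fundamental_theorem_of_algebra by blast
    \<comment> \<open>At a zero of the denominator only the leading term in the eigenvalue survives;
      by \<open>a_reg\<close> the numerator vanishes there too, against minimality.\<close>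
    have "pdet 0 (poly P' r) (?x r) = (- poly P' r) ^ \<rho> * pdet 1 0 a"
      using pdet_scale[of "- poly P' r" 1 0 a] unfolding pdet_def by simp
    then have "(- poly P' r) ^ \<rho> * pdet 1 0 a = 0" using van[of r] r by simp
    then have "poly P' r = 0" using a_reg by simp
    then obtain R S where RS: "P' = [:- r, 1:] * R" "Q' = [:- r, 1:] * S"
      using r by (metis dvdE poly_eq_0_iff_dvd)
    have "[:- r, 1:] * (R * Q) = [:- r, 1:] * (P * S)" using P' RS by (simp only: ac_simps)
    then have "R * Q = P * S" by (simp only: mult_cancel_left) auto
    moreover have "S \<noteq> 0" using RS Q' by auto
    ultimately have "degree Q' \<le> degree S" using Qmin[of S] by blast
    moreover have "degree Q' = 1 + degree S" unfolding RS(2) using \<open>S \<noteq> 0\<close> by (subst degree_mult_eq) auto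
    ultimately show False by simp
  qed
  then obtain k where k: "Q' = [:k:]" by (metis degree_eq_zeroE)
  then have k0: "k \<noteq> 0" using Q' by auto
  define T where "T = Polynomial.smult (1 / k) P'"
  have T: "poly P r = poly T r * poly Q r" for r
    using arg_cong[OF P', of "\<lambda>p. poly p r"] k k0 by (simp add: T_def field_simps)
  have vanT: "pdet 1 (poly T r) (?x r) = 0" for r
  proof -
    have "pdet 1 (poly T r) (?x r) = (1 / k) ^ \<rho> * pdet k (poly P' r) (?x r)"
      using pdet_scale[of "1 / k" k "poly P' r" "?x r"] k0 by (simp add: T_def)
    then show ?thesis using van[of r] k by simp
  qed
  have "degree T \<le> 1"
  proof (rule ccontr)
    assume "\<not> degree T \<le> 1"
    then have d: "degree T \<ge> 2" by simp
    define d where "d = degree T"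
    obtain d' where d': "d = Suc (Suc d')" using d unfolding d_def by (metis add_2_eq_Suc le_Suc_ex)
    \<comment> \<open>The line parameter is replaced by \<open>inverse s\<close> and the point
      scaled by \<open>s ^ d\<close>. For \<open>d \<ge> 2\<close> the point becomes 0 at
      \<open>s = 0\<close>, while the reflected polynomial takes the leading coefficient of
      \<open>T\<close> there, which is then an eigenvalue at the point 0 and must vanish.\<close>
    let ?y = "\<lambda>s k. s ^ d * x k + s ^ (d - 1) * b k"
    have yk: "(\<lambda>s. ?y s k) \<in> univ_funs" for k by (intro UF.add UF.mult UF.const UF.power univ_funs_id)
    have "pdet 1 (poly (reflect_poly T) 0) (?y 0) = 0"
    proof (rule univ_funs_eq_0[OF pdet_univ[OF UF.const univ_funs_poly yk], of "{0}" 1])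
      fix s :: complex assume "s \<notin> {0}"
      then have s: "s \<noteq> 0" by simp
      have r: "poly (reflect_poly T) s = s ^ d * poly T (inverse s)"
        using poly_reflect_poly_nz[OF s, of T] by (simp add: d_def)
      have y: "?y s = (\<lambda>k. s ^ d * ?x (inverse s) k)"
        using s d' by (auto simp: field_simps)
      have "pdet 1 (poly (reflect_poly T) s) (?y s) = pdet (s ^ d) (s ^ d * poly T (inverse s)) (?x (inverse s))"
        unfolding r y by (rule pdet_one[symmetric])
      also have "\<dots> = (s ^ d) ^ \<rho> * pdet 1 (poly T (inverse s)) (?x (inverse s))"
        using pdet_scale[of "s ^ d" 1] by simp
      finally show "pdet 1 (poly (reflect_poly T) s) (?y s) = 0" using vanT by simp
    qed simp
    moreover have "?y 0 = (\<lambda>k. 0)" using d' by auto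
    moreover have "pdet 1 (poly (reflect_poly T) 0) (\<lambda>k. 0) = (- poly (reflect_poly T) 0) ^ \<rho> * pdet 1 0 a"
    proof -
      have "form (\<lambda>k. 0) = (\<lambda>i j. 0 * form a i j)" by (intro ext) (simp add: form_def)
      from pdet_a[OF this, of 1 "poly (reflect_poly T) 0"] show ?thesis by simp
    qed
    ultimately have "poly (reflect_poly T) 0 = 0" using a_reg by simp
    then have "T = 0" by (simp add: poly_0_coeff_0)
    then show False using d by simp
  qed
  then obtain \<alpha> \<beta> where "T = [:\<alpha>, \<beta>:]" using degree1_coeffs[of T] by (metis degree_eq_zeroE le_neq_implies_less less_one pCons_0_0)
  then have "poly T r = \<alpha> + r * \<beta>" for r by simp
  then have "app p (?x r) = (\<alpha> + r * \<beta>) * app q (?x r)" for r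
    using T[of r] fun_cong[OF P, of r] fun_cong[OF Q, of r] by simp
  then show ?thesis by blast
qed

text \<open>Being affine on lines makes the fraction affine. At 0 and at \<open>a\<close> the pencil
  consists of multiples of the form at \<open>a\<close>, with sole eigenvalue 0 and 1 respectively;
  this removes the constant term and normalises the linear form.\<close>

lemma linear:
  "\<exists>f. (\<forall>x. app p x = app q x * (\<Sum>k<n. x k * f k)) \<and> (\<Sum>k<n. a k * f k) = 1 \<and>
     (\<forall>x. pdet 1 (\<Sum>k<n. x k * f k) x = 0)"
proof -
  obtain x0 where x0: "app q x0 \<noteq> 0" using q0 mfun_nz_iff by blast
  define \<alpha> where "\<alpha> = app p x0 / app q x0"
  let ?l = "\<lambda>b r k. x0 k + r * b k"
  \<comment> \<open>\<open>\<beta>\<close> is the slope in direction \<open>b\<close> seen from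
    \<open>x0\<close>; it is unique because \<open>q\<close> has finitely many zeros on that
    line.\<close>
  define good where "good b \<beta> \<longleftrightarrow> (\<forall>r. app p (?l b r) = (\<alpha> + r * \<beta>) * app q (?l b r))" for b \<beta>
  have fin: "finite {r. app q (?l b r) = 0}" for b
    using univ_funs_nz_cofinite[OF line_univ[OF app, of q x0 b], of 0] x0 by simp
  have ex: "\<exists>\<beta>. good b \<beta>" for b
  proof -
    obtain \<alpha>' \<beta> where ab: "\<And>r. app p (?l b r) = (\<alpha>' + r * \<beta>) * app q (?l b r)"
      using line_affine[OF x0, of b] by blast
    have "\<alpha>' = \<alpha>" using ab[of 0] x0 by (simp add: \<alpha>_def)
    then show ?thesis using ab unfolding good_def by blast
  qed
  have uniq: "\<beta> = \<beta>'" if "good b \<beta>" "good b \<beta>'" for b \<beta> \<beta>'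
  proof -
    obtain r where r: "r \<notin> {r. app q (?l b r) = 0} \<union> {0}"
      by (rule ex_notin_finite[OF finite_UnI[OF fin], of "{0}" b]) auto
    have "(\<alpha> + r * \<beta>) * app q (?l b r) = (\<alpha> + r * \<beta>') * app q (?l b r)"
      using that unfolding good_def by metis
    then show ?thesis using r by auto
  qed
  define \<beta> where "\<beta> b = (SOME \<beta>. good b \<beta>)" for b
  have good: "good b (\<beta> b)" for b unfolding \<beta>_def using ex by (rule someI_ex)
  have scale: "\<beta> (\<lambda>k. s * b k) = s * \<beta> b" for s b
  proof (rule uniq[OF good])
    show "good (\<lambda>k. s * b k) (s * \<beta> b)"
      unfolding good_def
    proof
      fix r
      show "app p (?l (\<lambda>k. s * b k) r) = (\<alpha> + r * (s * \<beta> b)) * app q (?l (\<lambda>k. s * b k) r)"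
        using good[of b, unfolded good_def, rule_format, of "r * s"] by (simp add: mult.assoc)
    qed
  qed
  have add: "\<beta> (\<lambda>k. b k + d k) = \<beta> b + \<beta> d" for b d
  proof -
    \<comment> \<open>The points reached from \<open>x0\<close> along \<open>b\<close>,
      \<open>?m\<close> and \<open>d\<close> are collinear, and the middle one is a midpoint;
      affinity on their line yields additivity.\<close>
    let ?m = "\<lambda>k. (b k + d k) / 2"
    obtain r where "r \<notin> {r. app q (?l b r) = 0} \<union> {r. app q (?l d r) = 0} \<union> {r. app q (?l ?m r) = 0} \<union> {0}"
      by (rule ex_notin_finite[OF finite_UnI[OF finite_UnI[OF finite_UnI[OF fin fin] fin]], of "{0}" b d ?m]) auto
    then have r: "r \<noteq> 0" "app q (?l b r) \<noteq> 0" "app q (?l d r) \<noteq> 0" "app q (?l ?m r) \<noteq> 0" by auto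
    obtain \<alpha>' \<beta>' where ab: "\<And>t. app p (\<lambda>k. ?l b r k + t * (r * (d k - b k))) =
        (\<alpha>' + t * \<beta>') * app q (\<lambda>k. ?l b r k + t * (r * (d k - b k)))"
      using line_affine[OF r(2), of "\<lambda>k. r * (d k - b k)"] by blast
    have g: "app p (?l b r) = (\<alpha> + r * \<beta> b) * app q (?l b r)" for b
      using good[of b] unfolding good_def by blast
    have "\<alpha> + r * \<beta> b = \<alpha>'" using ab[of 0] g[of b] r(2) by simp
    moreover have "\<alpha> + r * \<beta> d = \<alpha>' + \<beta>'"
    proof -
      have "(\<lambda>k. ?l b r k + 1 * (r * (d k - b k))) = ?l d r" by (auto simp: algebra_simps)
      then show ?thesis using ab[of 1] g[of d] r(3) by simp
    qed
    moreover have "\<alpha> + r * \<beta> ?m = \<alpha>' + 1/2 * \<beta>'"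
    proof -
      have "(\<lambda>k. ?l b r k + 1/2 * (r * (d k - b k))) = ?l ?m r" by (auto simp: field_simps)
      then show ?thesis using ab[of "1/2"] g[of ?m] r(4) by simp
    qed
    moreover have "\<beta> ?m = 1/2 * \<beta> (\<lambda>k. b k + d k)"
      using scale[of "1/2" "\<lambda>k. b k + d k"] by simp
    ultimately have e: "\<alpha> + r * \<beta> b = \<alpha>'" "\<alpha> + r * \<beta> d = \<alpha>' + \<beta>'"
        "\<alpha> + r * (1/2 * \<beta> (\<lambda>k. b k + d k)) = \<alpha>' + 1/2 * \<beta>'"
      by simp_all
    have "r * \<beta> (\<lambda>k. b k + d k) = 2 * (\<alpha> + r * (1/2 * \<beta> (\<lambda>k. b k + d k))) - 2 * \<alpha>"
      by (simp add: ring_distribs)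
    also have "\<dots> = (\<alpha> + r * \<beta> b) + (\<alpha> + r * \<beta> d) - 2 * \<alpha>"
      unfolding e by (simp add: ring_distribs)
    also have "\<dots> = r * (\<beta> b + \<beta> d)" by (simp add: ring_distribs)
    finally have "r * \<beta> (\<lambda>k. b k + d k) = r * (\<beta> b + \<beta> d)" .
    then show ?thesis using r(1) by simp
  qed
  define \<kappa> where "\<kappa> = \<alpha> - \<beta> x0"
  have phi: "app p x = (\<kappa> + \<beta> x) * app q x" for x
  proof -
    have "app p (?l (\<lambda>k. x k - x0 k) 1) = (\<alpha> + 1 * \<beta> (\<lambda>k. x k - x0 k)) * app q (?l (\<lambda>k. x k - x0 k) 1)"
      using good[of "\<lambda>k. x k - x0 k"] unfolding good_def by blast
    moreover have "\<beta> x = \<beta> (\<lambda>k. x k - x0 k) + \<beta> x0" using add[of "\<lambda>k. x k - x0 k" x0] by simp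
    ultimately show ?thesis by (simp add: \<kappa>_def)
  qed
  have van: "pdet 1 (\<kappa> + \<beta> x) x = 0" for x
  proof -
    let ?x = "?l (\<lambda>k. x k - x0 k)"
    have lin: "\<beta> (?x r) = \<beta> x0 + r * \<beta> (\<lambda>k. x k - x0 k)" for r
      using add[of x0 "\<lambda>k. r * (x k - x0 k)"] scale[of r "\<lambda>k. x k - x0 k"] by simp
    have u: "(\<lambda>r. pdet 1 (\<kappa> + (\<beta> x0 + r * \<beta> (\<lambda>k. x k - x0 k))) (?x r)) \<in> univ_funs"
      by (intro pdet_univ UF.add UF.mult UF.const univ_funs_id)
    have "pdet 1 (\<kappa> + (\<beta> x0 + 1 * \<beta> (\<lambda>k. x k - x0 k))) (?x 1) = 0"
    proof (rule univ_funs_eq_0[OF u fin[of "\<lambda>k. x k - x0 k"]])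
      fix r assume "r \<notin> {r. app q (?x r) = 0}"
      then have "app q (?x r) \<noteq> 0" by simp
      moreover have "pdet (app q (?x r) * 1) (app q (?x r) * (\<kappa> + \<beta> (?x r))) (?x r) = 0"
        using root[of "?x r"] phi[of "?x r"] by (simp add: mult.commute)
      ultimately show "pdet 1 (\<kappa> + (\<beta> x0 + r * \<beta> (\<lambda>k. x k - x0 k))) (?x r) = 0"
        unfolding lin pdet_scale by simp
    qed
    then show ?thesis using lin[of 1] by simp
  qed
  \<comment> \<open>Used at 0 to get \<open>\<kappa> = 0\<close>, and at points supported outside
    the first \<open>n\<close> coordinates to make \<open>\<beta>\<close> independent of those
    coordinates.\<close>
  have vz: "\<kappa> + \<beta> z = 0" if "form z = (\<lambda>i j. 0)" for z
  proof -
    have "(1 * 0 - (\<kappa> + \<beta> z)) ^ \<rho> * pdet 1 0 a = 0"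
      using van[of z] pdet_a[of z 0 1 "\<kappa> + \<beta> z"] that by simp
    then have "1 * 0 - (\<kappa> + \<beta> z) = 0" using a_reg power_not_zero by (metis mult_eq_0_iff)
    then show ?thesis by (simp only: mult_1 diff_0 neg_equal_0_iff_equal)
  qed
  have "\<beta> (\<lambda>k. 0) = 0" using scale[of 0 "\<lambda>k. 0"] by simp
  then have k0: "\<kappa> = 0" using vz[of "\<lambda>k. 0"] by (simp add: form_def fun_eq_iff)
  have rest: "\<beta> z = 0" if "\<And>k. k < n \<Longrightarrow> z k = 0" for z
    using vz[of z] k0 that by (simp add: form_def fun_eq_iff)
  have b1: "\<beta> a = 1"
  proof -
    have "(1 * 1 - \<beta> a) ^ \<rho> * pdet 1 0 a = 0"
      using van[of a] pdet_a[of a 1 1 "\<beta> a"] k0 by simp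
    then have "1 * 1 - \<beta> a = 0" using a_reg power_not_zero by (metis mult_eq_0_iff)
    then show ?thesis by simp
  qed
  let ?e = "\<lambda>i k. if k = i then 1 else (0::complex)"
  have part: "\<beta> (\<lambda>k. if k < m then x k else 0) = (\<Sum>k<m. x k * \<beta> (?e k))" for m x
  proof (induction m)
    case 0 then show ?case using \<open>\<beta> (\<lambda>k. 0) = 0\<close> by simp
  next
    case (Suc m)
    have "(\<lambda>k. if k < Suc m then x k else 0) = (\<lambda>k. (if k < m then x k else 0) + x m * ?e m k)"
      by (auto simp: less_Suc_eq)
    then show ?case using add[of "\<lambda>k. if k < m then x k else 0" "\<lambda>k. x m * ?e m k"] scale[of "x m" "?e m"] Suc by simp
  qed
  have lin: "\<beta> x = (\<Sum>k<n. x k * \<beta> (?e k))" for x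
  proof -
    have "(\<lambda>k. (if k < n then x k else 0) + (if k < n then 0 else x k)) = x" by auto
    then have "\<beta> x = \<beta> (\<lambda>k. if k < n then x k else 0) + \<beta> (\<lambda>k. if k < n then 0 else x k)"
      using add[of "\<lambda>k. if k < n then x k else 0" "\<lambda>k. if k < n then 0 else x k"] by simp
    then show ?thesis using rest[of "\<lambda>k. if k < n then 0 else x k"] part[of n x] by simp
  qed
  show ?thesis
  proof (intro exI[of _ "\<lambda>k. \<beta> (?e k)"] conjI allI)
    show "app p x = app q x * (\<Sum>k<n. x k * \<beta> (?e k))" for x
      unfolding lin[symmetric] using phi[of x] k0 by (simp add: mult.commute)
    show "(\<Sum>k<n. a k * \<beta> (?e k)) = 1" unfolding lin[symmetric] by (rule b1)
    show "pdet 1 (\<Sum>k<n. x k * \<beta> (?e k)) x = 0" for x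
      unfolding lin[symmetric] using van[of x] k0 by simp
  qed
qed

end

section \<open>The Lie bracket along a linear pencil\<close>

locale lie =
  fixes n :: nat and c :: "nat \<Rightarrow> nat \<Rightarrow> nat \<Rightarrow> complex"
  assumes lie: "lie_structure_constants n c"
begin

definition br :: "(nat \<Rightarrow> complex) \<Rightarrow> (nat \<Rightarrow> complex) \<Rightarrow> nat \<Rightarrow> complex" where
  "br u v = (\<lambda>p. \<Sum>i<n. \<Sum>j<n. u i * v j * c i j p)"

definition pair :: "(nat \<Rightarrow> complex) \<Rightarrow> (nat \<Rightarrow> complex) \<Rightarrow> complex" where
  "pair y u = (\<Sum>p<n. y p * u p)"

definition F :: "(nat \<Rightarrow> complex) \<Rightarrow> (nat \<Rightarrow> complex) \<Rightarrow> (nat \<Rightarrow> complex) \<Rightarrow> complex" where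
  "F y u v = pair y (br u v)"

lemma pair_cong: "(\<And>p. p < n \<Longrightarrow> u p = v p) \<Longrightarrow> pair y u = pair y v"
  by (simp add: pair_def)

lemma pair_lin [simp]:
  "pair y (\<lambda>p. u p + v p) = pair y u + pair y v" "pair y (\<lambda>p. k * u p) = k * pair y u"
  "pair y (\<lambda>p. 0) = 0" "pair y (\<lambda>p. \<Sum>s\<in>S. f s p) = (\<Sum>s\<in>S. pair y (f s))"
proof -
  show "pair y (\<lambda>p. \<Sum>s\<in>S. f s p) = (\<Sum>s\<in>S. pair y (f s))"
    by (simp add: pair_def sum_distrib_left) (rule sum.swap)
qed (simp_all add: pair_def algebra_simps sum.distrib sum_distrib_left)

lemma pair_lin_left [simp]:
  "pair (\<lambda>p. y p + z p) u = pair y u + pair z u" "pair (\<lambda>p. k * y p) u = k * pair y u"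
  "pair (\<lambda>p. y p - z p) u = pair y u - pair z u"
  by (simp_all add: pair_def algebra_simps sum.distrib sum_subtractf sum_distrib_left)

lemma skew: "p < n \<Longrightarrow> br u v p = - br v u p"
proof -
  assume p: "p < n"
  have "br u v p = (\<Sum>i<n. \<Sum>j<n. u i * v j * - c j i p)"
    unfolding br_def
  proof (intro sum.cong refl arg_cong2[where f="(*)"])
    fix i j assume "i \<in> {..<n}" "j \<in> {..<n}"
    then show "c i j p = - c j i p"
      using lie[unfolded lie_structure_constants_def, THEN conjunct1, rule_format, of i j p] p by simp
  qed
  also have "\<dots> = - (\<Sum>j<n. \<Sum>i<n. v j * u i * c j i p)"
    by (subst sum.swap) (simp add: sum_negf mult.commute)
  finally show ?thesis by (simp add: br_def)
qed

lemma br_left [simp]: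
  "br (\<lambda>i. u i + v i) w = (\<lambda>p. br u w p + br v w p)" "br (\<lambda>i. k * u i) w = (\<lambda>p. k * br u w p)"
  "br (\<lambda>i. 0) w = (\<lambda>p. 0)" "br (\<lambda>i. \<Sum>s\<in>S. f s i) w = (\<lambda>p. \<Sum>s\<in>S. br (f s) w p)"
proof -
  have "br (\<lambda>i. \<Sum>s\<in>S. f s i) w p = (\<Sum>s\<in>S. br (f s) w p)" for p
  proof -
    have "br (\<lambda>i. \<Sum>s\<in>S. f s i) w p = (\<Sum>i<n. \<Sum>j<n. \<Sum>s\<in>S. f s i * w j * c i j p)"
      by (simp add: br_def sum_distrib_right)
    also have "\<dots> = (\<Sum>i<n. \<Sum>s\<in>S. \<Sum>j<n. f s i * w j * c i j p)"
      by (intro sum.cong refl sum.swap)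
    also have "\<dots> = (\<Sum>s\<in>S. \<Sum>i<n. \<Sum>j<n. f s i * w j * c i j p)" by (rule sum.swap)
    finally show ?thesis by (simp add: br_def)
  qed
  then show "br (\<lambda>i. \<Sum>s\<in>S. f s i) w = (\<lambda>p. \<Sum>s\<in>S. br (f s) w p)" by blast
qed (simp_all add: br_def algebra_simps sum.distrib sum_distrib_left)

lemma F_skew: "F y u v = - F y v u"
proof -
  have "F y u v = pair y (\<lambda>p. - 1 * br v u p)"
    unfolding F_def by (rule pair_cong) (use skew[of _ u v] in simp)
  then show ?thesis by (simp only: pair_lin F_def) simp
qed

lemma F_left [simp]:
  "F y (\<lambda>i. u i + v i) w = F y u w + F y v w" "F y (\<lambda>i. k * u i) w = k * F y u w"
  "F y (\<lambda>i. 0) w = 0" "F y (\<lambda>i. \<Sum>s\<in>S. f s i) w = (\<Sum>s\<in>S. F y (f s) w)"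
  by (simp_all add: F_def)

lemma F_right [simp]:
  "F y w (\<lambda>i. u i + v i) = F y w u + F y w v" "F y w (\<lambda>i. k * u i) = k * F y w u"
  "F y w (\<lambda>i. 0) = 0" "F y w (\<lambda>i. \<Sum>s\<in>S. f s i) = (\<Sum>s\<in>S. F y w (f s))"
  unfolding F_skew[of y w] by (simp_all add: sum_negf)

lemma F_form [simp]:
  "F (\<lambda>p. y p + z p) u v = F y u v + F z u v" "F (\<lambda>p. k * y p) u v = k * F y u v"
  "F (\<lambda>p. y p - z p) u v = F y u v - F z u v"
  by (simp_all add: F_def)

lemma F_cong: "(\<And>p. p < n \<Longrightarrow> u p = u' p) \<Longrightarrow> (\<And>p. p < n \<Longrightarrow> v p = v' p) \<Longrightarrow> F y u v = F y u' v'"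
  by (simp add: F_def br_def)

lemma br_br: "br u (br v w) p = (\<Sum>i<n. \<Sum>j<n. \<Sum>l<n. u i * v j * w l * (\<Sum>m<n. c j l m * c i m p))"
proof -
  have "br u (br v w) p = (\<Sum>i<n. \<Sum>m<n. \<Sum>j<n. \<Sum>l<n. u i * v j * w l * (c j l m * c i m p))"
    by (simp add: br_def sum_distrib_left sum_distrib_right mult.assoc)
  also have "\<dots> = (\<Sum>i<n. \<Sum>j<n. \<Sum>m<n. \<Sum>l<n. u i * v j * w l * (c j l m * c i m p))"
    by (intro sum.cong refl sum.swap)
  also have "\<dots> = (\<Sum>i<n. \<Sum>j<n. \<Sum>l<n. \<Sum>m<n. u i * v j * w l * (c j l m * c i m p))"
    by (intro sum.cong refl sum.swap)
  finally show ?thesis by (simp add: sum_distrib_left)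
qed

lemma jacobi:
  assumes p: "p < n" shows "br u (br v w) p + br v (br w u) p + br w (br u v) p = 0"
proof -
  let ?T = "\<lambda>i j l. \<Sum>m<n. c j l m * c i m p"
  have "br v (br w u) p = (\<Sum>j<n. \<Sum>l<n. \<Sum>i<n. v j * w l * u i * ?T j l i)" by (rule br_br)
  also have "\<dots> = (\<Sum>j<n. \<Sum>i<n. \<Sum>l<n. v j * w l * u i * ?T j l i)" by (intro sum.cong refl sum.swap)
  also have "\<dots> = (\<Sum>i<n. \<Sum>j<n. \<Sum>l<n. v j * w l * u i * ?T j l i)" by (rule sum.swap)
  finally have 2: "br v (br w u) p = (\<Sum>i<n. \<Sum>j<n. \<Sum>l<n. u i * v j * w l * ?T j l i)"
    by (simp add: ac_simps)
  have "br w (br u v) p = (\<Sum>l<n. \<Sum>i<n. \<Sum>j<n. w l * u i * v j * ?T l i j)" by (rule br_br)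
  also have "\<dots> = (\<Sum>i<n. \<Sum>l<n. \<Sum>j<n. w l * u i * v j * ?T l i j)" by (rule sum.swap)
  also have "\<dots> = (\<Sum>i<n. \<Sum>j<n. \<Sum>l<n. w l * u i * v j * ?T l i j)" by (intro sum.cong refl sum.swap)
  finally have 3: "br w (br u v) p = (\<Sum>i<n. \<Sum>j<n. \<Sum>l<n. u i * v j * w l * ?T l i j)"
    by (simp add: ac_simps)
  have "br u (br v w) p + br v (br w u) p + br w (br u v) p =
      (\<Sum>i<n. \<Sum>j<n. \<Sum>l<n. u i * v j * w l * (?T i j l + ?T j l i + ?T l i j))"
    unfolding br_br[of u] 2 3 by (simp only: sum.distrib distrib_left)
  also have "\<dots> = 0"
  proof (intro sum.neutral ballI)
    fix i j l assume "i \<in> {..<n}" "j \<in> {..<n}" "l \<in> {..<n}"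
    then have "?T i j l + ?T j l i + ?T l i j = 0"
      using lie[unfolded lie_structure_constants_def, THEN conjunct2, rule_format, of i j l p] p by simp
    then show "u i * v j * w l * (?T i j l + ?T j l i + ?T l i j) = 0" by simp
  qed
  finally show ?thesis .
qed

lemma F_jacobi: "F y u (br v w) + F y v (br w u) + F y w (br u v) = 0"
proof -
  have "F y u (br v w) + F y v (br w u) + F y w (br u v) =
      pair y (\<lambda>p. br u (br v w) p + br v (br w u) p + br w (br u v) p)"
    by (simp add: F_def)
  also have "\<dots> = pair y (\<lambda>p. 0)" by (rule pair_cong) (rule jacobi)
  finally show ?thesis by simp
qed

lemma F_br_skew: "F y u (br v w) = - F y u (br w v)"
proof -
  have "F y u (br v w) = F y u (\<lambda>p. - 1 * br w v p)"
    by (rule F_cong) (use skew[of _ v w] in auto)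
  then show ?thesis by (simp only: F_right) simp
qed

text \<open>The Jacobi identity in the form that brings \<open>u\<close> or \<open>v\<close> into
  the first slot, where kernel relations can exchange \<open>y\<close> for \<open>a\<close>.\<close>

lemma F_br: "F y (br u v) w = F y u (br v w) - F y v (br u w)"
  using F_jacobi[of y u v w] F_skew[of y "br u v" w] F_br_skew[of y v w u] by (simp add: algebra_simps)

text \<open>The vector polynomial \<open>\<Sum>s<m. t ^ s * u s\<close> is annihilated by the form at \<open>y + t * a\<close> up to order \<open>m\<close>.\<close>

definition tker :: "nat \<Rightarrow> (nat \<Rightarrow> complex) \<Rightarrow> (nat \<Rightarrow> complex) \<Rightarrow> (nat \<Rightarrow> nat \<Rightarrow> complex) \<Rightarrow> bool" where
  "tker m y a u \<longleftrightarrow> (\<forall>s<m. \<forall>w. F y (u s) w + (if s = 0 then 0 else F a (u (s - 1)) w) = 0)"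

lemma tker_0: "tker m y a u \<Longrightarrow> 0 < m \<Longrightarrow> F y (u 0) w = 0"
  unfolding tker_def by (drule spec[of _ 0]) simp

lemma tker_Suc: "tker m y a u \<Longrightarrow> Suc s < m \<Longrightarrow> F y (u (Suc s)) w = - F a (u s) w"
  unfolding tker_def by (drule spec[of _ "Suc s"]) (simp add: eq_neg_iff_add_eq_0)

text \<open>Multiplication by \<open>t ^ d\<close> modulo \<open>t ^ m\<close>. The constancy
  condition concerns the coefficient of degree \<open>m - 1\<close>; shifts extend it to lower
  degrees.\<close>

lemma tker_shift: "tker m y a u \<Longrightarrow> tker m y a (\<lambda>s. if s < d then (\<lambda>i. 0) else u (s - d))"
  unfolding tker_def
proof (intro allI impI)
  fix s w assume u: "\<forall>s<m. \<forall>w. F y (u s) w + (if s = 0 then 0 else F a (u (s - 1)) w) = 0" and s: "s < m"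
  show "F y (if s < d then \<lambda>i. 0 else u (s - d)) w +
        (if s = 0 then 0 else F a (if s - 1 < d then \<lambda>i. 0 else u (s - 1 - d)) w) = 0"
  proof (cases "s < d")
    case False
    then have "s - d < m" using s by simp
    from u[rule_format, OF this, of w] show ?thesis using False by (cases "s = d") auto
  qed auto
qed

text \<open>Skew-symmetry and two kernel relations move one power of \<open>t\<close> from one
  argument to the other, so only the total degree matters.\<close>

lemma tker_const:
  assumes u: "tker m y a u" and v: "tker m y a v" and k: "k < m" and i: "i \<le> k"
  shows "F a (u i) (v (k - i)) = F a (u k) (v 0)"
  using i
proof (induction rule: inc_induct)
  case (step i)
  have ki: "k - i = Suc (k - Suc i)" using step by simp
  have "F a (u i) (v (k - i)) = - F y (u (Suc i)) (v (k - i))"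
    using tker_Suc[OF u, of i] step k by simp
  also have "\<dots> = F y (v (k - i)) (u (Suc i))" using F_skew[of y "u (Suc i)"] by simp
  also have "\<dots> = - F a (v (k - Suc i)) (u (Suc i))"
    using tker_Suc[OF v, of "k - Suc i"] ki k by simp
  also have "\<dots> = F a (u (Suc i)) (v (k - Suc i))" using F_skew[of a "u (Suc i)"] by simp
  finally show ?case using step by simp
qed simp

text \<open>Below the top degree one more kernel relation is available, and it ends at
  \<open>v 0\<close>, which lies in the kernel of the form at \<open>y\<close>.\<close>

lemma tker_low:
  assumes u: "tker m y a u" and v: "tker m y a v" and k: "Suc k < m"
  shows "F a (u k) (v 0) = 0"
proof -
  have "F a (u k) (v 0) = - F y (u (Suc k)) (v 0)" using tker_Suc[OF u k] by simp
  also have "\<dots> = F y (v 0) (u (Suc k))" using F_skew[of y "u (Suc k)"] by simp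
  finally show ?thesis using tker_0[OF v] k by simp
qed

text \<open>A Jordan chain at \<open>y\<close>, running towards the kernel. Reversed and with
  alternating signs it is a truncated kernel element; zero entries at the end are allowed, so
  shorter blocks also give chains of length \<open>m\<close>.\<close>

definition chain :: "nat \<Rightarrow> (nat \<Rightarrow> complex) \<Rightarrow> (nat \<Rightarrow> complex) \<Rightarrow> (nat \<Rightarrow> nat \<Rightarrow> complex) \<Rightarrow> bool" where
  "chain m y a w \<longleftrightarrow> w m = (\<lambda>i. 0) \<and> (\<forall>k<m. \<forall>z. F y (w k) z = F a (w (Suc k)) z)"

text \<open>For \<open>k < m\<close>, the coefficient of \<open>t ^ k\<close> in the bracket of the
  two vector polynomials.\<close>

definition bcoef :: "(nat \<Rightarrow> nat \<Rightarrow> complex) \<Rightarrow> (nat \<Rightarrow> nat \<Rightarrow> complex) \<Rightarrow> nat \<Rightarrow> nat \<Rightarrow> complex" where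
  "bcoef u v k = (\<lambda>p. \<Sum>i\<le>k. br (u i) (v (k - i)) p)"

lemma pair_bcoef:
  assumes u: "tker m y a u" and v: "tker m y a v" and k: "k < m"
  shows "pair a (bcoef u v k) = of_nat (Suc k) * F a (u k) (v 0)"
proof -
  have "pair a (bcoef u v k) = (\<Sum>i\<le>k. F a (u i) (v (k - i)))" by (simp add: bcoef_def F_def)
  also have "\<dots> = (\<Sum>i\<le>k. F a (u k) (v 0))" by (intro sum.cong refl tker_const[OF u v k]) auto
  finally show ?thesis by simp
qed

end

text \<open>The assumption \<open>const_rank\<close> is the infinitesimal form of the rank of the truncated pencil at
  \<open>y\<close> being constant along the hyperplane \<open>pair h \<xi> = 0\<close>.\<close>

locale lie_generic = lie +
  fixes y a \<xi> :: "nat \<Rightarrow> complex" and m :: nat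
  assumes m: "0 < m" and a1: "pair a \<xi> = 1"
    and const_rank: "\<And>u v h. tker m y a u \<Longrightarrow> tker m y a v \<Longrightarrow> pair h \<xi> = 0 \<Longrightarrow>
      (\<Sum>s<m. F h (u s) (v (m - 1 - s))) = 0"
begin

lemma bcoef_ker:
  assumes u: "tker m y a u" and v: "tker m y a v" and k: "k < m" and h: "pair h \<xi> = 0"
  shows "pair h (bcoef u v k) = 0"
proof -
  define d where "d = m - 1 - k"
  have "(\<Sum>s<m. F h (if s < d then \<lambda>i. 0 else u (s - d)) (v (m - 1 - s))) = 0"
    using const_rank[OF tker_shift[OF u, of d] v h] .
  moreover have "(\<Sum>s<m. F h (if s < d then \<lambda>i. 0 else u (s - d)) (v (m - 1 - s))) =
     (\<Sum>s\<in>{d..<m}. F h (u (s - d)) (v (m - 1 - s)))"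
    by (intro sum.mono_neutral_cong_right) auto
  moreover have "\<dots> = (\<Sum>i\<le>k. F h (u i) (v (k - i)))"
    by (rule sum.reindex_bij_witness[of _ "\<lambda>i. i + d" "\<lambda>s. s - d"]) (use k in \<open>auto simp: d_def\<close>)
  ultimately show ?thesis by (simp add: bcoef_def F_def)
qed

text \<open>A vector annihilated by all \<open>h\<close> with \<open>pair h \<xi> = 0\<close> is a
  multiple of \<open>\<xi>\<close>, and \<open>a1\<close> identifies the factor.\<close>

lemma bcoef_xi:
  assumes u: "tker m y a u" and v: "tker m y a v" and k: "k < m" and p: "p < n"
  shows "bcoef u v k p = pair a (bcoef u v k) * \<xi> p"
proof -
  let ?e = "\<lambda>q. if q = p then 1 else (0::complex)"
  have e: "pair ?e w = w p" for w
  proof -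
    have "pair ?e w = (\<Sum>q<n. if q = p then w q else 0)" unfolding pair_def by (intro sum.cong) auto
    then show ?thesis using p by simp
  qed
  \<comment> \<open>Subtracting \<open>\<xi> p * a\<close> from the coordinate functional puts it
    into the hyperplane, because \<open>pair a \<xi> = 1\<close>.\<close>
  have "pair (\<lambda>q. ?e q - \<xi> p * a q) \<xi> = 0" using e a1 by (simp only: pair_lin_left) simp
  from bcoef_ker[OF u v k this] show ?thesis by (simp only: pair_lin_left e) (simp add: mult.commute)
qed

lemma bcoef_low:
  assumes u: "tker m y a u" and v: "tker m y a v" and k: "Suc k < m" and p: "p < n"
  shows "bcoef u v k p = 0"
  using bcoef_xi[OF u v _ p, of k] pair_bcoef[OF u v, of k] tker_low[OF u v k] k by simp

text \<open>The top coefficient of the bracket is a nonzero multiple of \<open>\<xi>\<close>. Jacobi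
  and the kernel relations turn the form at \<open>y\<close> on it into minus the form at
  \<open>a\<close> on the next lower coefficient, which is zero by \<open>bcoef_low\<close>.\<close>

lemma xi_kernel:
  assumes u: "tker m y a u" and v: "tker m y a v" and nz: "F a (u (m - 1)) (v 0) \<noteq> 0"
  shows "F y \<xi> w = 0"
proof -
  obtain k where k: "m = Suc k" using m by (cases m) auto
  let ?R = "\<lambda>i j. F a (u i) (br (v j) w) - F a (v j) (br (u i) w)"
  \<comment> \<open>The kernel vectors \<open>u 0\<close> and \<open>v 0\<close> each remove one
    boundary term; the remaining indices shift by one, so the two sums recombine in degree
    \<open>k - 1\<close>.\<close>
  have s1: "(\<Sum>i\<le>k. F y (u i) (br (v (k - i)) w)) = (\<Sum>i<k. - F a (u i) (br (v (k - Suc i)) w))"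
  proof -
    have "(\<Sum>i\<le>k. F y (u i) (br (v (k - i)) w)) =
        F y (u 0) (br (v k) w) + (\<Sum>i<k. F y (u (Suc i)) (br (v (k - Suc i)) w))"
      by (simp add: sum.atMost_shift)
    then show ?thesis using tker_0[OF u m] tker_Suc[OF u] k by simp
  qed
  have s2: "(\<Sum>i\<le>k. F y (v (k - i)) (br (u i) w)) = (\<Sum>i<k. - F a (v (k - Suc i)) (br (u i) w))"
  proof -
    have "(\<Sum>i\<le>k. F y (v (k - i)) (br (u i) w)) =
        (\<Sum>i<k. F y (v (k - i)) (br (u i) w)) + F y (v 0) (br (u k) w)"
      by (simp add: lessThan_Suc_atMost[symmetric])
    moreover have "F y (v (k - i)) (br (u i) w) = - F a (v (k - Suc i)) (br (u i) w)" if "i < k" for i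
      using tker_Suc[OF v, of "k - Suc i"] that k by (simp add: Suc_diff_Suc)
    ultimately show ?thesis using tker_0[OF v m] by simp
  qed
  have "F y (bcoef u v k) w = (\<Sum>i\<le>k. F y (u i) (br (v (k - i)) w)) - (\<Sum>i\<le>k. F y (v (k - i)) (br (u i) w))"
    by (simp add: bcoef_def F_br sum_subtractf)
  also have "\<dots> = - (\<Sum>i<k. F a (br (u i) (v (k - Suc i))) w)"
    unfolding s1 s2 by (simp add: F_br sum_subtractf sum_negf)
  also have "(\<Sum>i<k. F a (br (u i) (v (k - Suc i))) w) = 0"
  proof (cases k)
    case (Suc k')
    have "(\<Sum>i<k. F a (br (u i) (v (k - Suc i))) w) = F a (bcoef u v k') w"
      unfolding Suc by (simp add: bcoef_def lessThan_Suc_atMost)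
    also have "\<dots> = F a (\<lambda>p. 0) w" by (rule F_cong) (use bcoef_low[OF u v, of k'] k Suc in auto)
    finally show ?thesis by simp
  qed auto
  finally have "F y (bcoef u v k) w = 0" by simp
  moreover have "F y (bcoef u v k) w = F y (\<lambda>p. pair a (bcoef u v k) * \<xi> p) w"
    by (rule F_cong) (use bcoef_xi[OF u v] k in auto)
  ultimately have "pair a (bcoef u v k) * F y \<xi> w = 0" by simp
  moreover have "pair a (bcoef u v k) \<noteq> 0"
    using pair_bcoef[OF u v, of k] k nz by (simp del: of_nat_Suc)
  ultimately show ?thesis by simp
qed

text \<open>The Jacobi identity at \<open>y + t * a\<close>, divided by \<open>t ^ m\<close> and
  read in degree \<open>m - 1\<close>. It is the equation
  \<open>\<omega> \<and> \<theta> = 0\<close> for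
  \<open>\<omega> u v = F a (u (m - 1)) (v 0)\<close> and
  \<open>\<theta> u = F a (u (m - 1)) \<xi>\<close>.\<close>

lemma cyclic:
  assumes u: "tker m y a u" and v: "tker m y a v" and x: "tker m y a x"
  shows "F a (u (m - 1)) (v 0) * F a (x (m - 1)) \<xi> + F a (v (m - 1)) (x 0) * F a (u (m - 1)) \<xi> +
    F a (x (m - 1)) (u 0) * F a (v (m - 1)) \<xi> = 0"
proof -
  obtain k where k: "m = Suc k" using m by (cases m) auto
  define V where "V u t = (\<lambda>i. \<Sum>s<m. t ^ s * u s i)" for u :: "nat \<Rightarrow> nat \<Rightarrow> complex" and t :: complex
  have FV: "F z (V u t) w = (\<Sum>s<m. t ^ s * F z (u s) w)" for z u t w
    unfolding V_def by simp
  \<comment> \<open>All degrees cancel by the kernel relations except degree \<open>m\<close>, where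
    the truncated vector has no successor.\<close>
  have top: "F y (V u t) w + t * F a (V u t) w = t ^ m * F a (u (m - 1)) w" if "tker m y a u" for u t w
  proof -
    have "F y (V u t) w = F y (u 0) w + (\<Sum>s<k. t ^ Suc s * F y (u (Suc s)) w)"
      unfolding FV k by (simp add: sum.lessThan_Suc_shift del: sum.lessThan_Suc)
    also have "\<dots> = - (\<Sum>s<k. t ^ Suc s * F a (u s) w)"
      using tker_0[OF that m] tker_Suc[OF that] k by (simp add: sum_negf)
    finally show ?thesis unfolding FV k by (simp add: sum_distrib_left mult.assoc algebra_simps)
  qed
  let ?G = "\<lambda>u v x t. F a (x (m - 1)) (br (V u t) (V v t))"
  have cyc: "?G u v x t + ?G v x u t + ?G x u v t = 0" if "t \<noteq> 0" for t
  proof -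
    have "t ^ m * (?G u v x t + ?G v x u t + ?G x u v t) = 0"
      unfolding distrib_left top[OF u, symmetric] top[OF v, symmetric] top[OF x, symmetric]
      using F_jacobi[of y "V u t" "V v t" "V x t"] F_jacobi[of a "V u t" "V v t" "V x t"]
      by (simp add: algebra_simps) (simp add: distrib_left[symmetric])
    then show ?thesis using that by simp
  qed
  \<comment> \<open>Stated as polynomials in \<open>t\<close>, the cyclic identity can be compared
    in degree \<open>k = m - 1\<close>, where brackets are multiples of
    \<open>\<xi>\<close>.\<close>
  define P where "P u v x = (\<Sum>i<m. \<Sum>j<m. monom (F a (x (m - 1)) (br (u i) (v j))) (i + j))"
    for u v x :: "nat \<Rightarrow> nat \<Rightarrow> complex"
  have br_r: "F a z (br (V u t) (V v t)) = (\<Sum>i<m. \<Sum>j<m. t ^ (i + j) * F a z (br (u i) (v j)))" for z u v t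
  proof -
    have "F a z (br (V u t) (V v t)) = (\<Sum>i<m. t ^ i * F a z (br (u i) (V v t)))"
      unfolding V_def[of u] by simp
    also have "\<dots> = (\<Sum>i<m. t ^ i * (\<Sum>j<m. t ^ j * F a z (br (u i) (v j))))"
    proof (intro sum.cong refl arg_cong2[where f="(*)"])
      fix i
      have "F a z (br (u i) (V v t)) = - F a z (br (V v t) (u i))" by (rule F_br_skew)
      also have "\<dots> = - (\<Sum>j<m. t ^ j * F a z (br (v j) (u i)))" unfolding V_def by simp
      also have "\<dots> = (\<Sum>j<m. t ^ j * F a z (br (u i) (v j)))"
        unfolding F_br_skew[of a z "u i"] by (simp add: sum_negf)
      finally show "F a z (br (u i) (V v t)) = (\<Sum>j<m. t ^ j * F a z (br (u i) (v j)))" .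
    qed
    finally show ?thesis by (simp add: sum_distrib_left power_add mult.assoc)
  qed
  have polyP: "poly (P u v x) t = ?G u v x t" for u v x t
    unfolding P_def br_r by (simp add: poly_sum poly_monom mult.commute)
  have coeffP: "coeff (P u v x) k = F a (x (m - 1)) (bcoef u v k)" for u v x
  proof -
    have "coeff (P u v x) k = (\<Sum>i<m. \<Sum>j<m. if i + j = k then F a (x (m - 1)) (br (u i) (v j)) else 0)"
      unfolding P_def by (simp add: coeff_sum cong: if_cong)
    also have "\<dots> = (\<Sum>i<m. F a (x (m - 1)) (br (u i) (v (k - i))))"
    proof (intro sum.cong refl)
      fix i assume "i \<in> {..<m}"
      then have i: "i \<le> k" using k by simp
      have "(\<Sum>j<m. if i + j = k then F a (x (m - 1)) (br (u i) (v j)) else 0) =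
        (\<Sum>j<m. if j = k - i then F a (x (m - 1)) (br (u i) (v j)) else 0)"
        using i by (intro sum.cong refl) auto
      then show "(\<Sum>j<m. if i + j = k then F a (x (m - 1)) (br (u i) (v j)) else 0) =
         F a (x (m - 1)) (br (u i) (v (k - i)))" using k by simp
    qed
    finally show ?thesis by (simp add: bcoef_def k lessThan_Suc_atMost)
  qed
  have "P u v x + P v x u + P x u v = 0"
  proof -
    have "poly (P u v x + P v x u + P x u v) r = 0" for r
      by (rule univ_funs_eq_0[OF univ_funs_poly, of "{0}"]) (use cyc polyP in auto)
    then show ?thesis using poly_all_0_iff_0 by blast
  qed
  then have "coeff (P u v x + P v x u + P x u v) k = 0" by simp
  then have s: "F a (x (m - 1)) (bcoef u v k) + F a (u (m - 1)) (bcoef v x k) + F a (v (m - 1)) (bcoef x u k) = 0"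
    by (simp add: coeffP)
  have b: "F a z (bcoef u v k) = of_nat m * (F a (u (m - 1)) (v 0) * F a z \<xi>)"
    if "tker m y a u" "tker m y a v" for u v z
  proof -
    have "F a z (bcoef u v k) = F a z (\<lambda>p. pair a (bcoef u v k) * \<xi> p)"
      by (rule F_cong) (use bcoef_xi[OF that] k in auto)
    then show ?thesis using pair_bcoef[OF that, of k] k by simp
  qed
  have "of_nat m * (F a (u (m - 1)) (v 0) * F a (x (m - 1)) \<xi> + F a (v (m - 1)) (x 0) * F a (u (m - 1)) \<xi> +
    F a (x (m - 1)) (u 0) * F a (v (m - 1)) \<xi>) = 0"
    using s unfolding b[OF u v] b[OF v x] b[OF x u] by (simp only: distrib_left)
  then show ?thesis using m by simp
qed

lemma chain_tker:
  assumes w: "chain m y a w" shows "tker m y a (\<lambda>s i. (- 1) ^ s * w (m - 1 - s) i)"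
  unfolding tker_def
proof (intro allI impI)
  fix s z assume s: "s < m"
  have "F y (w (m - 1 - s)) z = F a (w (Suc (m - 1 - s))) z"
    using w s m unfolding chain_def by simp
  moreover have "Suc (m - 1 - s) = (if s = 0 then m else m - 1 - (s - 1))" using s by auto
  ultimately show "F y (\<lambda>i. (- 1) ^ s * w (m - 1 - s) i) z +
      (if s = 0 then 0 else F a (\<lambda>i. (- 1) ^ (s - 1) * w (m - 1 - (s - 1)) i) z) = 0"
    using w unfolding chain_def F_left(2) by (cases s) auto
qed

lemma chain_xi_kernel:
  assumes "chain m y a w" "chain m y a w'" "F a (w 0) (w' (m - 1)) \<noteq> 0"
  shows "F y \<xi> z = 0"
  by (rule xi_kernel[OF chain_tker[OF assms(1)] chain_tker[OF assms(2)]]) (use assms(3) in simp)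

lemma chain_cyclic:
  assumes "chain m y a w" "chain m y a w'" "chain m y a w''"
  shows "F a (w 0) (w' (m - 1)) * F a (w'' 0) \<xi> + F a (w' 0) (w'' (m - 1)) * F a (w 0) \<xi> +
    F a (w'' 0) (w (m - 1)) * F a (w' 0) \<xi> = 0"
proof -
  define e :: complex where "e = (- 1) ^ (m - 1)"
  have ee: "e * e = 1" unfolding e_def by (simp add: power_mult_distrib[symmetric])
  have "e * F a (w 0) (w' (m - 1)) * (e * F a (w'' 0) \<xi>) + e * F a (w' 0) (w'' (m - 1)) * (e * F a (w 0) \<xi>) +
    e * F a (w'' 0) (w (m - 1)) * (e * F a (w' 0) \<xi>) = 0"
    using cyclic[OF chain_tker[OF assms(1)] chain_tker[OF assms(2)] chain_tker[OF assms(3)]]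
    by (simp only: F_left(2) diff_self_eq_0 power_0 mult_1 diff_zero e_def[symmetric])
  moreover have "e * x * (e * z) = x * z" for x z using ee by (simp add: ac_simps)
  ultimately show ?thesis by simp
qed

text \<open>\<open>P, Q\<close> and \<open>P', Q'\<close> play the role of two orthogonal hyperbolic
  pairs. Inserting \<open>P\<close> and \<open>Q\<close> next to the second pair kills
  \<open>\<theta>\<close> on the first; any \<open>w\<close> next to the first pair then has
  \<open>\<theta> w = 0\<close>. Here the second block of maximal size enters.\<close>

lemma chain_orth:
  assumes ch: "chain m y a P" "chain m y a Q" "chain m y a P'" "chain m y a Q'" "chain m y a w"
    and pq: "F a (P 0) (Q (m - 1)) = 1" "F a (P' 0) (Q' (m - 1)) = 1"
    and z: "F a (Q' 0) (P (m - 1)) = 0" "F a (P 0) (P' (m - 1)) = 0"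
      "F a (Q' 0) (Q (m - 1)) = 0" "F a (Q 0) (P' (m - 1)) = 0"
  shows "F a (w 0) \<xi> = 0"
proof -
  have P: "F a (P 0) \<xi> = 0" using chain_cyclic[OF ch(3,4,1)] pq z by simp
  have Q: "F a (Q 0) \<xi> = 0" using chain_cyclic[OF ch(3,4,2)] pq z by simp
  show ?thesis using chain_cyclic[OF ch(1,2,5)] pq P Q by simp
qed

end

section \<open>Truncated kernel elements as kernel vectors of matrices\<close>

lemma conv_linear:
  fixes \<alpha> \<beta> :: complex
  assumes "s < m"
  shows "(\<Sum>w<m. (if w \<le> s then coeff [:\<alpha>, \<beta>:] (s - w) else 0) * g w) = \<alpha> * g s + (if s = 0 then 0 else \<beta> * g (s - 1))"
proof -
  have "(\<Sum>w<m. (if w \<le> s then coeff [:\<alpha>, \<beta>:] (s - w) else 0) * g w) =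
    (\<Sum>w<m. (if w = s then \<alpha> * g s else 0) + (if Suc w = s then \<beta> * g w else 0))"
  proof (intro sum.cong refl)
    fix w
    show "(if w \<le> s then coeff [:\<alpha>, \<beta>:] (s - w) else 0) * g w =
      (if w = s then \<alpha> * g s else 0) + (if Suc w = s then \<beta> * g w else 0)"
    proof (cases "w < s")
      case True
      then obtain d where "s = w + Suc d" using less_iff_Suc_add by auto
      then show ?thesis by (cases d) auto
    qed auto
  qed
  also have "\<dots> = \<alpha> * g s + (if s = 0 then 0 else \<beta> * g (s - 1))"
    using assms by (cases s) (simp_all add: sum.distrib)
  finally show ?thesis .
qed

lemma conv_linear_transpose:
  fixes \<alpha> \<beta> :: complex
  assumes "w < m"
  shows "(\<Sum>s<m. (if w \<le> s then coeff [:\<alpha>, \<beta>:] (s - w) else 0) * g s) = \<alpha> * g w + (if Suc w < m then \<beta> * g (Suc w) else 0)"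
proof -
  have "(\<Sum>s<m. (if w \<le> s then coeff [:\<alpha>, \<beta>:] (s - w) else 0) * g s) =
    (\<Sum>s<m. (if s = w then \<alpha> * g w else 0) + (if s = Suc w then \<beta> * g (Suc w) else 0))"
  proof (intro sum.cong refl)
    fix s
    show "(if w \<le> s then coeff [:\<alpha>, \<beta>:] (s - w) else 0) * g s =
      (if s = w then \<alpha> * g w else 0) + (if s = Suc w then \<beta> * g (Suc w) else 0)"
    proof (cases "w < s")
      case True
      then obtain d where "s = w + Suc d" using less_iff_Suc_add by auto
      then show ?thesis by (cases d) auto
    qed auto
  qed
  also have "\<dots> = \<alpha> * g w + (if Suc w < m then \<beta> * g (Suc w) else 0)"
    using assms by (simp add: sum.distrib)
  finally show ?thesis .
qed

context lie
begin

definition A :: "(nat \<Rightarrow> complex) \<Rightarrow> complex mat" where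
  "A x = lie_form n c (vec n x)"

lemma A_carrier [simp]: "A x \<in> carrier_mat n n"
  unfolding A_def lie_form_def by simp

lemma A_dim [simp]: "dim_row (A x) = n" "dim_col (A x) = n"
  unfolding A_def lie_form_def by simp_all

lemma A_index: "i < n \<Longrightarrow> j < n \<Longrightarrow> A x $$ (i, j) = (\<Sum>k<n. x k * c i j k)"
  unfolding A_def lie_form_def by simp

lemma A_lin: "i < n \<Longrightarrow> j < n \<Longrightarrow> A (\<lambda>k. x k + e * h k) $$ (i, j) = A x $$ (i, j) + e * A h $$ (i, j)"
  "i < n \<Longrightarrow> j < n \<Longrightarrow> A (\<lambda>k. x k - e * h k) $$ (i, j) = A x $$ (i, j) - e * A h $$ (i, j)"
  by (simp_all add: A_index algebra_simps sum.distrib sum_subtractf sum_distrib_left)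

lemma F_A: "F y u v = (\<Sum>i<n. \<Sum>j<n. u i * v j * A y $$ (i, j))"
proof -
  have "F y u v = (\<Sum>p<n. \<Sum>i<n. \<Sum>j<n. u i * v j * (y p * c i j p))"
    unfolding F_def pair_def br_def by (simp add: sum_distrib_left ac_simps)
  also have "\<dots> = (\<Sum>i<n. \<Sum>p<n. \<Sum>j<n. u i * v j * (y p * c i j p))" by (rule sum.swap)
  also have "\<dots> = (\<Sum>i<n. \<Sum>j<n. \<Sum>p<n. u i * v j * (y p * c i j p))"
    by (intro sum.cong refl sum.swap)
  finally show ?thesis by (simp add: A_index sum_distrib_left)
qed

lemma F_unit:
  assumes i: "i < n"
  shows "F y (\<lambda>q. if q = i then 1 else 0) u = (\<Sum>j<n. A y $$ (i, j) * u j)"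
    and "F y u (\<lambda>q. if q = i then 1 else 0) = (\<Sum>j<n. A y $$ (j, i) * u j)"
proof -
  have "F y (\<lambda>q. if q = i then 1 else 0) u = (\<Sum>k<n. if k = i then \<Sum>j<n. u j * A y $$ (k, j) else 0)"
    unfolding F_A by (intro sum.cong) auto
  then show "F y (\<lambda>q. if q = i then 1 else 0) u = (\<Sum>j<n. A y $$ (i, j) * u j)"
    using i by (simp add: mult.commute)
  have "F y u (\<lambda>q. if q = i then 1 else 0) = (\<Sum>k<n. \<Sum>j<n. if j = i then u k * A y $$ (k, j) else 0)"
    unfolding F_A by (intro sum.cong) auto
  then show "F y u (\<lambda>q. if q = i then 1 else 0) = (\<Sum>j<n. A y $$ (j, i) * u j)"
    using i by (simp add: mult.commute)
qed

lemma lpencil_A_index: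
  "i < n \<Longrightarrow> j < n \<Longrightarrow> lpencil (A x) (A a) l $$ (i, j) = [:A (\<lambda>k. x k - l * a k) $$ (i, j), A a $$ (i, j):]"
  by (simp add: lpencil_def A_lin)

text \<open>Instance of \<open>max_rank_kernel\<close>: truncated kernel elements are right kernel
  vectors of the truncated pencil, and left ones once their degrees are reversed.\<close>

lemma const_rank:
  assumes m: "0 < m" and X: "X \<in> carrier_mat R (n * m)" and Y: "Y \<in> carrier_mat (n * m) R"
    and nz: "det (X * toep m (lpencil (A x) (A a) l) * Y) \<noteq> 0"
    and max: "\<And>e. \<not> rk_ge (toep m (lpencil (A (\<lambda>k. x k + e * h k)) (A a) l)) (Suc R)"
    and y: "y = (\<lambda>k. x k - l * a k)" and u: "tker m y a u" and v: "tker m y a v"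
  shows "(\<Sum>s<m. F h (u s) (v (m - 1 - s))) = 0"
proof -
  let ?N = "n * m"
  define T0 where "T0 = toep m (lpencil (A x) (A a) l)"
  \<comment> \<open>The eigenvalue \<open>l\<close> stays fixed along \<open>h\<close>, so the
    derivative of the pencil is the form at \<open>h\<close> without a
    \<open>t\<close>-part.\<close>
  define T1 where "T1 = toep m (lpencil (A h) (0\<^sub>m n n) 0)"
  have T: "T0 \<in> carrier_mat ?N ?N" "T1 \<in> carrier_mat ?N ?N" unfolding T0_def T1_def by auto
  have lc: "lpencil (A x) (A a) l \<in> carrier_mat n n" "lpencil (A h) (0\<^sub>m n n) 0 \<in> carrier_mat n n" for x by auto
  have dm: "p div m < n" "p mod m < m" if "p < ?N" for p using that m by (auto simp: div_less_iff)
  have e0: "T0 $$ (p, q) = (if q mod m \<le> p mod m then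
      coeff [:A y $$ (p div m, q div m), A a $$ (p div m, q div m):] (p mod m - q mod m) else 0)"
    if "p < ?N" "q < ?N" for p q
    unfolding T0_def toep_index[OF lc(1) that] using dm[OF that(1)] dm[OF that(2)]
    by (simp add: lpencil_A_index y)
  have e1: "T1 $$ (p, q) = (if q mod m \<le> p mod m then
      coeff [:A h $$ (p div m, q div m), 0:] (p mod m - q mod m) else 0)"
    if "p < ?N" "q < ?N" for p q
    unfolding T1_def toep_index[OF lc(2) that] using dm[OF that(1)] dm[OF that(2)]
    by (simp add: lpencil_def)
  have Te: "toep m (lpencil (A (\<lambda>k. x k + e * h k)) (A a) l) = T0 + e \<cdot>\<^sub>m T1" for e
  proof (rule eq_matI)
    fix p q assume "p < dim_row (T0 + e \<cdot>\<^sub>m T1)" "q < dim_col (T0 + e \<cdot>\<^sub>m T1)"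
    then have pq: "p < ?N" "q < ?N" using T by auto
    show "toep m (lpencil (A (\<lambda>k. x k + e * h k)) (A a) l) $$ (p, q) = (T0 + e \<cdot>\<^sub>m T1) $$ (p, q)"
      unfolding toep_index[OF lc(1) pq] using dm[OF pq(1)] dm[OF pq(2)] pq T e0[OF pq] e1[OF pq]
      by (auto simp: lpencil_def A_lin y coeff_pCons split: nat.split)
  qed (use T in auto)
  define U where "U = vec ?N (\<lambda>q. u (q mod m) (q div m))"
  define V where "V = vec ?N (\<lambda>q. v (m - 1 - q mod m) (q div m))"
  have UV: "U \<in> carrier_vec ?N" "V \<in> carrier_vec ?N" unfolding U_def V_def by auto
  let ?e = "\<lambda>i q. if q = i then 1 else (0::complex)"
  have T0U: "T0 *\<^sub>v U = 0\<^sub>v ?N"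
  proof (rule eq_vecI)
    fix p assume "p < dim_vec (0\<^sub>v ?N)"
    then have p: "p < ?N" by simp
    let ?i = "p div m" and ?s = "p mod m"
    have "(T0 *\<^sub>v U) $ p = (\<Sum>q<?N. T0 $$ (p, q) * U $ q)"
      using p T UV by (simp add: scalar_prod_def lessThan_atLeast0)
    also have "\<dots> = (\<Sum>q<?N. (\<lambda>j w. (if w \<le> ?s then coeff [:A y $$ (?i, j), A a $$ (?i, j):] (?s - w) else 0) * u w j) (q div m) (q mod m))"
      using p by (intro sum.cong refl) (simp add: e0 U_def del: coeff_pCons_Suc)
    also have "\<dots> = (\<Sum>j<n. \<Sum>w<m. (if w \<le> ?s then coeff [:A y $$ (?i, j), A a $$ (?i, j):] (?s - w) else 0) * u w j)"
      by (rule sum_div_mod[OF m])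
    also have "\<dots> = (\<Sum>j<n. A y $$ (?i, j) * u ?s j + (if ?s = 0 then 0 else A a $$ (?i, j) * u (?s - 1) j))"
      by (intro sum.cong refl conv_linear dm p)
    also have "\<dots> = F y (?e ?i) (u ?s) + (if ?s = 0 then 0 else F a (?e ?i) (u (?s - 1)))"
      using dm[OF p] by (simp add: F_unit(1) sum.distrib)
    also have "\<dots> = - (F y (u ?s) (?e ?i) + (if ?s = 0 then 0 else F a (u (?s - 1)) (?e ?i)))"
      using F_skew[of y "?e ?i" "u ?s"] F_skew[of a "?e ?i" "u (?s - 1)"] by simp
    also have "\<dots> = 0" using u dm[OF p] unfolding tker_def by simp
    finally show "(T0 *\<^sub>v U) $ p = 0\<^sub>v ?N $ p" using p by simp
  qed (use T in auto)
  have VT0: "transpose_mat T0 *\<^sub>v V = 0\<^sub>v ?N"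
  proof (rule eq_vecI)
    fix q assume "q < dim_vec (0\<^sub>v ?N)"
    then have q: "q < ?N" by simp
    let ?j = "q div m" and ?w = "q mod m"
    have "(transpose_mat T0 *\<^sub>v V) $ q = (\<Sum>p<?N. T0 $$ (p, q) * V $ p)"
      using q T UV by (simp add: scalar_prod_def lessThan_atLeast0)
    also have "\<dots> = (\<Sum>p<?N. (\<lambda>i s. (if ?w \<le> s then coeff [:A y $$ (i, ?j), A a $$ (i, ?j):] (s - ?w) else 0) * v (m - 1 - s) i) (p div m) (p mod m))"
      using q by (intro sum.cong refl) (simp add: e0 V_def del: coeff_pCons_Suc)
    also have "\<dots> = (\<Sum>i<n. \<Sum>s<m. (if ?w \<le> s then coeff [:A y $$ (i, ?j), A a $$ (i, ?j):] (s - ?w) else 0) * v (m - 1 - s) i)"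
      by (rule sum_div_mod[OF m])
    also have "\<dots> = (\<Sum>i<n. A y $$ (i, ?j) * v (m - 1 - ?w) i + (if Suc ?w < m then A a $$ (i, ?j) * v (m - 1 - Suc ?w) i else 0))"
      by (intro sum.cong refl conv_linear_transpose dm q)
    also have "\<dots> = F y (v (m - 1 - ?w)) (?e ?j) + (if Suc ?w < m then F a (v (m - 1 - Suc ?w)) (?e ?j) else 0)"
      using dm[OF q] by (simp add: F_unit(2) sum.distrib)
    also have "\<dots> = 0"
    proof -
      have "m - 1 - ?w < m" using m by simp
      from v[unfolded tker_def, rule_format, OF this, of "?e ?j"]
      have "F y (v (m - 1 - ?w)) (?e ?j) + (if m - 1 - ?w = 0 then 0 else F a (v (m - 1 - ?w - 1)) (?e ?j)) = 0" .
      moreover have "m - 1 - ?w = 0 \<longleftrightarrow> \<not> Suc ?w < m" "m - 1 - ?w - 1 = m - 1 - Suc ?w" by auto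
      ultimately show ?thesis by (simp split: if_splits)
    qed
    finally show "(transpose_mat T0 *\<^sub>v V) $ q = 0\<^sub>v ?N $ q" using q by simp
  qed (use T in auto)
  have "V \<bullet> (T1 *\<^sub>v U) = 0"
    by (rule max_rank_kernel[OF T X Y _ _ UV(1) T0U UV(2) VT0]) (use nz max Te T0_def in auto)
  moreover have "V \<bullet> (T1 *\<^sub>v U) = (\<Sum>s<m. F h (v (m - 1 - s)) (u s))"
  proof -
    have T1U: "(T1 *\<^sub>v U) $ p = (\<Sum>j<n. A h $$ (p div m, j) * u (p mod m) j)" if p: "p < ?N" for p
    proof -
      have "(T1 *\<^sub>v U) $ p = (\<Sum>q<?N. T1 $$ (p, q) * U $ q)"
        using p T UV by (simp add: scalar_prod_def lessThan_atLeast0)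
      also have "\<dots> = (\<Sum>q<?N. (\<lambda>j w. (if w \<le> p mod m then coeff [:A h $$ (p div m, j), 0:] (p mod m - w) else 0) * u w j) (q div m) (q mod m))"
        using p by (intro sum.cong refl) (simp add: e1 U_def del: coeff_pCons_Suc)
      also have "\<dots> = (\<Sum>j<n. \<Sum>w<m. (if w \<le> p mod m then coeff [:A h $$ (p div m, j), 0:] (p mod m - w) else 0) * u w j)"
        by (rule sum_div_mod[OF m])
      also have "\<dots> = (\<Sum>j<n. A h $$ (p div m, j) * u (p mod m) j + (if p mod m = 0 then 0 else 0 * u (p mod m - 1) j))"
        by (intro sum.cong refl conv_linear dm p)
      finally show ?thesis by (cases "p mod m = 0") simp_all
    qed
    have "V \<bullet> (T1 *\<^sub>v U) = (\<Sum>p<?N. V $ p * (T1 *\<^sub>v U) $ p)"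
      using T UV by (simp add: scalar_prod_def lessThan_atLeast0)
    also have "\<dots> = (\<Sum>p<?N. (\<lambda>i s. v (m - 1 - s) i * (\<Sum>j<n. A h $$ (i, j) * u s j)) (p div m) (p mod m))"
    proof (intro sum.cong refl)
      fix p assume "p \<in> {..<?N}"
      then have p: "p < ?N" by simp
      show "V $ p * (T1 *\<^sub>v U) $ p = (\<lambda>i s. v (m - 1 - s) i * (\<Sum>j<n. A h $$ (i, j) * u s j)) (p div m) (p mod m)"
        unfolding T1U[OF p] using p by (simp add: V_def)
    qed
    also have "\<dots> = (\<Sum>i<n. \<Sum>s<m. v (m - 1 - s) i * (\<Sum>j<n. A h $$ (i, j) * u s j))"
      by (rule sum_div_mod[OF m])
    also have "\<dots> = (\<Sum>s<m. \<Sum>i<n. v (m - 1 - s) i * (\<Sum>j<n. A h $$ (i, j) * u s j))"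
      by (rule sum.swap)
    also have "\<dots> = (\<Sum>s<m. F h (v (m - 1 - s)) (u s))"
      unfolding F_A by (simp add: sum_distrib_left ac_simps)
    finally show ?thesis .
  qed
  ultimately have "(\<Sum>s<m. - F h (u s) (v (m - 1 - s))) = 0"
    unfolding F_skew[of h "v _"] by simp
  then show ?thesis by (simp add: sum_negf)
qed

end

section \<open>Bases adapted to the block decomposition\<close>

definition off :: "jk_block list \<Rightarrow> nat \<Rightarrow> nat" where
  "off bs b = sum_list (map bdim (take b bs))"

lemma off_simps [simp]: "off bs 0 = 0" "off (x # bs) (Suc b) = bdim x + off bs b"
  by (simp_all add: off_def)

lemma off_less: "b < length bs \<Longrightarrow> i < bdim (bs ! b) \<Longrightarrow> off bs b + i < sum_list (map bdim bs)"
proof (induction bs arbitrary: b)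
  case (Cons x bs)
  then show ?case by (cases b) (auto simp: add.assoc)
qed simp

lemma sum_lessThan_add: "(\<Sum>p<d + (N::nat). g p) = (\<Sum>p<d. g p) + (\<Sum>p<N. g (d + p) :: complex)"
  by (induction N) auto

lemma sum_blocks:
  "(\<Sum>p<sum_list (map bdim bs). g p) = (\<Sum>b<length bs. \<Sum>i<bdim (bs ! b). g (off bs b + i) :: complex)"
proof (induction bs arbitrary: g)
  case (Cons x bs)
  show ?case
    by (simp add: sum_lessThan_add Cons.IH[of "\<lambda>p. g (bdim x + p)"] sum.lessThan_Suc_shift add.assoc del: sum.lessThan_Suc)
qed simp

lemma diag_block_index:
  assumes G: "\<And>b. G b \<in> carrier_mat (bdim b) (bdim b)"
  shows "b < length bs \<Longrightarrow> b' < length bs \<Longrightarrow> i < bdim (bs ! b) \<Longrightarrow> i' < bdim (bs ! b') \<Longrightarrow>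
      diag_block_mat (map G bs) $$ (off bs b + i, off bs b' + i') = (if b = b' then G (bs ! b) $$ (i, i') else 0)"
proof (induction bs arbitrary: b b')
  case (Cons x bs)
  have d: "dim_row (diag_block_mat (map G bs)) = sum_list (map bdim bs)"
    "dim_col (diag_block_mat (map G bs)) = sum_list (map bdim bs)"
    "dim_row (G x) = bdim x" "dim_col (G x) = bdim x"
    using diag_block_carrier[of G bs, OF G] G[of x] by auto
  have lt: "off bs k + r < sum_list (map bdim bs)" if "Suc k < length (x # bs)" "r < bdim ((x # bs) ! Suc k)" for k r
    using off_less[of k bs r] that by simp
  show ?case
  proof (cases b)
    case 0
    show ?thesis
    proof (cases b')
      case 0
      then show ?thesis using Cons.prems \<open>b = 0\<close> d by (simp add: Let_def)
    next
      case (Suc k')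
      then show ?thesis using Cons.prems \<open>b = 0\<close> d lt[of k' i'] by (simp add: Let_def)
    qed
  next
    case (Suc k)
    show ?thesis
    proof (cases b')
      case 0
      then show ?thesis using Cons.prems \<open>b = Suc k\<close> d lt[of k i] by (simp add: Let_def)
    next
      case (Suc k')
      then show ?thesis using Cons.prems \<open>b = Suc k\<close> d lt[of k i] lt[of k' i'] Cons.IH[of k k']
        by (simp add: Let_def add.assoc)
    qed
  qed
qed simp

text \<open>Value of the first form on basis vector \<open>i\<close> of a block and a vector whose
  coordinates in that block are \<open>g\<close>.\<close>

definition rowA :: "jk_block \<Rightarrow> nat \<Rightarrow> (nat \<Rightarrow> complex) \<Rightarrow> complex" where
  "rowA b i g = (\<Sum>i'<bdim b. block_A b $$ (i, i') * g i')"

definition rowB :: "jk_block \<Rightarrow> nat \<Rightarrow> (nat \<Rightarrow> complex) \<Rightarrow> complex" where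
  "rowB b i g = (\<Sum>i'<bdim b. block_B b $$ (i, i') * g i')"

lemma row_kronecker:
  "i < k \<Longrightarrow> rowA (JK_Kronecker k) i g = (if i < k - 1 then g (k + i) else 0)"
  "i < k \<Longrightarrow> rowB (JK_Kronecker k) i g = (if 0 < i then g (k + (i - 1)) else 0)"
  "i < k - 1 \<Longrightarrow> rowA (JK_Kronecker k) (k + i) g = - g i"
  "i < k - 1 \<Longrightarrow> rowB (JK_Kronecker k) (k + i) g = - g (Suc i)"
proof -
  assume i: "i < k"
  have "rowA (JK_Kronecker k) i g = (\<Sum>l<k. 0) + (\<Sum>l<k - 1. if l = i then g (k + i) else 0)"
    unfolding rowA_def bdim.simps sum_lessThan_add using i
    by (intro arg_cong2[where f="(+)"] sum.cong) (auto simp: skew_of_def kron_M1_def)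
  then show "rowA (JK_Kronecker k) i g = (if i < k - 1 then g (k + i) else 0)" by simp
  have "rowB (JK_Kronecker k) i g = (\<Sum>l<k. 0) + (\<Sum>l<k - 1. if l = i - 1 then if 0 < i then g (k + (i - 1)) else 0 else 0)"
    unfolding rowB_def bdim.simps sum_lessThan_add using i
    by (intro arg_cong2[where f="(+)"] sum.cong) (auto simp: skew_of_def kron_M2_def)
  then show "rowB (JK_Kronecker k) i g = (if 0 < i then g (k + (i - 1)) else 0)" using i by auto
next
  assume i: "i < k - 1"
  have "rowA (JK_Kronecker k) (k + i) g = (\<Sum>l<k. if l = i then - g i else 0) + (\<Sum>l<k - 1. 0)"
    unfolding rowA_def bdim.simps sum_lessThan_add using i
    by (intro arg_cong2[where f="(+)"] sum.cong) (auto simp: skew_of_def kron_M1_def)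
  then show "rowA (JK_Kronecker k) (k + i) g = - g i" using i by simp
  have "rowB (JK_Kronecker k) (k + i) g = (\<Sum>l<k. if l = Suc i then - g (Suc i) else 0) + (\<Sum>l<k - 1. 0)"
    unfolding rowB_def bdim.simps sum_lessThan_add using i
    by (intro arg_cong2[where f="(+)"] sum.cong) (auto simp: skew_of_def kron_M2_def)
  then show "rowB (JK_Kronecker k) (k + i) g = - g (Suc i)" using i by simp
qed

lemma row_jordan:
  assumes i: "i < m"
  shows "rowA (JK_Jordan (Some \<mu>) m) i g = \<mu> * g (m + i) + (if Suc i < m then g (m + Suc i) else 0)"
    and "rowB (JK_Jordan (Some \<mu>) m) i g = g (m + i)"
    and "rowA (JK_Jordan (Some \<mu>) m) (m + i) g = - (\<mu> * g i + (if 0 < i then g (i - 1) else 0))"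
    and "rowB (JK_Jordan (Some \<mu>) m) (m + i) g = - g i"
proof -
  have "rowA (JK_Jordan (Some \<mu>) m) i g = (\<Sum>l<m. 0) +
      (\<Sum>l<m. (if l = i then \<mu> * g (m + i) else 0) + (if l = Suc i then g (m + Suc i) else 0))"
    unfolding rowA_def bdim.simps sum_lessThan_add using i
    by (intro arg_cong2[where f="(+)"] sum.cong) (auto simp: skew_of_def jordan_block_def)
  then show "rowA (JK_Jordan (Some \<mu>) m) i g = \<mu> * g (m + i) + (if Suc i < m then g (m + Suc i) else 0)"
    using i by (simp add: sum.distrib)
  have "rowB (JK_Jordan (Some \<mu>) m) i g = (\<Sum>l<m. 0) + (\<Sum>l<m. if l = i then g (m + i) else 0)"
    unfolding rowB_def bdim.simps sum_lessThan_add using i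
    by (intro arg_cong2[where f="(+)"] sum.cong) (auto simp: std_skew_def)
  then show "rowB (JK_Jordan (Some \<mu>) m) i g = g (m + i)" using i by simp
  have "rowA (JK_Jordan (Some \<mu>) m) (m + i) g =
      (\<Sum>l<m. (if l = i then - (\<mu> * g i) else 0) + (if Suc l = i then - g l else 0)) + (\<Sum>l<m. 0)"
    unfolding rowA_def bdim.simps sum_lessThan_add using i
    by (intro arg_cong2[where f="(+)"] sum.cong) (auto simp: skew_of_def jordan_block_def)
  then show "rowA (JK_Jordan (Some \<mu>) m) (m + i) g = - (\<mu> * g i + (if 0 < i then g (i - 1) else 0))"
    using i by (cases i) (simp_all add: sum.distrib)
  have "rowB (JK_Jordan (Some \<mu>) m) (m + i) g = (\<Sum>l<m. if l = i then - g i else 0) + (\<Sum>l<m. 0)"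
    unfolding rowB_def bdim.simps sum_lessThan_add using i
    by (intro arg_cong2[where f="(+)"] sum.cong) (auto simp: std_skew_def)
  then show "rowB (JK_Jordan (Some \<mu>) m) (m + i) g = - g i" using i by simp
qed

text \<open>The first \<open>k\<close> vectors of a Kronecker block span the part that contains the
  kernels of the regular forms; these dimensions add up to the bound of the theorem.\<close>

fun kdim :: "jk_block \<Rightarrow> nat" where
  "kdim (JK_Jordan mu m) = 0"
| "kdim (JK_Kronecker k) = k"

lemma sum_kdim: "(\<Sum>b<length bs. kdim (bs ! b)) = sum_mset (kronecker_ks bs)"
proof (induction bs)
  case (Cons b bs)
  then show ?case by (cases b) (simp_all add: sum.lessThan_Suc_shift del: sum.lessThan_Suc)
qed simp

lemma kernel_kronecker:
  assumes "\<And>i. i < k + (k - 1) \<Longrightarrow> rowA (JK_Kronecker k) i g - l * rowB (JK_Kronecker k) i g = 0"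
    and i: "i < k - 1"
  shows "g (k + i) = 0"
  using i
proof (induction i)
  case 0
  then show ?case using assms(1)[of 0] row_kronecker(1,2)[of 0 k g] by simp
next
  case (Suc i)
  then show ?case using assms(1)[of "Suc i"] row_kronecker(1,2)[of "Suc i" k g] by simp
qed

text \<open>Both halves give triangular systems with \<open>\<mu> - l\<close> on the diagonal, up to
  sign; one is solved from the first index upwards, the other from the last downwards.\<close>

lemma kernel_jordan:
  assumes row: "\<And>i. i < m + m \<Longrightarrow> rowA (JK_Jordan (Some \<mu>) m) i g - l * rowB (JK_Jordan (Some \<mu>) m) i g = 0"
    and ne: "\<mu> \<noteq> l" and i: "i < m"
  shows "g i = 0" and "g (m + i) = 0"
proof -
  show "g i = 0" using i
  proof (induction i)
    case 0
    then have "(\<mu> - l) * g 0 = 0" using row[of "m + 0"] row_jordan(3,4)[of 0 m \<mu> g] by (auto simp: algebra_simps)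
    then show ?case using ne by auto
  next
    case (Suc i)
    then have "(\<mu> - l) * g (Suc i) = 0" using row[of "m + Suc i"] row_jordan(3,4)[of "Suc i" m \<mu> g] by (auto simp: algebra_simps)
    then show ?case using ne by simp
  qed
  have step: "(\<mu> - l) * g (m + i) + (if Suc i < m then g (m + Suc i) else 0) = 0" if "i < m" for i
    using row[of i] row_jordan(1,2)[of i m \<mu> g] that by (simp add: algebra_simps)
  have "\<forall>i<m. m - i \<le> d \<longrightarrow> g (m + i) = 0" for d
  proof (induction d)
    case (Suc d)
    show ?case
    proof (intro allI impI)
      fix i assume i: "i < m" "m - i \<le> Suc d"
      have "(if Suc i < m then g (m + Suc i) else 0) = 0" using Suc i by auto
      then have "(\<mu> - l) * g (m + i) = 0" using step[OF i(1)] by simp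
      then show "g (m + i) = 0" using ne by simp
    qed
  qed auto
  from this[of m] i show "g (m + i) = 0" by simp
qed

context lie
begin

text \<open>The columns of the congruence matrix, addressed by block and position, so that chains
  and kernels are handled block by block.\<close>

definition jk_basis :: "(nat \<Rightarrow> complex) \<Rightarrow> (nat \<Rightarrow> complex) \<Rightarrow> jk_block list \<Rightarrow> (nat \<Rightarrow> nat \<Rightarrow> nat \<Rightarrow> complex) \<Rightarrow> bool" where
  "jk_basis x a bs e \<longleftrightarrow> (\<forall>b\<in>set bs. jk_block_ok b) \<and>
    (\<forall>b<length bs. \<forall>b'<length bs. \<forall>i<bdim (bs ! b). \<forall>i'<bdim (bs ! b').
       F x (e b i) (e b' i') = (if b = b' then block_A (bs ! b) $$ (i, i') else 0) \<and>
       F a (e b i) (e b' i') = (if b = b' then block_B (bs ! b) $$ (i, i') else 0)) \<and>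
    (\<forall>z. \<exists>g. \<forall>p<n. z p = (\<Sum>b<length bs. \<Sum>i<bdim (bs ! b). g b i * e b i p))"

lemma jk_basis_exists:
  assumes jk: "jk_decomposition n (A x) (A a) bs"
  shows "\<exists>e. jk_basis x a bs e"
proof -
  obtain P where P: "P \<in> carrier_mat n n" "invertible_mat P"
      and PA: "transpose_mat P * A x * P = diag_block_mat (map block_A bs)"
      and PB: "transpose_mat P * A a * P = diag_block_mat (map block_B bs)"
      and ok: "\<forall>b\<in>set bs. jk_block_ok b"
    using jk unfolding jk_decomposition_def by auto
  have N: "n = sum_list (map bdim bs)"
    using arg_cong[OF PA, of dim_row] diag_block_carrier[of block_A bs, OF block_carrier(1)] P by simp
  define e where "e b i = (\<lambda>p. P $$ (p, off bs b + i))" for b i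
  have F3: "F y (\<lambda>p. P $$ (p, s)) (\<lambda>p. P $$ (p, t)) = (transpose_mat P * A y * P) $$ (s, t)"
    if st: "s < n" "t < n" for y s t
  proof -
    have "(transpose_mat P * A y * P) $$ (s, t) = (\<Sum>i<n. transpose_mat P $$ (s, i) * (\<Sum>j<n. A y $$ (i, j) * P $$ (j, t)))"
      using st P by (simp add: scalar_prod_def lessThan_atLeast0 assoc_mult_mat[of _ n n _ n _ n])
    then show ?thesis unfolding F_A using st P by (simp add: sum_distrib_left ac_simps)
  qed
  show ?thesis
    unfolding jk_basis_def
  proof (intro exI[of _ e] conjI allI impI ok)
    fix b b' i i' assume b: "b < length bs" "b' < length bs" "i < bdim (bs ! b)" "i' < bdim (bs ! b')"
    have l: "off bs b + i < n" "off bs b' + i' < n" using off_less b N by auto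
    show "F x (e b i) (e b' i') = (if b = b' then block_A (bs ! b) $$ (i, i') else 0)"
      unfolding e_def F3[OF l] PA by (rule diag_block_index[OF block_carrier(1) b])
    show "F a (e b i) (e b' i') = (if b = b' then block_B (bs ! b) $$ (i, i') else 0)"
      unfolding e_def F3[OF l] PB by (rule diag_block_index[OF block_carrier(2) b])
  next
    fix z :: "nat \<Rightarrow> complex"
    obtain Q where Q: "Q \<in> carrier_mat n n" "P * Q = 1\<^sub>m n"
      using det_nz_inverse[OF P(1) invertible_det[OF P]] by metis
    define w where "w = Q *\<^sub>v vec n z"
    have w: "w \<in> carrier_vec n" "P *\<^sub>v w = vec n z"
      using P Q assoc_mult_mat_vec[OF P(1) Q(1), of "vec n z"] unfolding w_def by auto
    show "\<exists>g. \<forall>p<n. z p = (\<Sum>b<length bs. \<Sum>i<bdim (bs ! b). g b i * e b i p)"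
    proof (intro exI allI impI)
      fix p assume p: "p < n"
      have "z p = (P *\<^sub>v w) $ p" using w(2) p by simp
      also have "\<dots> = (\<Sum>t<n. w $ t * P $$ (p, t))"
        using p P w(1) by (simp add: scalar_prod_def lessThan_atLeast0 mult.commute)
      also have "\<dots> = (\<Sum>b<length bs. \<Sum>i<bdim (bs ! b). w $ (off bs b + i) * e b i p)"
        unfolding N sum_blocks e_def by simp
      finally show "z p = (\<Sum>b<length bs. \<Sum>i<bdim (bs ! b). (\<lambda>b i. w $ (off bs b + i)) b i * e b i p)"
        by simp
    qed
  qed
qed

lemma jk_basis_rows:
  assumes e: "jk_basis x a bs e" and z: "\<forall>p<n. z p = (\<Sum>b<length bs. \<Sum>i<bdim (bs ! b). g b i * e b i p)"
    and b: "b < length bs" "i < bdim (bs ! b)"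
  shows "F x (e b i) z = rowA (bs ! b) i (g b)" and "F a (e b i) z = rowB (bs ! b) i (g b)"
proof -
  have ex: "F y (e b i) z = (\<Sum>b'<length bs. \<Sum>i'<bdim (bs ! b'). g b' i' * F y (e b i) (e b' i'))" for y
  proof -
    have "F y (e b i) z = F y (e b i) (\<lambda>p. \<Sum>b'<length bs. \<Sum>i'<bdim (bs ! b'). g b' i' * e b' i' p)"
      by (rule F_cong) (use z in auto)
    then show ?thesis by simp
  qed
  have bb: "F x (e b i) (e b' i') = (if b = b' then block_A (bs ! b) $$ (i, i') else 0)"
     "F a (e b i) (e b' i') = (if b = b' then block_B (bs ! b) $$ (i, i') else 0)"
    if "b' < length bs" "i' < bdim (bs ! b')" for b' i'
    using e b that unfolding jk_basis_def by blast+
  have "F x (e b i) z = (\<Sum>b'<length bs. if b' = b then rowA (bs ! b) i (g b) else 0)"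
    unfolding ex rowA_def by (intro sum.cong refl) (auto simp: bb mult.commute)
  then show "F x (e b i) z = rowA (bs ! b) i (g b)" using b by simp
  have "F a (e b i) z = (\<Sum>b'<length bs. if b' = b then rowB (bs ! b) i (g b) else 0)"
    unfolding ex rowB_def by (intro sum.cong refl) (auto simp: bb mult.commute)
  then show "F a (e b i) z = rowB (bs ! b) i (g b)" using b by simp
qed

text \<open>On the first half of a Jordan block the index rises along the chain, on the second half
  (\<open>jk_chain_upper\<close>) it falls. Padding by zeros makes every basis vector of a block
  with \<open>m' \<le> m\<close> the head of a chain of length \<open>m\<close>.\<close>

lemma jk_chain_lower:
  assumes e: "jk_basis x a bs e" and b: "b < length bs" "bs ! b = JK_Jordan (Some l) m'"
    and y: "y = (\<lambda>k. x k - l * a k)" and m: "m' \<le> m" and i: "i < m'"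
  shows "chain m y a (\<lambda>k. if i + k < m' then e b (i + k) else (\<lambda>p. 0))"
  unfolding chain_def
proof (intro conjI allI impI)
  fix k z assume "k < m"
  obtain g where g: "\<forall>p<n. z p = (\<Sum>b<length bs. \<Sum>i<bdim (bs ! b). g b i * e b i p)"
    using e unfolding jk_basis_def by blast
  have r: "F x (e b s) z = rowA (bs ! b) s (g b)" "F a (e b s) z = rowB (bs ! b) s (g b)" if "s < m'" for s
    using jk_basis_rows[OF e g b(1), of s] b(2) that by auto
  have Fy: "F y u z = F x u z - l * F a u z" for u unfolding y by (simp add: F_def)
  show "F y (if i + k < m' then e b (i + k) else (\<lambda>p. 0)) z =
     F a (if i + Suc k < m' then e b (i + Suc k) else (\<lambda>p. 0)) z"
    using row_jordan(1,2)[of "i + k" m' l "g b"] row_jordan(2)[of "i + Suc k" m' l "g b"]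
      r[of "i + k"] r[of "i + Suc k"] b(2) by (simp add: Fy)
qed (use m in auto)

lemma jk_chain_upper:
  assumes e: "jk_basis x a bs e" and b: "b < length bs" "bs ! b = JK_Jordan (Some l) m'"
    and y: "y = (\<lambda>k. x k - l * a k)" and m: "m' \<le> m" and i: "i < m'"
  shows "chain m y a (\<lambda>k. if k \<le> i then e b (m' + (i - k)) else (\<lambda>p. 0))"
  unfolding chain_def
proof (intro conjI allI impI)
  fix k z assume "k < m"
  obtain g where g: "\<forall>p<n. z p = (\<Sum>b<length bs. \<Sum>i<bdim (bs ! b). g b i * e b i p)"
    using e unfolding jk_basis_def by blast
  have r: "F x (e b (m' + s)) z = rowA (bs ! b) (m' + s) (g b)"
     "F a (e b (m' + s)) z = rowB (bs ! b) (m' + s) (g b)" if "s < m'" for s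
    using jk_basis_rows[OF e g b(1), of "m' + s"] b(2) that by auto
  have Fy: "F y u z = F x u z - l * F a u z" for u unfolding y by (simp add: F_def)
  show "F y (if k \<le> i then e b (m' + (i - k)) else (\<lambda>p. 0)) z =
     F a (if Suc k \<le> i then e b (m' + (i - Suc k)) else (\<lambda>p. 0)) z"
    using row_jordan(3,4)[of "i - k" m' l "g b"] row_jordan(4)[of "i - Suc k" m' l "g b"]
      r[of "i - k"] r[of "i - Suc k"] b(2) i by (auto simp: Fy not_le)
qed (use m i in auto)

text \<open>Jordan coordinates vanish for eigenvalues other than \<open>l\<close> by the kernel
  condition, and for \<open>l\<close> by orthogonality, since the form at \<open>a\<close> is
  nondegenerate on such a block; a Kronecker block keeps its first \<open>k\<close>
  coordinates.\<close>

lemma jk_kernel_coeffs: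
  assumes e: "jk_basis x a bs e" and noinf: "\<And>m. JK_Jordan None m \<notin> set bs"
    and ker: "\<And>z. F (\<lambda>k. x k - l * a k) \<xi> z = 0"
    and orth: "\<And>b m i. b < length bs \<Longrightarrow> bs ! b = JK_Jordan (Some l) m \<Longrightarrow> i < m + m \<Longrightarrow> F a (e b i) \<xi> = 0"
    and g: "\<forall>p<n. \<xi> p = (\<Sum>b<length bs. \<Sum>i<bdim (bs ! b). g b i * e b i p)"
    and b: "b < length bs" and i: "i < bdim (bs ! b)" "kdim (bs ! b) \<le> i"
  shows "g b i = 0"
proof -
  have row: "rowA (bs ! b) i (g b) - l * rowB (bs ! b) i (g b) = 0" if "i < bdim (bs ! b)" for i
  proof -
    have "F (\<lambda>k. x k - l * a k) (e b i) \<xi> = 0" using ker F_skew[of _ "e b i" \<xi>] by simp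
    then show ?thesis using jk_basis_rows[OF e g b that] by simp
  qed
  show ?thesis
  proof (cases "bs ! b")
    case (JK_Kronecker k)
    have "g b (k + (i - k)) = 0"
      by (rule kernel_kronecker[of k "g b" l]) (use row i JK_Kronecker in auto)
    then show ?thesis using i JK_Kronecker by simp
  next
    case (JK_Jordan mu m)
    then obtain \<mu> where mu: "mu = Some \<mu>" using noinf[of m] b nth_mem[OF b] by (cases mu) auto
    have ii: "i < m \<or> (\<exists>i'<m. i = m + i')" using i JK_Jordan by (simp) presburger
    show ?thesis
    proof (cases "\<mu> = l")
      case True
      have rb: "rowB (bs ! b) s (g b) = 0" if "s < m + m" for s
        using orth[OF b, of m s] jk_basis_rows(2)[OF e g b, of s] JK_Jordan mu True that by simp
      from ii show ?thesis
      proof (elim disjE exE conjE)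
        assume "i < m"
        then show ?thesis using rb[of "m + i"] row_jordan(4)[of i m \<mu> "g b"] JK_Jordan mu by simp
      next
        fix i' assume "i' < m" "i = m + i'"
        then show ?thesis using rb[of i'] row_jordan(2)[of i' m \<mu> "g b"] JK_Jordan mu by simp
      qed
    next
      case False
      have row': "\<And>i. i < m + m \<Longrightarrow> rowA (JK_Jordan (Some \<mu>) m) i (g b) - l * rowB (JK_Jordan (Some \<mu>) m) i (g b) = 0"
        using row JK_Jordan mu by simp
      from ii show ?thesis using kernel_jordan[OF row' False] by auto
    qed
  qed
qed

text \<open>The assumptions say that \<open>v + s v'\<close> is in the kernel of the form at \<open>x + s a\<close> for all \<open>s\<close>; such a
  linear family only involves Kronecker blocks of sizes one and three.\<close>

lemma linear_kernel_dependent: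
  assumes e: "jk_basis x a bs e" and noinf: "\<And>m. JK_Jordan None m \<notin> set bs"
    and K2: "2 \<notin># kronecker_ks bs" and K1: "count (kronecker_ks bs) 1 \<le> 1"
    and k1: "\<And>z. F x v z = 0" and k2: "\<And>z. F a v' z = 0" and k3: "\<And>z. F x v' z + F a v z = 0"
  shows "\<exists>s s'. (s \<noteq> 0 \<or> s' \<noteq> 0) \<and> (\<forall>p<n. s * v p + s' * v' p = 0)"
proof -
  obtain g where g: "\<forall>p<n. v p = (\<Sum>b<length bs. \<Sum>i<bdim (bs ! b). g b i * e b i p)"
    using e unfolding jk_basis_def by blast
  obtain g' where g': "\<forall>p<n. v' p = (\<Sum>b<length bs. \<Sum>i<bdim (bs ! b). g' b i * e b i p)"
    using e unfolding jk_basis_def by blast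
  have z: "g b i = 0 \<and> g' b i = 0" if b: "b < length bs" and ne: "bs ! b \<noteq> JK_Kronecker 1" and i: "i < bdim (bs ! b)" for b i
  proof -
    have r1: "rowA (bs ! b) i (g b) = 0" and r2: "rowB (bs ! b) i (g' b) = 0"
      and r3: "rowA (bs ! b) i (g' b) + rowB (bs ! b) i (g b) = 0" if "i < bdim (bs ! b)" for i
    proof -
      show "rowA (bs ! b) i (g b) = 0" using k1[of "e b i"] F_skew[of x v] jk_basis_rows(1)[OF e g b that] by simp
      show "rowB (bs ! b) i (g' b) = 0" using k2[of "e b i"] F_skew[of a v'] jk_basis_rows(2)[OF e g' b that] by simp
      have "F x (e b i) v' + F a (e b i) v = - (F x v' (e b i) + F a v (e b i))"
        by (simp add: F_skew[of x "e b i" v'] F_skew[of a "e b i" v])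
      then have "F x (e b i) v' + F a (e b i) v = 0" using k3[of "e b i"] by simp
      then show "rowA (bs ! b) i (g' b) + rowB (bs ! b) i (g b) = 0"
        using jk_basis_rows(1)[OF e g' b that] jk_basis_rows(2)[OF e g b that] by simp
    qed
    show ?thesis
    proof (cases "bs ! b")
      case (JK_Jordan mu m)
      then obtain \<mu> where mu: "mu = Some \<mu>" using noinf[of m] b nth_mem[OF b] by (cases mu) auto
      have bd: "bdim (bs ! b) = m + m" using JK_Jordan by simp
      \<comment> \<open>The form at \<open>a\<close> is nondegenerate on a Jordan block with finite
        eigenvalue: it kills \<open>v'\<close> first, then the mixed equation kills
        \<open>v\<close>.\<close>
      have gB: "h s = 0 \<and> h (m + s) = 0" if "\<And>s. s < m + m \<Longrightarrow> rowB (bs ! b) s h = 0" "s < m" for h s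
        using that(1)[of s] that(1)[of "m + s"] row_jordan(2,4)[OF that(2), of \<mu> h] that(2) JK_Jordan mu by simp
      have a: "g' b s = 0 \<and> g' b (m + s) = 0" if "s < m" for s
        by (rule gB) (use r2 bd that in auto)
      have g'0: "g' b s = 0" if "s < m + m" for s
        using a[of s] a[of "s - m"] that by (cases "s < m") auto
      have "rowA (bs ! b) s (g' b) = 0" if "s < m + m" for s
        unfolding rowA_def bd using g'0 by simp
      then have rB: "rowB (bs ! b) s (g b) = 0" if "s < m + m" for s
        using r3[of s] that bd by simp
      have a: "g b s = 0 \<and> g b (m + s) = 0" if "s < m" for s
        by (rule gB) (use rB that in auto)
      have "g b s = 0" if "s < m + m" for s
        using a[of s] a[of "s - m"] that by (cases "s < m") auto
      then show ?thesis using i bd g'0 by simp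
    next
      case (JK_Kronecker k)
      have "jk_block_ok (bs ! b)" using e nth_mem[OF b] unfolding jk_basis_def by blast
      moreover have "k \<noteq> 2" using K2 JK_Kronecker nth_mem[OF b] set_kronecker_ks[of 2 bs] by auto
      ultimately have k: "3 \<le> k" using JK_Kronecker ne by (cases "k = 0"; cases "k = 1") auto
      have bd: "bdim (bs ! b) = k + (k - 1)" using JK_Kronecker by simp
      have q: "g b (k + s) = 0 \<and> g' b (k + s) = 0" if s: "s < k - 1" for s
      proof
        show "g b (k + s) = 0" using r1[of s] row_kronecker(1)[of s k "g b"] s bd JK_Kronecker by simp
        show "g' b (k + s) = 0" using r2[of "Suc s"] row_kronecker(2)[of "Suc s" k "g' b"] s bd JK_Kronecker by simp
      qed
      have p1: "g b s = 0" if "s < k - 1" for s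
        using r1[of "k + s"] row_kronecker(3)[OF that, of "g b"] that bd JK_Kronecker by simp
      have p2: "g' b (Suc s) = 0" if "s < k - 1" for s
        using r2[of "k + s"] row_kronecker(4)[OF that, of "g' b"] that bd JK_Kronecker by simp
      have p3: "g' b s + g b (Suc s) = 0" if "s < k - 1" for s
      proof -
        have "k + s < bdim (bs ! b)" using that bd by simp
        from r3[OF this] have "- g' b s + - g b (Suc s) = 0"
          using row_kronecker(3)[OF that, of "g' b"] row_kronecker(4)[OF that, of "g b"] JK_Kronecker by simp
        then have "- (g' b s + g b (Suc s)) = 0" by simp
        then show ?thesis by (simp only: neg_equal_0_iff_equal)
      qed
      \<comment> \<open>By \<open>p1\<close> and \<open>p2\<close> only \<open>g b (k - 1)\<close>
        and \<open>g' b 0\<close> survive. The two ends of \<open>p3\<close> kill them separately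
        because \<open>k \<ge> 3\<close>; for \<open>k = 2\<close> the ends would be one equation
        with a nonzero solution.\<close>
      have "g' b 0 = 0" using p3[of 0] p1[of 1] k by simp
      then have gp: "g' b s = 0" if "s < k" for s using p2[of "s - 1"] that by (cases s) auto
      have "g b (Suc (k - 2)) = 0" using p3[of "k - 2"] gp[of "k - 2"] k by simp
      then have "g b (k - 1) = 0" 
      proof -
        have "Suc (k - 2) = k - 1" using k by simp
        with \<open>g b (Suc (k - 2)) = 0\<close> show ?thesis by simp
      qed
      then have gg: "g b s = 0" if "s < k" for s using p1[of s] that by (cases "s = k - 1") auto
      show ?thesis using i bd q[of "i - k"] gp[of i] gg[of i] by (cases "i < k") auto
    qed
  qed
  show ?thesis
  proof (cases "\<exists>b<length bs. bs ! b = JK_Kronecker 1")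
    case True
    then obtain b where b: "b < length bs" "bs ! b = JK_Kronecker 1" by blast
    have only: "b' = b" if "b' < length bs" "bs ! b' = JK_Kronecker 1" for b'
    proof (rule ccontr)
      assume ne: "b' \<noteq> b"
      have "count (kronecker_ks bs) 1 = length (filter ((=) (JK_Kronecker 1)) bs)"
      proof (induction bs)
        case (Cons x bs)
        then show ?case by (cases x) auto
      qed simp
      also have "\<dots> = card {i. i < length bs \<and> JK_Kronecker 1 = bs ! i}"
        by (rule length_filter_conv_card)
      finally have "card {i. i < length bs \<and> JK_Kronecker 1 = bs ! i} \<le> 1" using K1 by simp
      moreover have "card {b, b'} \<le> card {i. i < length bs \<and> JK_Kronecker 1 = bs ! i}"
        by (rule card_mono) (use b that in auto)
      ultimately show False using ne by simp
    qed
    have sumz: "(\<Sum>b<length bs. \<Sum>i<bdim (bs ! b). h b i * e b i p) = h b 0 * e b 0 p"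
      if h: "\<And>b i. b < length bs \<Longrightarrow> bs ! b \<noteq> JK_Kronecker 1 \<Longrightarrow> i < bdim (bs ! b) \<Longrightarrow> h b i = 0" for h p
    proof -
      have "(\<Sum>b<length bs. \<Sum>i<bdim (bs ! b). h b i * e b i p) = (\<Sum>b'<length bs. if b' = b then h b 0 * e b 0 p else 0)"
      proof (intro sum.cong refl)
        fix b' assume b': "b' \<in> {..<length bs}"
        show "(\<Sum>i<bdim (bs ! b'). h b' i * e b' i p) = (if b' = b then h b 0 * e b 0 p else 0)"
        proof (cases "b' = b")
          case True
          then show ?thesis using b by simp
        next
          case False
          then have "bs ! b' \<noteq> JK_Kronecker 1" using only b' by auto
          then show ?thesis using h[of b'] b' False by simp
        qed
      qed
      then show ?thesis using b by simp
    qed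
    \<comment> \<open>Both vectors are multiples of the vector of the only
      \<open>1 \<times> 1\<close> block, so crossing the coefficients gives a relation.\<close>
    have vp: "v p = g b 0 * e b 0 p" "v' p = g' b 0 * e b 0 p" if "p < n" for p
      using g g' that sumz[of g] sumz[of g'] z by auto
    show ?thesis
    proof (cases "g b 0 = 0 \<and> g' b 0 = 0")
      case True
      then show ?thesis using vp by (intro exI[of _ 1]) auto
    next
      case False
      then show ?thesis using vp by (intro exI[of _ "g' b 0"] exI[of _ "- g b 0"]) auto
    qed
  next
    case False
    then have "v p = 0" if "p < n" for p using g that z by auto
    then show ?thesis by (intro exI[of _ 1] exI[of _ 0]) auto
  qed
qed

end

section \<open>Eigenvalues of unique Jordan tuples\<close>

text \<open>Once the eigenvalue is a linear form in the point, minors of the truncated pencil become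
  polynomial in the point alone.\<close>

lemma bi_funs_comp:
  assumes f: "f \<in> bi_funs" and g: "g \<in> polynomial_funs"
  shows "(\<lambda>x. f (x, g x)) \<in> polynomial_funs"
proof -
  obtain h where h: "\<And>x l. f (x, l) = ev h x l" using f unfolding bi_funs_def by blast
  have "(\<lambda>x. ev h x (g x)) \<in> polynomial_funs"
  proof (induction h)
    case 0 then show ?case using PF.const[of 0] by simp
  next
    case (pCons p h)
    then show ?case using PF.add[OF app PF.mult[OF g pCons.IH]] by simp
  qed
  then show ?thesis using h by simp
qed

lemma poly_fun_left: "p \<in> poly_fun n \<Longrightarrow> (\<lambda>x. p (vec n x, v)) \<in> polynomial_funs"
proof (induction rule: poly_fun.induct)
  case (coord1 i)
  have *: "(\<lambda>x. case (vec n x, v) of (x, a) \<Rightarrow> x $ i) = (\<lambda>x. x i)" using coord1 by auto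
  show ?case unfolding * by (rule polynomial_funs.coord)
qed (auto intro: PF.const PF.add PF.mult)

lemma poly_fun_right: "p \<in> poly_fun n \<Longrightarrow> (\<lambda>x. p (v, vec n x)) \<in> polynomial_funs"
proof (induction rule: poly_fun.induct)
  case (coord2 i)
  have *: "(\<lambda>x. case (v, vec n x) of (x, a) \<Rightarrow> a $ i) = (\<lambda>x. x i)" using coord2 by auto
  show ?case unfolding * by (rule polynomial_funs.coord)
qed (auto intro: PF.const PF.add PF.mult)

lemma cork_le: "cork T d \<Longrightarrow> T \<in> carrier_mat N N \<Longrightarrow> d \<le> N"
  unfolding cork_def by auto

lemma toep_1: "M \<in> carrier_mat n n \<Longrightarrow> toep 1 M = map_mat (\<lambda>p. coeff p 0) M"
  by (intro eq_matI) (auto simp: toep_def)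

context lie
begin

lemma A_poly: "i < n \<Longrightarrow> j < n \<Longrightarrow> (\<lambda>x. A x $$ (i, j)) \<in> polynomial_funs"
  by (simp add: A_index) (intro PF.sum PF.mult PF.const polynomial_funs.coord)

lemma det_A_poly:
  "X \<in> carrier_mat k n \<Longrightarrow> Y \<in> carrier_mat n k \<Longrightarrow> (\<lambda>x. det (X * A x * Y)) \<in> polynomial_funs"
  by (rule PF.det_mult3[of _ n n]) (auto intro: A_poly)

lemma toep_bi:
  assumes X: "X \<in> carrier_mat k (n * m)" and Y: "Y \<in> carrier_mat (n * m) k" and m: "0 < m"
  shows "(\<lambda>(x, l). det (X * toep m (lpencil (A x) (A a) l) * Y)) \<in> bi_funs"
proof -
  have "(\<lambda>v. det (X * toep m (lpencil (A (fst v)) (A a) (snd v)) * Y)) \<in> bi_funs"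
  proof (rule BF.det_mult3[OF _ X Y])
    show "toep m (lpencil (A (fst v)) (A a) (snd v)) \<in> carrier_mat (n * m) (n * m)" for v by simp
    fix p q assume pq: "p < n * m" "q < n * m"
    then have d: "p div m < n" "q div m < n" using m by (auto simp: div_less_iff)
    have lc: "lpencil (A x) (A a) l \<in> carrier_mat n n" for x l by simp
    have li: "lpencil (A x) (A a) l $$ (p div m, q div m) =
      [:A x $$ (p div m, q div m) - l * A a $$ (p div m, q div m), A a $$ (p div m, q div m):]" for x l
      using d by (simp add: lpencil_def)
    let ?d = "p mod m - q mod m"
    have fs: "(\<lambda>v. A (fst v) $$ (p div m, q div m)) \<in> bi_funs"
      using bi_funs_fst[OF A_poly[OF d]] by (simp add: case_prod_unfold)
    have sn: "(\<lambda>v. snd v) \<in> bi_funs" using bi_funs_snd by (simp add: case_prod_unfold)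
    show "(\<lambda>v. toep m (lpencil (A (fst v)) (A a) (snd v)) $$ (p, q)) \<in> bi_funs"
    proof (cases "q mod m \<le> p mod m")
      case True
      show ?thesis
      proof (cases ?d)
        case 0
        have "(\<lambda>v. toep m (lpencil (A (fst v)) (A a) (snd v)) $$ (p, q)) =
          (\<lambda>v. A (fst v) $$ (p div m, q div m) - snd v * A a $$ (p div m, q div m))"
          using True 0 by (simp add: toep_index[OF lc pq] li)
        then show ?thesis using BF.diff[OF fs BF.mult[OF sn BF.const]] by simp
      next
        case (Suc k)
        have "(\<lambda>v. toep m (lpencil (A (fst v)) (A a) (snd v)) $$ (p, q)) =
          (\<lambda>v. coeff [:A a $$ (p div m, q div m):] k)"
          using True Suc by (simp add: toep_index[OF lc pq] li)
        then show ?thesis using BF.const by simp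
      qed
    next
      case False
      then show ?thesis using BF.const[of 0] by (simp add: toep_index[OF lc pq])
    qed
  qed
  then show ?thesis by (simp add: case_prod_unfold)
qed

lemma toep_1_lpencil: "toep 1 (lpencil (A x) (A a) l) = A (\<lambda>k. x k - l * a k)"
  by (subst toep_1[of _ n], simp) (intro eq_matI, auto simp: lpencil_def A_lin)

end

text \<open>\<open>a\<close> is a fixed generic point and \<open>w0\<close> a polynomial whose
  nonvanishing marks the good points \<open>x\<close>. The minor given by \<open>X\<close> and
  \<open>Y\<close> has the rank of a regular form as its size and certifies that \<open>a\<close> is
  regular.\<close>

locale lie_jk = lie +
  fixes a :: "nat \<Rightarrow> complex" and w0 :: mfun and bs :: "(nat \<Rightarrow> complex) \<Rightarrow> jk_block list"
    and e :: "(nat \<Rightarrow> complex) \<Rightarrow> nat \<Rightarrow> nat \<Rightarrow> nat \<Rightarrow> complex"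
    and K :: "nat multiset" and JT :: "nat multiset multiset" and X Y :: "complex mat"
  assumes w0: "w0 \<noteq> 0"
    and basis: "app w0 x \<noteq> 0 \<Longrightarrow> jk_basis x a (bs x) (e x)"
    and dec: "app w0 x \<noteq> 0 \<Longrightarrow> jk_decomposition n (A x) (A a) (bs x)"
    and K: "app w0 x \<noteq> 0 \<Longrightarrow> kronecker_ks (bs x) = K"
    and JT: "app w0 x \<noteq> 0 \<Longrightarrow> jordan_tuples (bs x) = JT"
    and K_cond: "2 \<notin># K" "count K 1 \<le> 1"
    and size_K: "size K \<le> n"
    and X: "X \<in> carrier_mat (n - size K) n" and Y: "Y \<in> carrier_mat n (n - size K)"
    and a_reg: "det (X * A a * Y) \<noteq> 0"
begin

text \<open>A block with eigenvalue infinity would raise the corank of the form at \<open>a\<close>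
  above the number of Kronecker blocks.\<close>

lemma no_None:
  assumes x: "app w0 x \<noteq> 0" shows "JK_Jordan None m \<notin> set (bs x)"
proof -
  have "cork (A a) (size K + 2 * size (jtuple (bs x) None))"
    using jk_decomposition_cork(2)[OF dec[OF x]] by (simp add: sum_list_lossB K[OF x])
  moreover have "rk_ge (A a) (n - size K)" using X Y a_reg unfolding rk_ge_def by auto
  ultimately have "jtuple (bs x) None = {#}" using cork_rk[of "A a" _ n "n - size K"] size_K by (simp add: size_eq_0_iff_empty)
  then show ?thesis using set_jtuple[of m "bs x" None] by simp
qed

definition D :: "nat \<Rightarrow> nat multiset \<Rightarrow> nat" where
  "D j t = j * size K + 2 * (\<Sum>m\<in>#t. min m j)"

lemma cork_D:
  assumes x: "app w0 x \<noteq> 0" and j: "0 < j"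
  shows "cork (toep j (lpencil (A x) (A a) l)) (D j (jtuple (bs x) (Some l)))"
  using jk_decomposition_cork(1)[OF dec[OF x] _ _ j, of l] by (simp add: sum_list_loss K[OF x] D_def)

lemma rk_D:
  assumes x: "app w0 x \<noteq> 0" and j: "0 < j"
  shows "rk_ge (toep j (lpencil (A x) (A a) l)) k \<longleftrightarrow> k + D j (jtuple (bs x) (Some l)) \<le> n * j"
    and "D j (jtuple (bs x) (Some l)) \<le> n * j"
proof -
  have T: "toep j (lpencil (A x) (A a) l) \<in> carrier_mat (n * j) (n * j)" by simp
  show "rk_ge (toep j (lpencil (A x) (A a) l)) k \<longleftrightarrow> k + D j (jtuple (bs x) (Some l)) \<le> n * j"
    by (rule cork_rk[OF cork_D[OF x j] T])
  show "D j (jtuple (bs x) (Some l)) \<le> n * j" by (rule cork_le[OF cork_D[OF x j] T])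
qed

text \<open>Strictly above all parts, as \<open>multiset_eq_if_min_sums\<close> demands; the
  inserted 0 keeps the maximum defined when there are no Jordan blocks.\<close>

definition J :: nat where
  "J = Suc (Max (insert 0 (\<Union>t\<in>set_mset JT. set_mset t)))"

lemma J: "t \<in># JT \<Longrightarrow> m \<in># t \<Longrightarrow> m < J"
proof -
  assume "t \<in># JT" "m \<in># t"
  then have "m \<in> insert 0 (\<Union>t\<in>set_mset JT. set_mset t)" by blast
  then show ?thesis unfolding J_def by (meson Max_ge finite_UN_I finite_insert finite_set_mset le_imp_less_Suc)
qed

lemma jtuple_JT: "app w0 x \<noteq> 0 \<Longrightarrow> jtuple (bs x) mu \<noteq> {#} \<Longrightarrow> jtuple (bs x) mu \<in># JT"
  using JT[of x] finite_jordan_eigenvalues[of "bs x"] jordan_eigenvalues_iff[of mu "bs x"]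
  unfolding jordan_tuples_eq by auto

lemma jtuple_bounds:
  assumes x: "app w0 x \<noteq> 0"
  shows "\<forall>m\<in>#jtuple (bs x) mu. 0 < m \<and> m < J"
proof
  fix m assume m: "m \<in># jtuple (bs x) mu"
  then have "JK_Jordan mu m \<in> set (bs x)" by (simp add: set_jtuple)
  then have "jk_block_ok (JK_Jordan mu m)" using basis[OF x] unfolding jk_basis_def by blast
  moreover have "jtuple (bs x) mu \<noteq> {#}" using m by auto
  then have "m < J" using J[OF jtuple_JT[OF x] m] by simp
  ultimately show "0 < m \<and> m < J" by simp
qed

definition um :: "nat multiset \<Rightarrow> bool" where
  "um t \<longleftrightarrow> t \<in># JT \<and> count JT t = 1 \<and> multiple_maxima t"

lemma um_ne: "um t \<Longrightarrow> t \<noteq> {#}"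
  unfolding um_def multiple_maxima_def by auto

text \<open>The multiplicity of \<open>t\<close> among the tuples is the number of eigenvalues that
  carry it, and \<open>no_None\<close> makes the only one finite.\<close>

lemma um_ex1:
  assumes x: "app w0 x \<noteq> 0" and t: "um t"
  shows "\<exists>!l. jtuple (bs x) (Some l) = t"
proof -
  let ?E = "jordan_eigenvalues (bs x)"
  have fE: "finite ?E" by (rule finite_jordan_eigenvalues)
  have "count JT t = card (jtuple (bs x) -` {t} \<inter> ?E)"
    using fE unfolding JT[OF x, symmetric] jordan_tuples_eq count_image_mset by simp
  then have "card (jtuple (bs x) -` {t} \<inter> ?E) = 1" using t unfolding um_def by simp
  then obtain mu where mu: "jtuple (bs x) -` {t} \<inter> ?E = {mu}" by (rule card_1_singletonE)
  have mem: "\<nu> \<in> ?E \<and> jtuple (bs x) \<nu> = t \<longleftrightarrow> \<nu> = mu" for \<nu>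
    using mu[unfolded set_eq_iff, rule_format, of \<nu>] by auto
  have "None \<notin> ?E" using no_None[OF x] unfolding jordan_eigenvalues_def by simp
  then have "mu \<noteq> None" using mem[of mu] by metis
  then obtain l where l: "mu = Some l" by auto
  show ?thesis
  proof (rule ex1I[of _ l])
    show "jtuple (bs x) (Some l) = t" using mem[of mu] l by simp
    fix l' assume l': "jtuple (bs x) (Some l') = t"
    then have "Some l' \<in> ?E" using um_ne[OF t] jordan_eigenvalues_iff by simp
    then have "Some l' = mu" using mem[of "Some l'"] l' by simp
    then show "l' = l" using l by simp
  qed
qed

definition mu :: "nat multiset \<Rightarrow> (nat \<Rightarrow> complex) \<Rightarrow> complex" where
  "mu t x = (THE l. jtuple (bs x) (Some l) = t)"

lemma mu_iff: "app w0 x \<noteq> 0 \<Longrightarrow> um t \<Longrightarrow> jtuple (bs x) (Some l) = t \<longleftrightarrow> l = mu t x"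
  using theI'[OF um_ex1, of x t] um_ex1[of x t] unfolding mu_def by blast

lemma mu_eqI:
  assumes x: "app w0 x \<noteq> 0" and t: "um t"
    and D: "\<And>j. 0 < j \<Longrightarrow> j \<le> J \<Longrightarrow> D j t \<le> n * j"
    and ge: "\<And>j. 0 < j \<Longrightarrow> j \<le> J \<Longrightarrow> rk_ge (toep j (lpencil (A x) (A a) l)) (n * j - D j t)"
    and le: "\<And>j. 0 < j \<Longrightarrow> j \<le> J \<Longrightarrow> \<not> rk_ge (toep j (lpencil (A x) (A a) l)) (Suc (n * j - D j t))"
  shows "l = mu t x"
proof -
  have "jtuple (bs x) (Some l) = t"
  proof (rule multiset_eq_if_min_sums[where J = J])
    fix j assume j: "0 < j" "j \<le> J"
    have "D j (jtuple (bs x) (Some l)) = D j t"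
      using ge[OF j] le[OF j] D[OF j] rk_D[OF x j(1), of l] by simp
    then show "(\<Sum>m\<in>#jtuple (bs x) (Some l). min m j) = (\<Sum>m\<in>#t. min m j)" unfolding D_def by linarith
  next
    show "\<forall>m\<in>#jtuple (bs x) (Some l). 0 < m \<and> m < J" by (rule jtuple_bounds[OF x])
    have "jtuple (bs x) (Some (mu t x)) = t" using mu_iff[OF x t] by simp
    then show "\<forall>m\<in>#t. 0 < m \<and> m < J" using jtuple_bounds[OF x, of "Some (mu t x)"] by simp
  qed
  then show ?thesis using mu_iff[OF x t] by simp
qed

text \<open>Over a generic point every root of the minimal equation has the truncated ranks of
  \<open>mu t x\<close>, hence the tuple \<open>t\<close>; uniqueness then makes the root single,
  the degree one and the eigenvalue a fraction.\<close>

lemma linear_eigenvalue: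
  assumes t: "um t"
  shows "\<exists>\<xi> w. w \<noteq> 0 \<and> pair a \<xi> = 1 \<and> (\<forall>x. app w x \<noteq> 0 \<longrightarrow> app w0 x \<noteq> 0 \<and> mu t x = pair x \<xi>)"
proof -
  let ?\<rho> = "n - size K"
  let ?T = "\<lambda>j x l. toep j (lpencil (A x) (A a) l)"
  define W where "W = {x \<in> UNIV. app w0 x \<noteq> 0}"
  have W: "zdense W" unfolding W_def by (rule zdense_open[OF zdense_UNIV w0])
  have tup: "jtuple (bs x) (Some (mu t x)) = t" if "x \<in> W" for x
    using mu_iff[of x t] that t unfolding W_def by simp
  have XY1: "X \<in> carrier_mat ?\<rho> (n * 1)" "Y \<in> carrier_mat (n * 1) ?\<rho>" using X Y by auto
  \<comment> \<open>One minor of the pencil supplies an equation for the eigenvalue. It is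
    nontrivial by \<open>a_reg\<close> (take \<open>x = a\<close>, \<open>l = 0\<close>) and
    vanishes at \<open>mu t x\<close> because a Jordan block raises the corank beyond
    \<open>size K\<close>.\<close>
  obtain E where E: "\<And>x l. det (X * ?T 1 x l * Y) = ev E x l"
    using toep_bi[OF XY1, of a] unfolding bi_funs_def by auto
  have E0: "E \<noteq> 0"
  proof
    assume "E = 0"
    then have "det (X * ?T 1 a 0 * Y) = 0" using E by simp
    then show False using a_reg unfolding toep_1_lpencil by simp
  qed
  have Ev: "ev E x (mu t x) = 0" if x: "x \<in> W" for x
  proof (rule ccontr)
    assume "ev E x (mu t x) \<noteq> 0"
    then have "rk_ge (?T 1 x (mu t x)) ?\<rho>"
      using X Y unfolding rk_ge_def E[symmetric] by (intro exI[of _ X] exI[of _ Y]) simp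
    then have "?\<rho> + D 1 t \<le> n" using rk_D(1)[of x 1 "mu t x" ?\<rho>] x tup[OF x] unfolding W_def by simp
    then have "(\<Sum>m\<in>#t. min m 1) = 0" using size_K unfolding D_def by simp
    moreover obtain m where m: "m \<in># t" using um_ne[OF t] by (meson multiset_nonemptyE)
    moreover have "0 < m" using jtuple_bounds[of x "Some (mu t x)"] x tup[OF x] m unfolding W_def by auto
    ultimately show False by (auto simp: sum_mset_0_iff)
  qed
  obtain g W' where W': "W' \<subseteq> W" and mr: "minimal_root g W' (mu t)"
    using minimal_root_exists[OF W E0 Ev] by blast
  interpret minimal_root g W' "mu t" by fact
  have g0: "g \<noteq> 0" using deg by auto
  obtain x1 where x1: "x1 \<in> W'" "app (lead_coeff g) x1 \<noteq> 0"
    using zdense_ne[OF zdense_open[OF dense, of "lead_coeff g"]] g0 by auto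
  have DW: "D j t \<le> n * j" if "0 < j" for j
    using rk_D(2)[of x1 j "mu t x1"] x1 W' tup that unfolding W_def by auto
  \<comment> \<open>A nonzero minor at the single point \<open>x1\<close> suffices: by
    \<open>vanishing\<close> it cannot vanish densely at \<open>mu t\<close>, and
    \<open>nonvanishing\<close> spreads it to all roots over an open set.\<close>
  have "\<exists>c. c \<noteq> 0 \<and> (\<forall>x l. app c x \<noteq> 0 \<longrightarrow> ev g x l = 0 \<longrightarrow> rk_ge (?T j x l) (n * j - D j t))" if j: "0 < j" for j
  proof -
    have "rk_ge (?T j x1 (mu t x1)) (n * j - D j t)"
      using rk_D(1)[of x1 j "mu t x1"] x1 W' tup j DW[OF j] unfolding W_def by auto
    then obtain X' Y' where XY': "X' \<in> carrier_mat (n * j - D j t) (n * j)" "Y' \<in> carrier_mat (n * j) (n * j - D j t)"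
      and nz: "det (X' * ?T j x1 (mu t x1) * Y') \<noteq> 0" unfolding rk_ge_def by auto
    obtain h where h: "\<And>x l. det (X' * ?T j x l * Y') = ev h x l"
      using toep_bi[OF XY' j, of a] unfolding bi_funs_def by auto
    have "\<not> zdense {x\<in>W'. ev h x (mu t x) = 0}"
    proof
      assume z: "zdense {x\<in>W'. ev h x (mu t x) = 0}"
      have "ev h x1 (mu t x1) = 0"
        by (rule vanishing[OF z _ _ x1(2) root[OF x1(1)]]) auto
      then show False using nz h by simp
    qed
    from nonvanishing[OF this] obtain c where c: "c \<noteq> 0" "\<And>x l. app c x \<noteq> 0 \<Longrightarrow> ev g x l = 0 \<Longrightarrow> ev h x l \<noteq> 0"
      by blast
    show ?thesis
    proof (intro exI[of _ c] conjI allI impI c(1))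
      fix x l assume "app c x \<noteq> 0" "ev g x l = 0"
      then have "det (X' * ?T j x l * Y') \<noteq> 0" using c(2) h by simp
      then show "rk_ge (?T j x l) (n * j - D j t)" unfolding rk_ge_def using XY' by auto
    qed
  qed
  then obtain cj where cj: "\<And>j. 0 < j \<Longrightarrow> cj j \<noteq> 0"
    "\<And>j x l. 0 < j \<Longrightarrow> app (cj j) x \<noteq> 0 \<Longrightarrow> ev g x l = 0 \<Longrightarrow> rk_ge (?T j x l) (n * j - D j t)" by metis
  \<comment> \<open>Larger minors vanish at \<open>mu t\<close> on all of \<open>W'\<close>, hence
    at every root of \<open>g\<close>.\<close>
  have upper: "\<not> rk_ge (?T j x l) (Suc (n * j - D j t))"
    if j: "0 < j" and x: "app (lead_coeff g) x \<noteq> 0" and l: "ev g x l = 0" for j x l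
  proof
    assume "rk_ge (?T j x l) (Suc (n * j - D j t))"
    then obtain X' Y' where XY': "X' \<in> carrier_mat (Suc (n * j - D j t)) (n * j)" "Y' \<in> carrier_mat (n * j) (Suc (n * j - D j t))"
      and nz: "det (X' * ?T j x l * Y') \<noteq> 0" unfolding rk_ge_def by auto
    obtain h where h: "\<And>x l. det (X' * ?T j x l * Y') = ev h x l"
      using toep_bi[OF XY' j, of a] unfolding bi_funs_def by auto
    have van: "ev h z (mu t z) = 0" if z: "z \<in> W'" for z
    proof (rule ccontr)
      assume "ev h z (mu t z) \<noteq> 0"
      then have "rk_ge (?T j z (mu t z)) (Suc (n * j - D j t))"
        using XY' unfolding rk_ge_def h[symmetric] by (intro exI[of _ X'] exI[of _ Y']) simp
      then show False using rk_D(1)[of z j "mu t z"] z W' tup j DW[OF j] unfolding W_def by auto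
    qed
    have "ev h x l = 0" by (rule vanishing[OF dense _ van x l]) auto
    then show False using nz h by simp
  qed
  \<comment> \<open>Only \<open>j\<close> up to \<open>J\<close> matter, so finitely many open
    conditions are multiplied.\<close>
  define e where "e = w0 * lead_coeff g * (\<Prod>j\<in>{1..J}. cj j)"
  have e0: "e \<noteq> 0" unfolding e_def using w0 g0 cj(1) by simp
  have app_prod: "app (prod f S) x = (\<Prod>j\<in>S. app (f j) x)" for f :: "nat \<Rightarrow> mfun" and S x
    by (induction S rule: infinite_finite_induct) auto
  have uniq: "l = mu t x" if "app e x \<noteq> 0" "ev g x l = 0" for x l
  proof -
    have x: "app w0 x \<noteq> 0" "app (lead_coeff g) x \<noteq> 0" "\<And>j. 0 < j \<Longrightarrow> j \<le> J \<Longrightarrow> app (cj j) x \<noteq> 0"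
      using that(1) unfolding e_def by (auto simp: app_prod)
    show ?thesis
      by (rule mu_eqI[OF x(1) t DW cj(2)[OF _ x(3) that(2)] upper[OF _ x(2) that(2)]])
  qed
  have "degree g = 1" by (rule unique_root_degree[OF e0 uniq])
  then obtain p0 q where g: "g = [:p0, q:]" "q \<noteq> 0" by (rule degree1_coeffs)
  define p where "p = - p0"
  have gx: "ev g x l = 0 \<longleftrightarrow> app p x = app q x * l" for x l
  proof -
    have "ev g x l = app q x * l - app p x" by (simp add: g(1) p_def algebra_simps)
    then show ?thesis by auto
  qed
  interpret L: linear_pencil n c a ?\<rho> X Y by unfold_locales (rule X Y)+
  have Lp: "L.pdet 1 l x = det (X * A (\<lambda>k. x k - l * a k) * Y)" for l x
  proof -
    have "mat n n (\<lambda>(i, j). 1 * L.form x i j - l * L.form a i j) = A (\<lambda>k. x k - l * a k)"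
      by (intro eq_matI) (auto simp: A_lin A_index L.form_def)
    then show ?thesis unfolding L.pdet_def by simp
  qed
  interpret LR: linear_root n c a ?\<rho> X Y p q
  proof
    show "q \<noteq> 0" by (rule g(2))
    show "L.pdet 1 0 a \<noteq> 0" using a_reg unfolding Lp by simp
    fix x
    have "(\<lambda>x. L.pdet (app q x) (app p x) x) \<in> polynomial_funs"
      unfolding L.pdet_def
    proof (rule PF.det_mult3[OF _ X Y])
      fix i j assume "i < n" "j < n"
      then show "(\<lambda>x. mat n n (\<lambda>(i, j). app q x * L.form x i j - app p x * L.form a i j) $$ (i, j)) \<in> polynomial_funs"
        by (simp add: L.form_def) (intro PF.diff PF.mult PF.sum PF.const app polynomial_funs.coord)
    qed simp
    then obtain d where d: "\<forall>x. app d x = L.pdet (app q x) (app p x) x" using ex_mfun by blast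
    have "app d x = 0" if x: "x \<in> W'" for x
    proof -
      have "app p x = app q x * mu t x" using root[OF x] gx by simp
      then have "app d x = L.pdet (app q x * 1) (app q x * mu t x) x" using d by simp
      also have "\<dots> = app q x ^ ?\<rho> * L.pdet 1 (mu t x) x" by (rule L.pdet_scale)
      also have "L.pdet 1 (mu t x) x = 0"
        using Ev[of x] x W' E[of x "mu t x"] unfolding Lp toep_1_lpencil by auto
      finally show ?thesis by simp
    qed
    then have "d = 0" using dense unfolding zdense_def by blast
    then show "L.pdet (app q x) (app p x) x = 0" using d by simp
  qed
  obtain \<xi> where \<xi>: "\<And>x. app p x = app q x * (\<Sum>k<n. x k * \<xi> k)" "(\<Sum>k<n. a k * \<xi> k) = 1"
    using LR.linear by blast
  show ?thesis
  proof (intro exI[of _ \<xi>] exI[of _ "e * q"] conjI allI impI)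
    show "e * q \<noteq> 0" using e0 g(2) by simp
    show "pair a \<xi> = 1" using \<xi>(2) by (simp add: pair_def)
    fix x assume "app (e * q) x \<noteq> 0"
    then have x: "app e x \<noteq> 0" "app q x \<noteq> 0" by auto
    then show "app w0 x \<noteq> 0" unfolding e_def by auto
    have "ev g x (pair x \<xi>) = 0" unfolding gx using \<xi>(1)[of x] by (simp add: pair_def)
    then show "mu t x = pair x \<xi>" using uniq[OF x(1)] by simp
  qed
qed

end

section \<open>Counting semi-invariants\<close>

lemma two_indices:
  "2 \<le> count (mset xs) y \<Longrightarrow> \<exists>i j. i \<noteq> j \<and> i < length xs \<and> j < length xs \<and> xs ! i = y \<and> xs ! j = y"
proof (induction xs)
  case (Cons x xs)
  show ?case
  proof (cases "x = y")
    case True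
    then have "0 < count (mset xs) y" using Cons.prems by simp
    then have "y \<in> set xs" by simp
    then obtain j where "j < length xs" "xs ! j = y" by (auto simp: in_set_conv_nth)
    then show ?thesis using True by (intro exI[of _ 0] exI[of _ "Suc j"]) simp
  next
    case False
    then have "2 \<le> count (mset xs) y" using Cons.prems by simp
    from Cons.IH[OF this] obtain i j where "i \<noteq> j" "i < length xs" "j < length xs" "xs ! i = y" "xs ! j = y" by blast
    then show ?thesis by (intro exI[of _ "Suc i"] exI[of _ "Suc j"]) simp
  qed
qed simp

context lie
begin

lemma pair_poly: "(\<lambda>x. pair x u) \<in> polynomial_funs"
  unfolding pair_def by (intro PF.sum PF.mult PF.const polynomial_funs.coord)

lemma F_poly: "(\<lambda>x. F x u v) \<in> polynomial_funs"
  unfolding F_def by (rule pair_poly)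

lemma br_cong: "(\<And>p. p < n \<Longrightarrow> u p = u' p) \<Longrightarrow> br u v = br u' v"
  by (simp add: br_def)

lemma pair_unit: "p < n \<Longrightarrow> pair (\<lambda>q. if q = p then 1 else 0) u = u p"
proof -
  assume p: "p < n"
  have "pair (\<lambda>q. if q = p then 1 else 0) u = (\<Sum>q<n. if q = p then u q else 0)"
    unfolding pair_def by (intro sum.cong) auto
  then show ?thesis using p by simp
qed

text \<open>Common eigenvectors for distinct weights: bracketing a relation with \<open>z\<close>
  and subtracting \<open>\<chi> s z\<close> times it eliminates the vector of
  \<open>s\<close>.\<close>

lemma weight_vectors_independent:
  assumes "finite S"
    and w: "\<And>t x z. t \<in> S \<Longrightarrow> F x (\<xi> t) z = pair x (\<xi> t) * \<chi> t z"
    and ne: "\<And>t. t \<in> S \<Longrightarrow> \<exists>p<n. \<xi> t p \<noteq> 0"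
    and dist: "\<And>t t'. t \<in> S \<Longrightarrow> t' \<in> S \<Longrightarrow> t \<noteq> t' \<Longrightarrow> \<exists>z. \<chi> t z \<noteq> \<chi> t' z"
    and z: "\<forall>p<n. (\<Sum>t\<in>S. v t * \<xi> t p) = 0"
  shows "\<forall>t\<in>S. v t = 0"
  using assms
proof (induction S arbitrary: v rule: finite_induct)
  case (insert s S)
  have b: "br (\<xi> t) z p = \<chi> t z * \<xi> t p" if "t \<in> insert s S" "p < n" for t z p
    using insert.prems(1)[OF that(1), of "\<lambda>q. if q = p then 1 else 0" z] pair_unit[OF that(2)]
    unfolding F_def by simp
  have "v t = 0" if t: "t \<in> S" for t
  proof -
    have "\<exists>z. \<chi> t z \<noteq> \<chi> s z" using insert.prems(3)[of t s] t insert.hyps by auto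
    then obtain z where zz: "\<chi> t z \<noteq> \<chi> s z" by blast
    have "\<forall>t\<in>S. v t * (\<chi> t z - \<chi> s z) = 0"
    proof (rule insert.IH)
      show "\<forall>p<n. (\<Sum>t\<in>S. v t * (\<chi> t z - \<chi> s z) * \<xi> t p) = 0"
      proof (intro allI impI)
        fix p assume p: "p < n"
        have "br (\<lambda>p. \<Sum>t\<in>insert s S. v t * \<xi> t p) z = br (\<lambda>p. 0) z"
          by (rule br_cong) (use insert.prems(4) in auto)
        then have "(\<Sum>t\<in>insert s S. v t * br (\<xi> t) z p) = 0"
          unfolding br_left by (rule fun_cong)
        moreover have "(\<Sum>t\<in>insert s S. v t * br (\<xi> t) z p) = (\<Sum>t\<in>insert s S. v t * (\<chi> t z * \<xi> t p))"
          by (intro sum.cong refl) (simp only: b[OF _ p])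
        ultimately have 1: "(\<Sum>t\<in>insert s S. v t * (\<chi> t z * \<xi> t p)) = 0" by simp
        have 2: "(\<Sum>t\<in>insert s S. v t * \<xi> t p) = 0" using insert.prems(4) p by blast
        have "(\<Sum>t\<in>insert s S. v t * (\<chi> t z * \<xi> t p)) - \<chi> s z * (\<Sum>t\<in>insert s S. v t * \<xi> t p) = 0"
          unfolding 1 2 by simp
        moreover have "(\<Sum>t\<in>insert s S. v t * (\<chi> t z * \<xi> t p)) - \<chi> s z * (\<Sum>t\<in>insert s S. v t * \<xi> t p)
            = (\<Sum>t\<in>insert s S. v t * (\<chi> t z - \<chi> s z) * \<xi> t p)"
          unfolding sum_distrib_left sum_subtractf[symmetric] by (intro sum.cong refl) (simp add: algebra_simps)
        ultimately show "(\<Sum>t\<in>S. v t * (\<chi> t z - \<chi> s z) * \<xi> t p) = 0"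
          using insert.hyps by simp
      qed
    qed (use insert.prems in auto)
    then show ?thesis using zz t by auto
  qed
  moreover have "v s = 0"
  proof -
    obtain p where p: "p < n" "\<xi> s p \<noteq> 0" using insert.prems(2) by blast
    have "(\<Sum>t\<in>insert s S. v t * \<xi> t p) = 0" using insert.prems(4) p by blast
    then have "v s * \<xi> s p = 0" using insert.hyps calculation by simp
    then show ?thesis using p by simp
  qed
  ultimately show ?case by simp
qed simp

end

context lie_jk
begin

text \<open>The two last conditions are the input of \<open>jk_kernel_coeffs\<close>, which leaves
  \<open>\<xi>\<close> only Kronecker coordinates.\<close>

definition adapted :: "nat multiset \<Rightarrow> (nat \<Rightarrow> complex) \<Rightarrow> mfun \<Rightarrow> bool" where
  "adapted t \<xi> w \<longleftrightarrow> w \<noteq> 0 \<and> pair a \<xi> = 1 \<and> (\<forall>x. app w x \<noteq> 0 \<longrightarrow> app w0 x \<noteq> 0 \<and> mu t x = pair x \<xi> \<and>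
     (\<forall>z. F (\<lambda>k. x k - pair x \<xi> * a k) \<xi> z = 0) \<and>
     (\<forall>b m i. b < length (bs x) \<longrightarrow> bs x ! b = JK_Jordan (Some (pair x \<xi>)) m \<longrightarrow> i < m + m \<longrightarrow> F a (e x b i) \<xi> = 0))"

lemma adapted_exists:
  assumes t: "um t"
  shows "\<exists>\<xi> w. adapted t \<xi> w"
proof -
  obtain \<xi> w where w: "w \<noteq> 0" and a1: "pair a \<xi> = 1"
    and wx: "\<And>x. app w x \<noteq> 0 \<Longrightarrow> app w0 x \<noteq> 0 \<and> mu t x = pair x \<xi>"
    using linear_eigenvalue[OF t] by blast
  have tup: "jtuple (bs x) (Some (pair x \<xi>)) = t" if "app w x \<noteq> 0" for x
    using mu_iff[of x t "pair x \<xi>"] wx[OF that] t by simp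
  define m where "m = Max (set_mset t)"
  have mt: "m \<in># t" unfolding m_def using um_ne[OF t] by (intro Max_in) auto
  have le_m: "m' \<le> m" if "m' \<in># t" for m' unfolding m_def using that by simp
  obtain x0 where "app w x0 \<noteq> 0" using w mfun_nz_iff by blast
  then have m: "0 < m" using jtuple_bounds[of x0 "Some (pair x0 \<xi>)"] tup[of x0] wx[of x0] mt by auto
  let ?T = "\<lambda>x. toep m (lpencil (A x) (A a) (pair x \<xi>))"
  have Tc: "?T x \<in> carrier_mat (n * m) (n * m)" for x by simp
  \<comment> \<open>\<open>R\<close> will be the largest rank of the truncated pencil when each
    point is taken at its own value \<open>pair x \<xi>\<close>; it is attained on an open
    set.\<close>
  let ?P = "\<lambda>k. \<exists>x. rk_ge (?T x) k"
  have P0: "?P 0" unfolding rk_ge_def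
    by (intro exI[of _ x0] exI[of _ "0\<^sub>m 0 (n * m)"] exI[of _ "0\<^sub>m (n * m) 0"]) simp
  have Pb: "\<forall>k. ?P k \<longrightarrow> k < Suc (n * m)" using rk_ge_le_dim[OF Tc] by (auto simp: less_Suc_eq_le)
  obtain R where R: "?P R" and Rmax: "\<And>k. ?P k \<Longrightarrow> k \<le> R"
    using ex_has_greatest_nat[of ?P 0 "\<lambda>k. k" "Suc (n * m)", OF P0 Pb] by blast
  obtain x2 X2 Y2 where X2: "X2 \<in> carrier_mat R (n * m)" and Y2: "Y2 \<in> carrier_mat (n * m) R"
    and nz2: "det (X2 * ?T x2 * Y2) \<noteq> 0" using R unfolding rk_ge_def by auto
  obtain w2 where w2: "\<forall>x. app w2 x = det (X2 * ?T x * Y2)"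
    using ex_mfun[OF bi_funs_comp[OF toep_bi[OF X2 Y2 m, of a] pair_poly[of \<xi>]]] by auto
  have "w2 \<noteq> 0" using w2 nz2 mfun_nz_iff by auto
  then have "w * w2 \<noteq> 0" using w by simp
  moreover have "app w0 x \<noteq> 0 \<and> mu t x = pair x \<xi> \<and>
     (\<forall>z. F (\<lambda>k. x k - pair x \<xi> * a k) \<xi> z = 0) \<and>
     (\<forall>b m i. b < length (bs x) \<longrightarrow> bs x ! b = JK_Jordan (Some (pair x \<xi>)) m \<longrightarrow> i < m + m \<longrightarrow> F a (e x b i) \<xi> = 0)"
    if "app (w * w2) x \<noteq> 0" for x
  proof -
    have x: "app w x \<noteq> 0" "app w2 x \<noteq> 0" using that by auto
    define l where "l = pair x \<xi>"
    define y where "y = (\<lambda>k. x k - l * a k)"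
    interpret G: lie_generic n c y a \<xi> m
    proof
      fix u v h assume uv: "tker m y a u" "tker m y a v" and h: "pair h \<xi> = 0"
      show "(\<Sum>s<m. F h (u s) (v (m - 1 - s))) = 0"
      proof (rule const_rank[OF m X2 Y2 _ _ y_def uv])
        show "det (X2 * toep m (lpencil (A x) (A a) l) * Y2) \<noteq> 0" using x(2) w2 unfolding l_def by simp
        fix r
        \<comment> \<open>Directions with \<open>pair h \<xi> = 0\<close> keep the eigenvalue, so
          the bound \<open>R\<close> holds at the moved point with the same
          \<open>l\<close>.\<close>
        have "pair (\<lambda>k. x k + r * h k) \<xi> = l" using h by (simp add: l_def)
        then show "\<not> rk_ge (toep m (lpencil (A (\<lambda>k. x k + r * h k)) (A a) l)) (Suc R)"
          using Rmax[of "Suc R"] by (metis Suc_n_not_le_n)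
      qed
    qed (use m a1 in auto)
    have x0: "app w0 x \<noteq> 0" using wx[OF x(1)] by simp
    note B = basis[OF x0]
    have tl: "jtuple (bs x) (Some l) = t" using tup[OF x(1)] by (simp add: l_def)
    have "2 \<le> count t m" using t unfolding um_def multiple_maxima_def m_def by simp
    then have "2 \<le> count (mset (bs x)) (JK_Jordan (Some l) m)" using count_jtuple[of "bs x" "Some l" m] tl by simp
    from two_indices[OF this] obtain b1 b2 where b: "b1 \<noteq> b2" "b1 < length (bs x)" "b2 < length (bs x)"
      "bs x ! b1 = JK_Jordan (Some l) m" "bs x ! b2 = JK_Jordan (Some l) m" by blast
    \<comment> \<open>Chains through a block of maximal size: the head of \<open>?L\<close> is its
      vector 0, the last entry of \<open>?U\<close> its vector \<open>m\<close>, and the form at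
      \<open>a\<close> pairs these two to 1.\<close>
    let ?L = "\<lambda>b k. if 0 + k < m then e x b (0 + k) else (\<lambda>p. 0)"
    let ?U = "\<lambda>b k. if k \<le> m - 1 then e x b (m + (m - 1 - k)) else (\<lambda>p. 0)"
    have chL: "chain m y a (?L b1)" "chain m y a (?L b2)"
      by (rule jk_chain_lower[OF B b(2,4) y_def order_refl m] jk_chain_lower[OF B b(3,5) y_def order_refl m])+
    have m1: "m - 1 < m" using m by simp
    have chU: "chain m y a (?U b1)" "chain m y a (?U b2)"
      by (rule jk_chain_upper[OF B b(2,4) y_def order_refl m1] jk_chain_upper[OF B b(3,5) y_def order_refl m1])+
    have Fa: "F a (e x b i) (e x b' i') = (if b = b' then block_B (bs x ! b) $$ (i, i') else 0)"
      if "b < length (bs x)" "b' < length (bs x)" "i < bdim (bs x ! b)" "i' < bdim (bs x ! b')" for b b' i i'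
      using B that unfolding jk_basis_def by blast
    have one: "F a (?L b1 0) (?U b1 (m - 1)) = 1" "F a (?L b2 0) (?U b2 (m - 1)) = 1"
      using Fa[of b1 b1 0 m] Fa[of b2 b2 0 m] b m by (simp_all add: std_skew_def)
    have zero: "F a (?U b2 0) (?L b1 (m - 1)) = 0" "F a (?L b1 0) (?L b2 (m - 1)) = 0"
      "F a (?U b2 0) (?U b1 (m - 1)) = 0" "F a (?U b1 0) (?L b2 (m - 1)) = 0"
      using Fa[of b2 b1 "m + (m - 1)" "m - 1"] Fa[of b1 b2 0 "m - 1"] Fa[of b2 b1 "m + (m - 1)" m]
        Fa[of b1 b2 "m + (m - 1)" "m - 1"] b m by simp_all
    have ker: "F y \<xi> z = 0" for z
      by (rule G.chain_xi_kernel[OF chL(1) chU(1)]) (use one in simp)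
    have orth: "F a (u 0) \<xi> = 0" if "chain m y a u" for u
      by (rule G.chain_orth[OF chL(1) chU(1) chL(2) chU(2) that one zero])
    \<comment> \<open>No block at \<open>l\<close> exceeds \<open>m\<close>, so each basis vector of
      that part heads a padded chain.\<close>
    have "F a (e x b i) \<xi> = 0" if bb: "b < length (bs x)" "bs x ! b = JK_Jordan (Some l) m'" "i < m' + m'" for b m' i
    proof -
      have "m' \<in># t" using set_jtuple[of m' "bs x" "Some l"] nth_mem[OF bb(1)] bb(2) tl by simp
      then have m': "m' \<le> m" by (rule le_m)
      show ?thesis
      proof (cases "i < m'")
        case True
        show ?thesis using orth[OF jk_chain_lower[OF B bb(1,2) y_def m' True]] True by simp
      next
        case False
        then have "i - m' < m'" using bb(3) by simp
        from orth[OF jk_chain_upper[OF B bb(1,2) y_def m' this]] show ?thesis using False by simp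
      qed
    qed
    then show ?thesis using wx[OF x(1)] ker unfolding y_def l_def by blast
  qed
  ultimately show ?thesis unfolding adapted_def using a1 by blast
qed

text \<open>With more tuples than available Kronecker coordinates, the vectors
  \<open>\<xi> t\<close> would be linearly dependent, against the independence of weight
  vectors.\<close>

lemma card_um: "card {t. um t} \<le> sum_mset K"
proof -
  let ?S = "{t. um t}"
  have fS: "finite ?S" by (rule finite_subset[of _ "set_mset JT"]) (auto simp: um_def)
  have "\<forall>t\<in>?S. \<exists>q. adapted t (fst q) (snd q)" using adapted_exists by simp
  from bchoice[OF this] obtain q where q: "\<And>t. um t \<Longrightarrow> adapted t (fst (q t)) (snd (q t))" by auto
  define \<xi> where "\<xi> t = fst (q t)" for t
  define w where "w t = snd (q t)" for t
  have ad: "um t \<Longrightarrow> adapted t (\<xi> t) (w t)" for t unfolding \<xi>_def w_def by (rule q)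
  have w: "\<And>t. um t \<Longrightarrow> w t \<noteq> 0" and a1: "\<And>t. um t \<Longrightarrow> pair a (\<xi> t) = 1"
    and wx: "\<And>t x. um t \<Longrightarrow> app (w t) x \<noteq> 0 \<Longrightarrow> app w0 x \<noteq> 0 \<and> mu t x = pair x (\<xi> t) \<and>
     (\<forall>z. F (\<lambda>k. x k - pair x (\<xi> t) * a k) (\<xi> t) z = 0) \<and>
     (\<forall>b m i. b < length (bs x) \<longrightarrow> bs x ! b = JK_Jordan (Some (pair x (\<xi> t))) m \<longrightarrow> i < m + m \<longrightarrow> F a (e x b i) (\<xi> t) = 0)"
    using ad unfolding adapted_def by blast+
  \<comment> \<open>The kernel condition is polynomial in the point and so holds everywhere; in
    bracket form, \<open>\<xi> t\<close> is an eigenvector of weight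
    \<open>F a (\<xi> t)\<close>.\<close>
  have semi: "F x (\<xi> t) z = pair x (\<xi> t) * F a (\<xi> t) z" if t: "um t" for t x z
  proof -
    have "(\<lambda>x. F x (\<xi> t) z - pair x (\<xi> t) * F a (\<xi> t) z) \<in> polynomial_funs"
      by (intro PF.diff PF.mult PF.const F_poly pair_poly)
    then obtain d where d: "\<forall>x. app d x = F x (\<xi> t) z - pair x (\<xi> t) * F a (\<xi> t) z" using ex_mfun by blast
    have "app d x = 0" if "x \<in> {x\<in>UNIV. app (w t) x \<noteq> 0}" for x
      using wx[OF t, of x] that d by simp
    then have "d = 0" using zdense_open[OF zdense_UNIV w[OF t]] unfolding zdense_def by blast
    then have "app d x = 0" by simp
    then show ?thesis using d by simp
  qed
  define W where "W = w0 * (\<Prod>t\<in>?S. w t)"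
  have "W \<noteq> 0" unfolding W_def using w0 w fS by simp
  then obtain x where "app W x \<noteq> 0" using mfun_nz_iff by blast
  moreover have app_prod: "app (prod f T) x = (\<Prod>t\<in>T. app (f t) x)" for f :: "nat multiset \<Rightarrow> mfun" and T
    by (induction T rule: infinite_finite_induct) auto
  ultimately have x0: "app w0 x \<noteq> 0" and xt: "\<And>t. um t \<Longrightarrow> app (w t) x \<noteq> 0"
    unfolding W_def using fS by auto
  have dist: "pair x (\<xi> t) \<noteq> pair x (\<xi> t')" if "um t" "um t'" "t \<noteq> t'" for t t'
    using mu_iff[OF x0 that(1), of "pair x (\<xi> t)"] mu_iff[OF x0 that(2), of "pair x (\<xi> t)"]
      wx[OF that(1) xt[OF that(1)]] wx[OF that(2) xt[OF that(2)]] that(3) by auto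
  note B = basis[OF x0]
  show ?thesis
  proof (rule ccontr)
    assume "\<not> ?thesis"
    then have less: "sum_mset K < card ?S" by simp
    have "\<forall>t. \<exists>g. \<forall>p<n. \<xi> t p = (\<Sum>b<length (bs x). \<Sum>i<bdim (bs x ! b). g b i * e x b i p)"
      using B unfolding jk_basis_def by blast
    from choice[OF this] obtain g
      where g: "\<forall>t. \<forall>p<n. \<xi> t p = (\<Sum>b<length (bs x). \<Sum>i<bdim (bs x ! b). g t b i * e x b i p)"
      by (elim exE)
    have g0: "g t b i = 0" if t: "um t" and b: "b < length (bs x)" "i < bdim (bs x ! b)" "kdim (bs x ! b) \<le> i" for t b i
    proof (rule jk_kernel_coeffs[OF B no_None[OF x0] _ _ g[THEN spec, of t] b])
      show "F (\<lambda>k. x k - pair x (\<xi> t) * a k) (\<xi> t) z = 0" for z using wx[OF t xt[OF t]] by blast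
      show "F a (e x b i) (\<xi> t) = 0"
        if "b < length (bs x)" "bs x ! b = JK_Jordan (Some (pair x (\<xi> t))) m" "i < m + m" for b m i
        using wx[OF t xt[OF t]] that by blast
    qed
    define I where "I = Sigma {..<length (bs x)} (\<lambda>b. {..<kdim (bs x ! b)})"
    have fI: "finite I" unfolding I_def by simp
    have "card I = sum_mset K" unfolding I_def using sum_kdim[of "bs x"] K[OF x0] by simp
    then have cI: "card I < card ?S" using less by simp
    obtain en where en: "bij_betw en {0..<card ?S} ?S" using ex_bij_betw_nat_finite[OF fS] by blast
    obtain v where v: "v \<in> carrier_vec (card ?S)" "v \<noteq> 0\<^sub>v (card ?S)"
      and vI: "\<And>q. q \<in> I \<Longrightarrow> (\<Sum>j<card ?S. g (en j) (fst q) (snd q) * v $ j) = 0"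
      using exists_kernel_vec[OF fI cI, of "\<lambda>q j. g (en j) (fst q) (snd q)"] by blast
    have eum: "um (en j)" if "j < card ?S" for j using bij_betwE[OF en] that by auto
    define u where "u t = v $ (the_inv_into {0..<card ?S} en t)" for t
    have ue: "u (en j) = v $ j" if "j < card ?S" for j
      unfolding u_def using en that by (simp add: bij_betw_def the_inv_into_f_f)
    have sumS: "(\<Sum>t\<in>?S. u t * h t) = (\<Sum>j<card ?S. h (en j) * v $ j)" for h
    proof -
      have "(\<Sum>t\<in>?S. u t * h t) = (\<Sum>j\<in>{0..<card ?S}. u (en j) * h (en j))"
        by (rule sum.reindex_bij_betw[OF en, symmetric])
      then show ?thesis using ue by (simp add: lessThan_atLeast0 mult.commute)
    qed
    have "\<forall>t\<in>?S. u t = 0"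
    proof (rule weight_vectors_independent[OF fS, of \<xi> "\<lambda>t. F a (\<xi> t)"])
      fix t x z assume "t \<in> ?S"
      then show "F x (\<xi> t) z = pair x (\<xi> t) * F a (\<xi> t) z" by (intro semi) simp
    next
      fix t assume t: "t \<in> ?S"
      show "\<exists>p<n. \<xi> t p \<noteq> 0"
      proof (rule ccontr)
        assume "\<not> ?thesis"
        then have "pair a (\<xi> t) = 0" by (simp add: pair_def)
        then show False using a1[of t] t by simp
      qed
    next
      fix t t' assume tt: "t \<in> ?S" "t' \<in> ?S" "t \<noteq> t'"
      then have um: "um t" "um t'" by auto
      show "\<exists>z. F a (\<xi> t) z \<noteq> F a (\<xi> t') z"
      proof (rule ccontr)
        assume "\<not> ?thesis"
        then have eq: "F a (\<xi> t) z = F a (\<xi> t') z" for z by blast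
        let ?f = "pair x (\<xi> t)" and ?f' = "pair x (\<xi> t')"
        \<comment> \<open>\<open>?v + s * ?v'\<close> is the combination of the overview taken at
          \<open>x + s * a\<close>; its slope is \<open>\<xi> t - \<xi> t'\<close> since both forms
          are 1 at \<open>a\<close>. Equal weights put it into the kernel of the form at
          \<open>x + s * a\<close>.\<close>
        let ?v = "\<lambda>p. ?f' * \<xi> t p + (- ?f) * \<xi> t' p" and ?v' = "\<lambda>p. \<xi> t p + (- 1) * \<xi> t' p"
        have Fl: "F y (\<lambda>p. r * \<xi> t p + s * \<xi> t' p) z = r * F y (\<xi> t) z + s * F y (\<xi> t') z" for y r s z
          by (simp only: F_left)
        have Fl': "F y ?v' z = F y (\<xi> t) z + (- 1) * F y (\<xi> t') z" for y z
          by (simp only: F_left)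
        have K2: "2 \<notin># kronecker_ks (bs x)" and K1: "count (kronecker_ks (bs x)) 1 \<le> 1"
          using K[OF x0] K_cond by auto
        have "\<exists>s s'. (s \<noteq> 0 \<or> s' \<noteq> 0) \<and> (\<forall>p<n. s * ?v p + s' * ?v' p = 0)"
        proof (rule linear_kernel_dependent[OF B no_None[OF x0] K2 K1])
          show "F x ?v z = 0" for z unfolding Fl semi[OF um(1), of x] semi[OF um(2), of x] eq by simp
          show "F a ?v' z = 0" for z unfolding Fl' eq by simp
          show "F x ?v' z + F a ?v z = 0" for z
            unfolding Fl Fl' semi[OF um(1), of x] semi[OF um(2), of x] eq by (simp add: algebra_simps)
        qed
        then obtain s s' where ss: "s \<noteq> 0 \<or> s' \<noteq> 0" and z: "\<forall>p<n. s * ?v p + s' * ?v' p = 0" by blast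
        have pz: "pair y (\<lambda>p. s * ?v p + s' * ?v' p) = 0" for y
        proof -
          have "pair y (\<lambda>p. s * ?v p + s' * ?v' p) = pair y (\<lambda>p. 0)"
            by (rule pair_cong) (rule z[rule_format])
          then show ?thesis by (simp only: pair_lin(3))
        qed
        have pl: "pair y (\<lambda>p. s * ?v p + s' * ?v' p) =
          s * (?f' * pair y (\<xi> t) + (- ?f) * pair y (\<xi> t')) + s' * (pair y (\<xi> t) + (- 1) * pair y (\<xi> t'))" for y
          by (simp only: pair_lin)
        have comb: "s * (?f' * pair y (\<xi> t) + (- ?f) * pair y (\<xi> t')) + s' * (pair y (\<xi> t) + (- 1) * pair y (\<xi> t')) = 0" for y
          by (rule trans[OF pl[symmetric] pz])
        \<comment> \<open>At \<open>a\<close> the vector \<open>?v'\<close> pairs to 0, at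
          \<open>x\<close> the vector \<open>?v\<close> does; the two evaluations isolate the
          coefficients, and \<open>dist\<close> makes the remaining factors nonzero.\<close>
        have "s * (?f' - ?f) = 0" using comb[of a] a1[OF um(1)] a1[OF um(2)] by simp
        then have "s = 0" using dist[OF um tt(3)] by simp
        moreover have "s' * (?f - ?f') = 0" using comb[of x] calculation by simp
        then have "s' = 0" using dist[OF um tt(3)] by simp
        ultimately show False using ss by simp
      qed
    next
      show "\<forall>p<n. (\<Sum>t\<in>?S. u t * \<xi> t p) = 0"
      proof (intro allI impI)
        fix p assume p: "p < n"
        have "(\<Sum>t\<in>?S. u t * \<xi> t p) = (\<Sum>j<card ?S. \<xi> (en j) p * v $ j)" by (rule sumS)
        also have "\<dots> = (\<Sum>j<card ?S. \<Sum>b<length (bs x). \<Sum>i<bdim (bs x ! b). g (en j) b i * v $ j * e x b i p)"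
          using g p by (simp add: sum_distrib_right sum_distrib_left ac_simps)
        also have "\<dots> = (\<Sum>b<length (bs x). \<Sum>j<card ?S. \<Sum>i<bdim (bs x ! b). g (en j) b i * v $ j * e x b i p)"
          by (rule sum.swap)
        also have "\<dots> = (\<Sum>b<length (bs x). \<Sum>i<bdim (bs x ! b). \<Sum>j<card ?S. g (en j) b i * v $ j * e x b i p)"
          by (intro sum.cong refl sum.swap)
        also have "\<dots> = (\<Sum>b<length (bs x). \<Sum>i<bdim (bs x ! b). (\<Sum>j<card ?S. g (en j) b i * v $ j) * e x b i p)"
          by (simp add: sum_distrib_right)
        also have "\<dots> = 0"
        proof (intro sum.neutral ballI)
          fix b i assume b: "b \<in> {..<length (bs x)}" and i: "i \<in> {..<bdim (bs x ! b)}"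
          have "(\<Sum>j<card ?S. g (en j) b i * v $ j) = 0"
          proof (cases "i < kdim (bs x ! b)")
            case True
            then show ?thesis using vI[of "(b, i)"] b unfolding I_def by simp
          next
            case False
            have "g (en j) b i = 0" if "j < card ?S" for j
              using g0[OF eum[OF that], of b i] False b i by auto
            then show ?thesis by simp
          qed
          then show "(\<Sum>j<card ?S. g (en j) b i * v $ j) * e x b i p = 0" by simp
        qed
        finally show "(\<Sum>t\<in>?S. u t * \<xi> t p) = 0" .
      qed
    qed
    then have vj: "v $ j = 0" if "j < card ?S" for j
      using ue[OF that] eum[OF that] that by simp
    have "v = 0\<^sub>v (card ?S)" using v(1) vj by (intro eq_vecI) auto
    then show False using v(2) by simp
  qed
qed

end

theorem theorem24:
  fixes n :: nat and c :: "nat \<Rightarrow> nat \<Rightarrow> nat \<Rightarrow> complex"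
    and K :: "nat multiset" and JT :: "nat multiset multiset"
  assumes "lie_structure_constants n c"
    and "lie_jk_invariants n c (K, JT)"
    and "2 \<notin># K"
    and "count K 1 \<le> 1"
  shows "J_um JT \<le> sum_mset K"
proof -
  interpret lie n c by unfold_locales (rule assms(1))
  obtain U where U: "zariski_open n U" "U \<noteq> {}"
    and inv: "\<And>x a. (x, a) \<in> U \<Longrightarrow> \<exists>bs. jk_decomposition n (lie_form n c x) (lie_form n c a) bs \<and> jk_type bs = (K, JT)"
    using assms(2) unfolding lie_jk_invariants_def by blast
  obtain S where S: "S \<subseteq> poly_fun n" "U = {(x,a) \<in> carrier_vec n \<times> carrier_vec n. \<exists>p\<in>S. p (x,a) \<noteq> 0}"
    using U(1) unfolding zariski_open_def by blast
  obtain xv av p where p: "xv \<in> carrier_vec n" "av \<in> carrier_vec n" "p \<in> S" "p (xv, av) \<noteq> 0"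
    using U(2) S(2) by auto
  define x0 where "x0 = (\<lambda>i. xv $ i)"
  define a0 where "a0 = (\<lambda>i. av $ i)"
  have xa: "vec n x0 = xv" "vec n a0 = av" using p unfolding x0_def a0_def by auto
  have pp: "p \<in> poly_fun n" using p(3) S(1) by blast
  have memU: "(vec n x, vec n a) \<in> U" if "p (vec n x, vec n a) \<noteq> 0" for x a
    using that p(3) S(2) by auto
  have inv': "\<exists>bs. jk_decomposition n (A x) (A a) bs \<and> kronecker_ks bs = K \<and> jordan_tuples bs = JT"
    if "p (vec n x, vec n a) \<noteq> 0" for x a
    using inv[OF memU[OF that]] unfolding A_def jk_type_def by simp
  obtain b0 where b0: "jk_decomposition n (A x0) (A a0) b0" "kronecker_ks b0 = K"
    using inv'[of x0 a0] p xa by auto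
  \<comment> \<open>Off the finite spectrum the point \<open>x0 - l * a0\<close> has a form of
    corank \<open>size K\<close>. So some minor of that size is a nonzero polynomial, and
    \<open>a\<close> can be chosen regular and generic for \<open>p\<close> at once.\<close>
  have "finite {l. Some l \<in> jordan_eigenvalues b0}"
    using finite_vimageI[OF finite_jordan_eigenvalues, of Some b0] by (simp add: vimage_def)
  then obtain l where "l \<notin> {l. Some l \<in> jordan_eigenvalues b0}" by (rule ex_notin_finite)
  then have "jtuple b0 (Some l) = {#}" using jordan_eigenvalues_iff by simp
  moreover have "cork (toep 1 (lpencil (A x0) (A a0) l)) (sum_list (map (loss l 1) b0))"
    by (rule jk_decomposition_cork(1)[OF b0(1)]) simp_all
  ultimately have ck: "cork (A (\<lambda>k. x0 k - l * a0 k)) (size K)"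
    unfolding toep_1_lpencil by (simp add: sum_list_loss b0(2))
  have sK: "size K \<le> n" by (rule cork_le[OF ck A_carrier])
  have "rk_ge (A (\<lambda>k. x0 k - l * a0 k)) (n - size K)" using cork_rk[OF ck A_carrier] sK by simp
  then obtain X Y where X: "X \<in> carrier_mat (n - size K) n" and Y: "Y \<in> carrier_mat n (n - size K)"
    and nz: "det (X * A (\<lambda>k. x0 k - l * a0 k) * Y) \<noteq> 0" unfolding rk_ge_def by auto
  obtain w1 where w1: "\<forall>a. app w1 a = det (X * A a * Y)" using ex_mfun[OF det_A_poly[OF X Y]] by blast
  obtain w2 where w2: "\<forall>a. app w2 a = p (xv, vec n a)" using ex_mfun[OF poly_fun_right[OF pp]] by blast
  have "w1 \<noteq> 0" using w1 nz mfun_nz_iff by auto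
  moreover have "w2 \<noteq> 0" using w2 p(4) xa mfun_nz_iff by metis
  ultimately have "w1 * w2 \<noteq> 0" by simp
  then obtain a where "app (w1 * w2) a \<noteq> 0" using mfun_nz_iff by blast
  then have a: "det (X * A a * Y) \<noteq> 0" "p (xv, vec n a) \<noteq> 0" using w1 w2 by auto
  obtain w0 where w0: "\<forall>x. app w0 x = p (vec n x, vec n a)" using ex_mfun[OF poly_fun_left[OF pp]] by blast
  have w00: "w0 \<noteq> 0" using w0 a(2) xa mfun_nz_iff by metis
  have "\<exists>bs e. app w0 x \<noteq> 0 \<longrightarrow> jk_decomposition n (A x) (A a) bs \<and> kronecker_ks bs = K \<and>
      jordan_tuples bs = JT \<and> jk_basis x a bs e" for x
    using inv'[of x a] jk_basis_exists[of x a] w0 by metis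
  then obtain bs e where be: "\<And>x. app w0 x \<noteq> 0 \<Longrightarrow> jk_decomposition n (A x) (A a) (bs x) \<and> kronecker_ks (bs x) = K \<and>
      jordan_tuples (bs x) = JT \<and> jk_basis x a (bs x) (e x)" by metis
  interpret lie_jk n c a w0 bs e K JT X Y
    by unfold_locales (use w00 be sK X Y a(1) assms in auto)
  have "{t \<in> set_mset JT. count JT t = 1 \<and> multiple_maxima t} = {t. um t}"
    unfolding um_def by auto
  then show ?thesis unfolding J_um_def using card_um by simp
qed

end
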